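(* Let $d,k\ge1$, let $\ell_1,\dots,\ell_k$ be distinct points of $\mathbb{Z}^d$, and let $\Omega=\bigcup_{i=1}^k\big([-1/2,1/2]^d+\ell_i\big)$. Let $x_1,\dots,x_m$ be independent random variables uniformly distributed in $[-1/2,1/2]^d$, let $\varepsilon>0$ and $0<\alpha<1$. If $$m\ \ge\ \frac{10}{\alpha^2}\cdot k\cdot\log\left(\frac{2k}{\varepsilon}\right),$$ then, with probability at least $1-\varepsilon$, the inequalities $$m(1-\alpha)\|f\|^2\ \le\ \sum_{r=1}^m\sum_{\ell\in\mathbb{Z}^d}|f(x_r+\ell)|^2\ \le\ m(1+\alpha)\|f\|^2$$ hold for every $f\in PW_\Omega$.
   Context: The Fourier transform is $\hat f(\omega)=\int_{\mathbb{R}^d}f(x)e^{-2\pi \mathrm{i}\langle x,\omega\rangle}\,dx$ (extended to $L^2$), and $\|\cdot\|$ is the $L^2(\mathbb{R}^d)$ norm. For a compact set $\Omega\subset\mathbb{R}^d$, the Paley-Wiener space is $PW_\Omega=\{f\in L^2(\mathbb{R}^d): \mathrm{Supp}(\hat f)\subseteq\Omega\}$; its elements are identified with their continuous representatives, so that point values make sense. *)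

theory Defs
  imports "HOL-Probability.Probability"
begin

definition int_lattice :: "(real ^ 'd) set" where
  "int_lattice = {l. \<forall>i. l $ i \<in> \<int>}"

definition unit_cube :: "(real ^ 'd) set" where
  "unit_cube = cbox (\<chi> i. - 1 / 2) (\<chi> i. 1 / 2)"

definition L2 :: "(real ^ 'd \<Rightarrow> complex) set" where
  "L2 = {f \<in> borel_measurable lborel. integrable lborel (\<lambda>x. (cmod (f x))\<^sup>2)}"

definition L2_norm :: "(real ^ 'd \<Rightarrow> complex) \<Rightarrow> real" where
  "L2_norm f = sqrt (LINT x|lborel. (cmod (f x))\<^sup>2)"

text \<open>The squared distance is a nonnegative extended integral, so that differences
  that are not square integrable have infinite distance instead of the default value 0
  of the Bochner integral.\<close>

definition L2_tendsto ::
    "(nat \<Rightarrow> real ^ 'd \<Rightarrow> complex) \<Rightarrow> (real ^ 'd \<Rightarrow> complex) \<Rightarrow> bool" where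
  "L2_tendsto h f \<longleftrightarrow>
     (\<lambda>n. \<integral>\<^sup>+ x. ennreal ((cmod (h n x - f x))\<^sup>2) \<partial>lborel) \<longlonglongrightarrow> 0"

definition fourier :: "(real ^ 'd \<Rightarrow> complex) \<Rightarrow> real ^ 'd \<Rightarrow> complex" where
  "fourier f \<omega> =
     (LINT x|lborel. f x * exp (- 2 * of_real pi * \<i> * of_real (x \<bullet> \<omega>)))"

text \<open>The extension of the Fourier integral from \<open>L\<^sup>1 \<inter> L\<^sup>2\<close> to \<open>L\<^sup>2\<close> by density. It is stated as
  a relation because an \<open>L\<^sup>2\<close> transform is determined only up to null sets; by Plancherel's
  theorem every \<open>f \<in> L2\<close> has such a \<open>g\<close>, which is unique almost everywhere.\<close>

definition has_fourier_L2 ::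
    "(real ^ 'd \<Rightarrow> complex) \<Rightarrow> (real ^ 'd \<Rightarrow> complex) \<Rightarrow> bool" where
  "has_fourier_L2 f g \<longleftrightarrow> f \<in> L2 \<and> g \<in> L2 \<and>
     (\<exists>h. (\<forall>n. integrable lborel (h n) \<and> h n \<in> L2) \<and>
          L2_tendsto h f \<and> L2_tendsto (\<lambda>n. fourier (h n)) g)"

text \<open>The support of a function up to null sets: the complement of the largest open set
  on which it vanishes almost everywhere.\<close>

definition ess_support :: "(real ^ 'd \<Rightarrow> complex) \<Rightarrow> (real ^ 'd) set" where
  "ess_support g = - \<Union> {U. open U \<and> (AE x in lborel. x \<in> U \<longrightarrow> g x = 0)}"

text \<open>Elements are the continuous representatives themselves.\<close>

definition paley_wiener :: "(real ^ 'd) set \<Rightarrow> (real ^ 'd \<Rightarrow> complex) set" where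
  "paley_wiener \<Omega> = {f \<in> L2. continuous_on UNIV f \<and>
     (\<exists>g. has_fourier_L2 f g \<and> ess_support g \<subseteq> \<Omega>)}"

end

theory Submission
  imports Defs
begin

text \<open>Let \<open>g\<close> be the Fourier transform of \<open>f\<close> and \<open>u\<^sub>i\<close> the translate to the unit cube \<open>C\<close> of the part of \<open>g\<close>
  on the \<open>i\<close>-th cube. For fixed \<open>x\<close> the values \<open>f (x + j)\<close> are Fourier coefficients on \<open>C\<close>, and Parseval gives
  \<open>\<Sum>\<^sub>j |f (x + j)|\<^sup>2 = \<integral>\<^sub>C |\<Sum>\<^sub>i u\<^sub>i(\<omega>) exp (2 \<pi> i l\<^sub>i \<bullet> x)|\<^sup>2 d\<omega>\<close>. Summed over the sample points, this is the integral of the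
  quadratic form of the frame operator \<open>S = \<Sum>\<^sub>r v\<^sub>r v\<^sub>r\<^sup>*\<close> at \<open>(u\<^sub>1(\<omega>), ..., u\<^sub>k(\<omega>))\<close>, where the vectors
  \<open>v\<^sub>r = (exp (- 2 \<pi> i l\<^sub>i \<bullet> x\<^sub>r))\<^sub>i\<close> are independent, have squared norm \<open>k\<close> and satisfy \<open>E v v\<^sup>* = 1\<close>. It remains to show that
  \<open>m (1 - \<alpha>) \<le> S \<le> m (1 + \<alpha>)\<close> with probability at least \<open>1 - \<epsilon>\<close>.

  For this matrix Chernoff bound, \<open>exp (\<theta> S)\<close> is replaced by \<open>(1 + (\<theta> / n) S)\<^sup>n\<close> with \<open>n\<close> even and tending to infinity.
  A rank-one update changes the trace of the \<open>n\<close>-th power by an expression in the moments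
  \<open>\<mu>\<^sub>j = \<langle>v, B\<^sup>j v\<rangle>\<close>, which are log-convex, so that \<open>\<mu>\<^sub>a \<mu>\<^sub>b \<le> k \<mu>\<^bsub>a+b\<^esub>\<close>; moreover \<open>E \<mu>\<^sub>j\<close> is the trace of \<open>B\<^sup>j\<close>. This gives a
  recursion in the number of samples without the Golden-Thompson inequality.\<close>

section \<open>Moments of positive semidefinite operators\<close>

text \<open>Both tails come from one argument, with a sign \<sigma> put into \<tau> =
  \<sigma>\<theta>/n. For negative \<tau> the operator 1 + \<tau>S must stay positive, which forces
  n to be large compared with the number m of samples. Its lower bound \<open>b\<close> then tends
  to 1, so that the cost of using it disappears in the limit. With \<theta> = \<alpha>/(4k) each
  tail is at most k exp(-\<alpha>^2 m/(8k)). The constant 10 in place of 8 is slack, and the union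
  of the two tails produces 2k/\<epsilon>.

  The analytic obstacle is that the inequalities concern actual point values and all f at once.
  Point values come from Fourier inversion at points of continuity. The exceptional set depends on
  the sample alone, because the matrix inequality holds for all vectors and hence at every \<omega>.
  Of Plancherel's theorem only |g| \<le> |f| is proved in advance; the reverse bound falls out of
  periodization. The event is an intersection over uncountably many f, and it is measurable because
  each condition is closed in the product space.\<close>

lemma logconvex_exchange:
  fixes \<mu> :: "nat \<Rightarrow> real"
  assumes nn: "\<And>n. 0 \<le> \<mu> n" and lc: "\<And>n. (\<mu> (Suc n))\<^sup>2 \<le> \<mu> n * \<mu> (Suc (Suc n))"
    and "m \<le> n"
  shows "\<mu> (Suc m) * \<mu> n \<le> \<mu> m * \<mu> (Suc n)"
  using \<open>m \<le> n\<close>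
proof (induction n rule: dec_induct)
  case base
  show ?case by simp
next
  case (step n)
  show ?case
  proof (cases "\<mu> (Suc n) = 0")
    case True
    then show ?thesis using nn[of m] nn[of "Suc (Suc n)"] by simp
  next
    case False
    then have pos: "0 < \<mu> (Suc n)" using nn[of "Suc n"] by linarith
    have "\<mu> n \<noteq> 0"
    proof
      assume "\<mu> n = 0"
      then have "(\<mu> (Suc n))\<^sup>2 \<le> 0" using lc[of n] by simp
      then show False using False by simp
    qed
    then have pos': "0 < \<mu> n" using nn[of n] by linarith
    \<comment> \<open>The claim is multiplied by \<open>\<mu> n * \<mu> (Suc n)\<close>, now known
      to be positive, and becomes the induction hypothesis times log-convexity at
      \<open>n\<close>.\<close>
    have "(\<mu> (Suc m) * \<mu> (Suc n)) * (\<mu> n * \<mu> (Suc n))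
        = (\<mu> (Suc m) * \<mu> n) * (\<mu> (Suc n))\<^sup>2"
      by (simp add: power2_eq_square)
    also have "\<dots> \<le> (\<mu> m * \<mu> (Suc n)) * (\<mu> n * \<mu> (Suc (Suc n)))"
      by (intro mult_mono step.IH lc mult_nonneg_nonneg nn) auto
    also have "\<dots> = (\<mu> m * \<mu> (Suc (Suc n))) * (\<mu> n * \<mu> (Suc n))"
      by simp
    finally show ?thesis
      using pos pos' by (simp only: mult_le_cancel_right) (simp add: zero_less_mult_iff)
  qed
qed

text \<open>Moving one unit of index from the smaller to the larger factor never decreases the
  product; this is repeated until the smaller index is 0. For moments of a measure on the half-line
  it is Chebyshev's inequality, obtained here without a spectral decomposition.\<close>

lemma logconvex_mult_le:
  fixes \<mu> :: "nat \<Rightarrow> real"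
  assumes nn: "\<And>n. 0 \<le> \<mu> n" and lc: "\<And>n. (\<mu> (Suc n))\<^sup>2 \<le> \<mu> n * \<mu> (Suc (Suc n))"
  shows "\<mu> a * \<mu> b \<le> \<mu> 0 * \<mu> (a + b)"
proof -
  have *: "\<mu> a * \<mu> b \<le> \<mu> 0 * \<mu> (a + b)" if "a \<le> b" for a b
    using that
  proof (induction a arbitrary: b)
    case 0
    show ?case by simp
  next
    case (Suc a)
    have "\<mu> (Suc a) * \<mu> b \<le> \<mu> a * \<mu> (Suc b)"
      using Suc.prems by (intro logconvex_exchange nn lc) simp
    also have "\<dots> \<le> \<mu> 0 * \<mu> (a + Suc b)"
      using Suc.prems by (intro Suc.IH) simp
    finally show ?case by simp
  qed
  show ?thesis
    using *[of a b] *[of b a] by (cases "a \<le> b") (simp_all add: mult.commute add.commute)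
qed

lemma even_or_odd_half: "\<exists>p. n = 2 * p \<or> n = Suc (2 * p)"
  by presburger

lemma discriminant_le:
  fixes a b c :: real
  assumes "\<And>t. 0 \<le> a + 2 * t * b + t\<^sup>2 * c" "0 \<le> c"
  shows "b\<^sup>2 \<le> a * c"
proof (cases "c = 0")
  case True
  show ?thesis
  proof (cases "b = 0")
    case False
    \<comment> \<open>An affine function of \<open>t\<close> that is bounded below is constant: this
      \<open>t\<close> would give the value -1.\<close>
    then show ?thesis using assms(1)[of "- (a + 1) / (2 * b)"] True by (simp add: field_simps)
  qed (use True in simp)
next
  case False
  then have "0 < c" using assms by simp
  \<comment> \<open>The minimiser of the quadratic in \<open>t\<close>.\<close>
  then show ?thesis using assms(1)[of "- b / c"]
    by (simp add: field_simps power2_eq_square)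
qed

section \<open>Finite-dimensional inner products and the moments of a positive semidefinite
  operator\<close>

definition ip :: "'i set \<Rightarrow> ('i \<Rightarrow> complex) \<Rightarrow> ('i \<Rightarrow> complex) \<Rightarrow> complex" where
  "ip I u w = (\<Sum>i\<in>I. cnj (u i) * w i)"

abbreviation basis_vec :: "'i \<Rightarrow> 'i \<Rightarrow> complex" where
  "basis_vec i \<equiv> (\<lambda>j. of_bool (j = i))"

lemma cnj_ip: "cnj (ip I u w) = ip I w u"
  by (simp add: ip_def mult.commute)

lemma ip_add_right: "ip I u (\<lambda>j. w j + z j) = ip I u w + ip I u z"
  by (simp add: ip_def algebra_simps sum.distrib)

lemma ip_add_left: "ip I (\<lambda>j. w j + z j) u = ip I w u + ip I z u"
  by (simp add: ip_def algebra_simps sum.distrib)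

lemma ip_scale_right: "ip I u (\<lambda>j. c * w j) = c * ip I u w"
  by (simp add: ip_def sum_distrib_left mult_ac)

lemma ip_scale_left: "ip I (\<lambda>j. c * w j) u = cnj c * ip I w u"
  by (simp add: ip_def sum_distrib_left mult_ac)

lemma ip_sum_right: "ip I u (\<lambda>j. \<Sum>s\<in>F. c s * w s j) = (\<Sum>s\<in>F. c s * ip I u (w s))"
  unfolding ip_def sum_distrib_left by (subst sum.swap) (simp add: mult_ac)

lemma ip_sum_left: "ip I (\<lambda>j. \<Sum>s\<in>F. c s * w s j) u = (\<Sum>s\<in>F. cnj (c s) * ip I (w s) u)"
  unfolding ip_def cnj_sum sum_distrib_left sum_distrib_right by (subst sum.swap) (simp add: mult_ac)

lemma ip_self: "ip I u u = of_real (\<Sum>i\<in>I. (cmod (u i))\<^sup>2)"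
  by (simp add: ip_def complex_norm_square mult.commute del: of_real_power)

lemma ip_basis_left: "finite I \<Longrightarrow> i \<in> I \<Longrightarrow> ip I (basis_vec i) u = u i"
  by (simp add: ip_def of_bool_def if_distrib[where f = cnj] if_distrib[where f = "\<lambda>x. x * _"] sum.delta cong: if_cong)

lemma ip_basis_right: "finite I \<Longrightarrow> i \<in> I \<Longrightarrow> ip I u (basis_vec i) = cnj (u i)"
  by (metis cnj_ip ip_basis_left)

lemma cauchy_schwarz_ip: "(cmod (ip I u w))\<^sup>2 \<le> Re (ip I u u) * Re (ip I w w)"
proof -
  have "cmod (ip I u w) \<le> (\<Sum>i\<in>I. cmod (u i) * cmod (w i))"
    unfolding ip_def by (rule order_trans[OF norm_sum]) (simp add: norm_mult)
  then have "(cmod (ip I u w))\<^sup>2 \<le> (\<Sum>i\<in>I. cmod (u i) * cmod (w i))\<^sup>2"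
    by (intro power_mono) auto
  also have "\<dots> \<le> (\<Sum>i\<in>I. (cmod (u i))\<^sup>2) * (\<Sum>i\<in>I. (cmod (w i))\<^sup>2)"
    by (rule Cauchy_Schwarz_ineq_sum)
  finally show ?thesis by (simp add: ip_self)
qed

text \<open>\<open>B\<close> is a function and not a matrix, so that powers are iterates and a
  rank-one update is an equation between functions. Vectors live on the whole index type while
  \<open>ip\<close> sees only \<open>I\<close>; this is the source of the support hypotheses
  wherever a vector is expanded in the basis.\<close>

locale psd_op =
  fixes I :: "'i set" and B :: "('i \<Rightarrow> complex) \<Rightarrow> ('i \<Rightarrow> complex)"
  assumes fin: "finite I"
    and add: "B (\<lambda>j. u j + w j) = (\<lambda>j. B u j + B w j)"
    and scale: "B (\<lambda>j. c * u j) = (\<lambda>j. c * B u j)"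
    and selfadj: "ip I (B u) w = ip I u (B w)"
    and psd: "0 \<le> Re (ip I u (B u))"
begin

text \<open>The n-th moment of the spectral measure of \<open>B\<close> at \<open>u\<close>. The
  real part discards nothing, by \<open>of_real_moment\<close>.\<close>

definition moment :: "('i \<Rightarrow> complex) \<Rightarrow> nat \<Rightarrow> real" where
  "moment u n = Re (ip I u ((B ^^ n) u))"

definition trace_pow :: "nat \<Rightarrow> real" where
  "trace_pow n = (\<Sum>i\<in>I. moment (basis_vec i) n)"

lemma pow_add: "(B ^^ n) (\<lambda>j. u j + w j) = (\<lambda>j. (B ^^ n) u j + (B ^^ n) w j)"
  by (induction n) (simp_all add: add)

lemma pow_scale: "(B ^^ n) (\<lambda>j. c * u j) = (\<lambda>j. c * (B ^^ n) u j)"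
  by (induction n) (simp_all add: scale)

lemma pow_sum: "(B ^^ n) (\<lambda>j. \<Sum>s\<in>F. c s * w s j) = (\<lambda>j. \<Sum>s\<in>F. c s * (B ^^ n) (w s) j)"
proof (induction F rule: infinite_finite_induct)
  case (insert s F)
  then show ?case by (simp add: pow_add pow_scale)
\<comment> \<open>For an empty or infinite \<open>F\<close> both sums are 0, and homogeneity with
  the scalar 0 shows that the power maps 0 to 0.\<close>
qed (use pow_scale[of n 0 "\<lambda>_. 0"] in simp_all)

lemma pow_selfadj: "ip I ((B ^^ n) u) w = ip I u ((B ^^ n) w)"
  by (induction n arbitrary: w) (simp_all add: selfadj, metis funpow_swap1)

lemma ip_pow_pow: "ip I ((B ^^ a) u) ((B ^^ b) w) = ip I u ((B ^^ (a + b)) w)"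
  by (simp add: pow_selfadj funpow_add)

lemma of_real_moment: "complex_of_real (moment u n) = ip I u ((B ^^ n) u)"
proof -
  have "cnj (ip I u ((B ^^ n) u)) = ip I u ((B ^^ n) u)"
    by (simp add: cnj_ip pow_selfadj)
  then show ?thesis
    by (simp add: moment_def complex_eq_iff)
qed

lemma moment_0: "moment u 0 = (\<Sum>i\<in>I. (cmod (u i))\<^sup>2)"
  by (simp add: moment_def ip_self)

lemma moment_even: "moment u (2 * p) = Re (ip I ((B ^^ p) u) ((B ^^ p) u))"
  by (simp add: moment_def ip_pow_pow flip: mult_2)

lemma moment_odd: "moment u (Suc (2 * p)) = Re (ip I ((B ^^ p) u) (B ((B ^^ p) u)))"
  using ip_pow_pow[of p u "Suc p" u] by (simp add: moment_def flip: mult_2)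

lemma moment_nonneg: "0 \<le> moment u n"
proof (cases "even n")
  case True
  then obtain p where "n = 2 * p" by blast
  then show ?thesis by (simp add: moment_even ip_self sum_nonneg)
next
  case False
  then obtain p where "n = Suc (2 * p)" by (metis oddE Suc_eq_plus1)
  then show ?thesis by (simp add: moment_odd psd)
qed

text \<open>Cauchy-Schwarz for the vectors B^p u and B^(p+1) u, with respect to the form
  \<open>ip I x y\<close> if n = 2p and to the semidefinite form \<open>ip I x (B y)\<close> if n =
  2p + 1. The quadratic polynomial in \<open>t\<close> is the form at \<open>z\<close>.\<close>

lemma moment_logconvex: "(moment u (Suc n))\<^sup>2 \<le> moment u n * moment u (Suc (Suc n))"
proof (rule discriminant_le)
  fix t :: real
  obtain p where p: "n = 2 * p \<or> n = Suc (2 * p)"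
    using even_or_odd_half by blast
  define z where "z = (\<lambda>j. (B ^^ p) u j + complex_of_real t * (B ^^ Suc p) u j)"
  have nn: "0 \<le> Re (ip I z z)" "0 \<le> Re (ip I z (B z))"
    by (simp_all add: ip_self sum_nonneg psd)
  have Bz: "B z = (\<lambda>j. (B ^^ Suc p) u j + complex_of_real t * (B ^^ Suc (Suc p)) u j)"
    unfolding z_def by (subst add, subst scale) simp
  show "0 \<le> moment u n + 2 * t * moment u (Suc n) + t\<^sup>2 * moment u (Suc (Suc n))"
    using p
  proof
    assume n: "n = 2 * p"
    have "ip I z z = ip I u ((B ^^ (p + p)) u) + 2 * t * ip I u ((B ^^ (p + Suc p)) u)
        + t\<^sup>2 * ip I u ((B ^^ (Suc p + Suc p)) u)"
      unfolding z_def ip_add_right ip_add_left ip_scale_right ip_scale_left ip_pow_pow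
      by (simp add: algebra_simps power2_eq_square)
    then have "ip I z z = of_real (moment u n + 2 * t * moment u (Suc n) + t\<^sup>2 * moment u (Suc (Suc n)))"
      unfolding n by (simp add: of_real_moment flip: mult_2)
    then show ?thesis using nn by simp
  next
    assume n: "n = Suc (2 * p)"
    have "ip I z (B z) = ip I u ((B ^^ (p + Suc p)) u) + 2 * t * ip I u ((B ^^ (p + Suc (Suc p))) u)
        + t\<^sup>2 * ip I u ((B ^^ (Suc p + Suc (Suc p))) u)"
      unfolding Bz unfolding z_def ip_add_right ip_add_left ip_scale_right ip_scale_left ip_pow_pow
      by (simp add: algebra_simps power2_eq_square)
    then have "ip I z (B z) = of_real (moment u n + 2 * t * moment u (Suc n) + t\<^sup>2 * moment u (Suc (Suc n)))"
      unfolding n by (simp add: of_real_moment flip: mult_2)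
    then show ?thesis using nn by simp
  qed
qed (rule moment_nonneg)

lemma moment_mult_le: "moment u a * moment u b \<le> moment u 0 * moment u (a + b)"
  by (rule logconvex_mult_le[where \<mu> = "moment u"]) (rule moment_nonneg moment_logconvex)+

text \<open>Jensen's inequality for the power function at a unit vector. It is what turns a bound on
  high powers back into a bound on the quadratic form itself.\<close>

lemma moment_ge_power:
  assumes "moment u 0 = 1"
  shows "moment u 1 ^ n \<le> moment u n"
proof (induction n)
  case (Suc n)
  have "moment u 1 ^ Suc n \<le> moment u 1 * moment u n"
    using Suc by (simp add: mult_left_mono moment_nonneg)
  also have "\<dots> \<le> moment u (Suc n)" using moment_mult_le[of u 1 n] assms by simp
  finally show ?case .
qed (use assms in simp)

text \<open>From B \<ge> b follows B^(n+1) \<ge> b B^n. Instead of a square root of B^n, the proof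
  uses that moments 1 and n multiply to at most moments 0 and n + 1, and cancels moment 0.\<close>

lemma moment_Suc_ge:
  assumes b: "\<And>w. b * moment w 0 \<le> moment w 1" and "0 \<le> b"
  shows "b * moment u n \<le> moment u (Suc n)"
proof (cases "moment u 0 = 0")
  case True
  then have "\<forall>i\<in>I. u i = 0"
    unfolding moment_0 using fin by (simp add: sum_nonneg_eq_0_iff)
  then have "ip I u w = 0" for w by (simp add: ip_def)
  then show ?thesis by (simp add: moment_def)
next
  case False
  then have pos: "0 < moment u 0" using moment_nonneg[of u 0] by linarith
  have "moment u 0 * (b * moment u n) \<le> moment u 1 * moment u n"
    using mult_right_mono[OF b[of u] moment_nonneg[of u n]] by (simp add: mult_ac)
  also have "\<dots> \<le> moment u 0 * moment u (Suc n)" using moment_mult_le[of u 1 n] by simp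
  finally show ?thesis using pos by simp
qed

text \<open>For even n the hypothesis is applied to B^(n/2) u. For odd n, log-convexity combines
  with the even case at n + 1: the square of moment n + 1 is at most moment n times moment n + 2,
  hence at most moment n times moment n + 1.\<close>

lemma moment_Suc_le:
  assumes le: "\<And>w. moment w 1 \<le> moment w 0"
  shows "moment u (Suc n) \<le> moment u n"
proof -
  have even: "moment u (Suc (2 * p)) \<le> moment u (2 * p)" for p
    using le[of "(B ^^ p) u"] unfolding moment_odd moment_even by (simp add: moment_def)
  show ?thesis
  proof (cases "even n")
    case True
    then show ?thesis using even by (auto elim!: evenE)
  next
    case False
    then obtain p where n: "n = Suc (2 * p)" by (auto elim!: oddE)
    have "moment u (Suc (Suc n)) \<le> moment u (Suc n)"
      using even[of "Suc p"] n by simp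
    then have "(moment u (Suc n))\<^sup>2 \<le> moment u n * moment u (Suc n)"
      using moment_logconvex[of u n] mult_left_mono[OF _ moment_nonneg[of u n]] by fastforce
    then show ?thesis
      using moment_nonneg[of u n] moment_nonneg[of u "Suc n"]
      by (cases "moment u (Suc n) = 0") (auto simp: power2_eq_square)
  qed
qed

lemma trace_pow_nonneg: "0 \<le> trace_pow n"
  by (simp add: trace_pow_def sum_nonneg moment_nonneg)

lemma expand_basis:
  assumes "\<And>j. j \<notin> I \<Longrightarrow> u j = 0"
  shows "u = (\<lambda>j. \<Sum>i\<in>I. u i * basis_vec i j)"
  using assms fin by (auto simp: fun_eq_iff of_bool_def if_distrib cong: if_cong)

text \<open>The operator norm of B^p is at most its Hilbert-Schmidt norm, whose square is the trace
  of B^(2p). This is why only even exponents are used in the tail bound.\<close>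

lemma moment_le_trace:
  assumes supp: "\<And>j. j \<notin> I \<Longrightarrow> u j = 0"
  shows "moment u (2 * p) \<le> moment u 0 * trace_pow (2 * p)"
proof -
  have Bu: "(B ^^ p) u j = (\<Sum>i\<in>I. u i * (B ^^ p) (basis_vec i) j)" for j
    by (subst expand_basis[OF supp], assumption) (simp add: pow_sum)
  have "moment u (2 * p) = (\<Sum>j\<in>I. (cmod ((B ^^ p) u j))\<^sup>2)"
    by (simp add: moment_even ip_self)
  also have "\<dots> \<le> (\<Sum>j\<in>I. (\<Sum>i\<in>I. (cmod (u i))\<^sup>2) * (\<Sum>i\<in>I. (cmod ((B ^^ p) (basis_vec i) j))\<^sup>2))"
  proof (rule sum_mono)
    fix j
    have "cmod ((B ^^ p) u j) \<le> (\<Sum>i\<in>I. cmod (u i) * cmod ((B ^^ p) (basis_vec i) j))"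
      unfolding Bu by (rule order_trans[OF norm_sum]) (simp add: norm_mult)
    then have "(cmod ((B ^^ p) u j))\<^sup>2 \<le> (\<Sum>i\<in>I. cmod (u i) * cmod ((B ^^ p) (basis_vec i) j))\<^sup>2"
      by (intro power_mono) auto
    also have "\<dots> \<le> (\<Sum>i\<in>I. (cmod (u i))\<^sup>2) * (\<Sum>i\<in>I. (cmod ((B ^^ p) (basis_vec i) j))\<^sup>2)"
      by (rule Cauchy_Schwarz_ineq_sum)
    finally show "(cmod ((B ^^ p) u j))\<^sup>2
      \<le> (\<Sum>i\<in>I. (cmod (u i))\<^sup>2) * (\<Sum>i\<in>I. (cmod ((B ^^ p) (basis_vec i) j))\<^sup>2)" .
  qed
  also have "\<dots> = moment u 0 * trace_pow (2 * p)"
    unfolding sum_distrib_left[symmetric]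
    by (subst sum.swap) (simp add: trace_pow_def moment_even ip_self moment_0)
  finally show ?thesis .
qed

text \<open>Separates the vector, which will be random, from the operator, which will be fixed: a
  mean over \<open>v\<close> involves only the products \<open>cnj (v i) * v j\<close>.\<close>

lemma moment_expand:
  assumes supp: "\<And>j. j \<notin> I \<Longrightarrow> v j = 0"
  shows "moment v n = Re (\<Sum>i\<in>I. \<Sum>j\<in>I. cnj (v i) * v j * (B ^^ n) (basis_vec j) i)"
proof -
  have "(B ^^ n) v i = (\<Sum>j\<in>I. v j * (B ^^ n) (basis_vec j) i)" for i
    by (subst expand_basis[OF supp], assumption) (simp add: pow_sum)
  then show ?thesis
    by (simp add: moment_def ip_def sum_distrib_left mult_ac)
qed

end

section \<open>Rank-one updates and frame operators\<close>

text \<open>One more sample in the frame operator. Positivity of both operators is part of the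
  locale because \<tau> may be negative.\<close>

locale psd_op_update = B: psd_op I B + B': psd_op I B'
  for I :: "'i set" and B B' +
  fixes \<tau> :: real and v :: "'i \<Rightarrow> complex"
  assumes update: "B' u = (\<lambda>j. B u j + complex_of_real \<tau> * ip I v u * v j)"
begin

text \<open>Telescoping: B'^a - B^a is the sum over c < a of B^c (B' - B) B'^(a-1-c), and B' - B has
  rank one.\<close>

lemma pow_update:
  "(B' ^^ a) w = (\<lambda>j. (B ^^ a) w j
      + (\<Sum>c<a. (complex_of_real \<tau> * ip I v ((B' ^^ (a - Suc c)) w)) * (B ^^ c) v j))"
proof (induction a)
  case (Suc a)
  have "(B' ^^ Suc a) w = (\<lambda>j. B ((B' ^^ a) w) j + complex_of_real \<tau> * ip I v ((B' ^^ a) w) * v j)"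
    by (simp add: update)
  also have "B ((B' ^^ a) w) = (\<lambda>j. (B ^^ Suc a) w j
      + (\<Sum>c<a. (complex_of_real \<tau> * ip I v ((B' ^^ (a - Suc c)) w)) * (B ^^ Suc c) v j))"
    by (subst Suc.IH, subst B.add, subst B.pow_sum[where n = 1, simplified]) simp
  finally show ?case
    by (simp add: sum.lessThan_Suc_shift add_ac del: sum.lessThan_Suc)
qed simp

lemma moment_update:
  "B'.moment v a = B.moment v a + \<tau> * (\<Sum>c<a. B'.moment v (a - Suc c) * B.moment v c)"
proof -
  have "complex_of_real (B'.moment v a) = ip I v ((B ^^ a) v)
      + (\<Sum>c<a. (complex_of_real \<tau> * ip I v ((B' ^^ (a - Suc c)) v)) * ip I v ((B ^^ c) v))"
    unfolding B'.of_real_moment by (subst pow_update) (simp only: ip_add_right ip_sum_right)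
  also have "\<dots> = of_real (B.moment v a + \<tau> * (\<Sum>c<a. B'.moment v (a - Suc c) * B.moment v c))"
    by (simp flip: B.of_real_moment B'.of_real_moment add: sum_distrib_left mult_ac)
  finally show ?thesis by (simp only: of_real_eq_iff)
qed

text \<open>A second use of the telescoping identity, now in the left argument. It splits off the
  pure moment of \<open>B\<close>, which yields the first-order term of the trace, from a remainder
  carrying another factor \<tau>.\<close>

lemma cross_moment:
  "ip I ((B' ^^ a) v) ((B ^^ c) v)
    = of_real (B.moment v (a + c) + \<tau> * (\<Sum>d<a. B'.moment v (a - Suc d) * B.moment v (d + c)))"
proof -
  have "ip I ((B' ^^ a) v) ((B ^^ c) v) = of_real (B.moment v (a + c))
      + (\<Sum>d<a. cnj (of_real \<tau> * of_real (B'.moment v (a - Suc d))) * of_real (B.moment v (d + c)))"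
    by (subst pow_update) (simp only: ip_add_left ip_sum_left B.ip_pow_pow flip: B.of_real_moment B'.of_real_moment)
  then show ?thesis by (simp add: sum_distrib_left mult_ac)
qed

lemma trace_update_cross:
  "complex_of_real (B'.trace_pow n) = of_real (B.trace_pow n)
    + of_real \<tau> * (\<Sum>c<n. ip I ((B' ^^ (n - Suc c)) v) ((B ^^ c) v))"
proof -
  note [simp] = B.fin
  \<comment> \<open>The trace of the rank-one operator that sends w to \<open>(B ^^ c) v\<close>
    with coefficient \<open>ip I v ((B' ^^ a) w)\<close>.\<close>
  have *: "(\<Sum>i\<in>I. ip I v ((B' ^^ a) (basis_vec i)) * (B ^^ c) v i) = ip I ((B' ^^ a) v) ((B ^^ c) v)" for a c
    by (simp add: ip_basis_right ip_def[of _ "(B' ^^ a) v"] flip: B'.pow_selfadj)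
  have "complex_of_real (B'.trace_pow n) = (\<Sum>i\<in>I. ip I (basis_vec i) ((B' ^^ n) (basis_vec i)))"
    by (simp add: B'.trace_pow_def B'.of_real_moment)
  also have "\<dots> = (\<Sum>i\<in>I. ip I (basis_vec i) ((B ^^ n) (basis_vec i))
      + (\<Sum>c<n. of_real \<tau> * ip I v ((B' ^^ (n - Suc c)) (basis_vec i)) * (B ^^ c) v i))"
  proof (rule sum.cong[OF refl])
    fix i assume "i \<in> I"
    then show "ip I (basis_vec i) ((B' ^^ n) (basis_vec i)) = ip I (basis_vec i) ((B ^^ n) (basis_vec i))
      + (\<Sum>c<n. of_real \<tau> * ip I v ((B' ^^ (n - Suc c)) (basis_vec i)) * (B ^^ c) v i)"
      by (subst pow_update) (simp only: ip_add_right ip_sum_right ip_basis_left B.fin)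
  qed
  also have "\<dots> = of_real (B.trace_pow n)
    + of_real \<tau> * (\<Sum>c<n. \<Sum>i\<in>I. ip I v ((B' ^^ (n - Suc c)) (basis_vec i)) * (B ^^ c) v i)"
    by (simp add: sum.distrib B.trace_pow_def B.of_real_moment sum.swap[of _ _ I] sum_distrib_left mult_ac)
  finally show ?thesis by (simp only: *)
qed

text \<open>An exact second-order expansion: the mixed moments in the coefficient of \<open>\<tau>\<^sup>2\<close> only need to be
  bounded from above, whatever the sign of \<open>\<tau>\<close>.\<close>

lemma trace_update:
  "B'.trace_pow n = B.trace_pow n + \<tau> * real n * B.moment v (n - 1)
    + \<tau>\<^sup>2 * (\<Sum>c<n. \<Sum>d<n - Suc c. B'.moment v (n - Suc c - Suc d) * B.moment v (d + c))"
proof -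
  have "(\<Sum>c<n. B.moment v (n - Suc c + c)) = (\<Sum>c<n. B.moment v (n - 1))"
    by (rule sum.cong) auto
  then have *: "(\<Sum>c<n. B.moment v (n - Suc c + c)) = real n * B.moment v (n - 1)" by simp
  have "complex_of_real (B'.trace_pow n) = of_real (B.trace_pow n
    + \<tau> * ((\<Sum>c<n. B.moment v (n - Suc c + c))
        + \<tau> * (\<Sum>c<n. \<Sum>d<n - Suc c. B'.moment v (n - Suc c - Suc d) * B.moment v (d + c))))"
    unfolding trace_update_cross cross_moment by (simp add: sum.distrib flip: sum_distrib_left)
  then show ?thesis unfolding of_real_eq_iff * by (simp add: power2_eq_square algebra_simps)
qed

text \<open>The two indices in every second-order product add up to n - 2. Once the moments of
  \<open>B'\<close> are bounded by \<open>K\<close> times those of \<open>B\<close>, all products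
  have the common bound from \<open>moment_mult_le\<close>, and there are at most n^2 of
  them.\<close>

lemma trace_update_le:
  assumes K: "\<And>d. d < n \<Longrightarrow> B'.moment v d \<le> K * B.moment v d" and "0 \<le> K"
  shows "B'.trace_pow n \<le> B.trace_pow n + \<tau> * real n * B.moment v (n - 1)
    + (\<tau> * real n)\<^sup>2 * K * (B.moment v 0 * B.moment v (n - 2))"
proof -
  let ?m = "K * (B.moment v 0 * B.moment v (n - 2))"
  have m: "0 \<le> ?m" using \<open>0 \<le> K\<close> by (simp add: B.moment_nonneg)
  have "(\<Sum>c<n. \<Sum>d<n - Suc c. B'.moment v (n - Suc c - Suc d) * B.moment v (d + c))
      \<le> (\<Sum>c<n. \<Sum>d<n - Suc c. ?m)"
  proof (intro sum_mono)
    fix c d assume "c \<in> {..<n}" "d \<in> {..<n - Suc c}"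
    then have eq: "n - Suc c - Suc d + (d + c) = n - 2" and lt: "n - Suc c - Suc d < n" by auto
    have "B'.moment v (n - Suc c - Suc d) * B.moment v (d + c)
        \<le> K * B.moment v (n - Suc c - Suc d) * B.moment v (d + c)"
      by (intro mult_right_mono K lt B.moment_nonneg)
    also have "\<dots> \<le> ?m"
      unfolding mult.assoc eq[symmetric] by (intro mult_left_mono B.moment_mult_le \<open>0 \<le> K\<close>)
    finally show "B'.moment v (n - Suc c - Suc d) * B.moment v (d + c) \<le> ?m" .
  qed
  also have "\<dots> \<le> (\<Sum>c<n. \<Sum>d<n. ?m)"
    using m by (intro sum_mono sum_mono2) auto
  also have "\<dots> = (real n)\<^sup>2 * ?m" by (simp add: power2_eq_square)
  finally have "\<tau>\<^sup>2 * (\<Sum>c<n. \<Sum>d<n - Suc c. B'.moment v (n - Suc c - Suc d) * B.moment v (d + c))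
      \<le> \<tau>\<^sup>2 * ((real n)\<^sup>2 * ?m)" by (intro mult_left_mono) auto
  then show ?thesis unfolding trace_update by (simp add: power_mult_distrib mult_ac)
qed

lemma moment_update_le_neg:
  assumes "\<tau> \<le> 0"
  shows "B'.moment v a \<le> B.moment v a"
proof -
  have "0 \<le> (\<Sum>c<a. B'.moment v (a - Suc c) * B.moment v c)"
    by (intro sum_nonneg mult_nonneg_nonneg B.moment_nonneg B'.moment_nonneg)
  then show ?thesis
    unfolding moment_update[of a] using assms by (simp add: mult_nonpos_nonneg)
qed

text \<open>Put r = 1 + \<tau> * \<open>B.moment v 0\<close>. The strong induction turns the
  recursion into a geometric sum, and 1 + (r - 1)(1 + r + ... + r^(a-1)) = r^a closes it. The index
  a - 1 left by \<open>moment_mult_le\<close> is raised to a by \<open>mono\<close>.\<close>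

lemma moment_update_le_pos:
  assumes "0 \<le> \<tau>" and mono: "\<And>j. B.moment v j \<le> B.moment v (Suc j)"
  shows "B'.moment v a \<le> (1 + \<tau> * B.moment v 0) ^ a * B.moment v a"
proof (induction a rule: less_induct)
  case (less a)
  define r where "r = 1 + \<tau> * B.moment v 0"
  have r: "1 \<le> r" unfolding r_def using assms B.moment_nonneg[of v 0] by simp
  have "B'.moment v (a - Suc c) * B.moment v c \<le> r ^ (a - Suc c) * (B.moment v 0 * B.moment v a)"
    if "c < a" for c
  proof -
    have "B'.moment v (a - Suc c) * B.moment v c \<le> (r ^ (a - Suc c) * B.moment v (a - Suc c)) * B.moment v c"
      unfolding r_def using that by (intro mult_right_mono less B.moment_nonneg) auto
    also have "\<dots> \<le> r ^ (a - Suc c) * (B.moment v 0 * B.moment v (a - Suc c + c))"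
      unfolding mult.assoc using r by (intro mult_left_mono B.moment_mult_le) auto
    also have "B.moment v (a - Suc c + c) \<le> B.moment v a"
      using mono[of "a - Suc 0"] that by simp
    finally show ?thesis
      using r B.moment_nonneg[of v 0] by (simp add: mult_left_mono)
  qed
  then have "(\<Sum>c<a. B'.moment v (a - Suc c) * B.moment v c)
      \<le> (\<Sum>c<a. r ^ (a - Suc c) * (B.moment v 0 * B.moment v a))"
    by (intro sum_mono) auto
  also have "\<dots> = (\<Sum>c<a. r ^ c) * (B.moment v 0 * B.moment v a)"
    unfolding sum_distrib_right[symmetric] by (subst sum.nat_diff_reindex) simp
  finally have "B'.moment v a \<le> B.moment v a + \<tau> * ((\<Sum>c<a. r ^ c) * (B.moment v 0 * B.moment v a))"
    unfolding moment_update[of a] using assms by (simp add: mult_left_mono)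
  also have "\<dots> = (1 + (r - 1) * (\<Sum>c<a. r ^ c)) * B.moment v a"
    by (simp add: r_def algebra_simps)
  also have "(r - 1) * (\<Sum>c<a. r ^ c) = r ^ a - 1"
    by (simp add: power_diff_1_eq)
  finally show ?case by (simp add: r_def)
qed

end

section \<open>Frame operators as perturbations of the identity\<close>

definition frame_op ::
    "'i set \<Rightarrow> real \<Rightarrow> 's set \<Rightarrow> ('s \<Rightarrow> 'i \<Rightarrow> complex) \<Rightarrow> ('i \<Rightarrow> complex) \<Rightarrow> 'i \<Rightarrow> complex" where
  "frame_op I \<tau> F V u = (\<lambda>j. u j + complex_of_real \<tau> * (\<Sum>s\<in>F. ip I (V s) u * V s j))"

lemma ip_frame_op:
  "ip I u (frame_op I \<tau> F V u)
    = of_real (Re (ip I u u) + \<tau> * (\<Sum>s\<in>F. (cmod (ip I (V s) u))\<^sup>2))"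
proof -
  have "ip I u (frame_op I \<tau> F V u) = ip I u u + \<tau> * (\<Sum>s\<in>F. ip I (V s) u * ip I u (V s))"
    unfolding frame_op_def ip_add_right ip_scale_right ip_sum_right ..
  also have "(\<Sum>s\<in>F. ip I (V s) u * ip I u (V s)) = (\<Sum>s\<in>F. of_real ((cmod (ip I (V s) u))\<^sup>2))"
    by (intro sum.cong refl) (metis cnj_ip complex_norm_square)
  finally show ?thesis by (simp add: ip_self)
qed

lemma frame_sum_le:
  assumes "\<And>s. s \<in> F \<Longrightarrow> Re (ip I (V s) (V s)) \<le> k"
  shows "(\<Sum>s\<in>F. (cmod (ip I (V s) u))\<^sup>2) \<le> k * card F * Re (ip I u u)"
proof -
  have "(\<Sum>s\<in>F. (cmod (ip I (V s) u))\<^sup>2) \<le> (\<Sum>s\<in>F. k * Re (ip I u u))"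
    by (intro sum_mono order_trans[OF cauchy_schwarz_ip] mult_right_mono assms)
      (simp_all add: ip_self sum_nonneg)
  then show ?thesis by (simp add: mult_ac)
qed

text \<open>\<open>b\<close> bounds the spectrum from below for either sign of \<tau>: a nonnegative
  \<tau> keeps it at least 1, and a negative one lowers it by at most |\<tau>| k per sample, by
  Cauchy-Schwarz.\<close>

locale frame_operator =
  fixes I :: "'i set" and \<tau> :: real and F :: "'s set" and V :: "'s \<Rightarrow> 'i \<Rightarrow> complex" and k b :: real
  assumes fin: "finite I" and finF: "finite F"
    and norm_le: "\<And>s. s \<in> F \<Longrightarrow> Re (ip I (V s) (V s)) \<le> k"
    and b_nonneg: "0 \<le> b" and b_le: "b \<le> 1" "b \<le> 1 + \<tau> * (k * card F)"
begin

lemma ip_frame_op_ge: "b * Re (ip I u u) \<le> Re (ip I u (frame_op I \<tau> F V u))"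
proof (cases "0 \<le> \<tau>")
  case True
  have "b * Re (ip I u u) \<le> 1 * Re (ip I u u)"
    by (intro mult_right_mono b_le) (simp add: ip_self sum_nonneg)
  also have "\<dots> \<le> Re (ip I u (frame_op I \<tau> F V u))"
    using True by (simp add: ip_frame_op sum_nonneg)
  finally show ?thesis .
next
  case False
  have "\<tau> * (k * card F * Re (ip I u u)) \<le> \<tau> * (\<Sum>s\<in>F. (cmod (ip I (V s) u))\<^sup>2)"
    using False by (intro mult_left_mono_neg frame_sum_le norm_le) auto
  moreover have "b * Re (ip I u u) \<le> (1 + \<tau> * (k * card F)) * Re (ip I u u)"
    by (intro mult_right_mono b_le) (simp add: ip_self sum_nonneg)
  ultimately show ?thesis by (simp add: ip_frame_op algebra_simps)
qed

sublocale psd_op I "frame_op I \<tau> F V"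
proof
  show "frame_op I \<tau> F V (\<lambda>j. u j + w j) = (\<lambda>j. frame_op I \<tau> F V u j + frame_op I \<tau> F V w j)" for u w
    by (simp add: frame_op_def ip_add_right algebra_simps sum.distrib)
  show "frame_op I \<tau> F V (\<lambda>j. c * u j) = (\<lambda>j. c * frame_op I \<tau> F V u j)" for u c
    by (simp add: frame_op_def ip_scale_right algebra_simps sum_distrib_left)
  show "ip I (frame_op I \<tau> F V u) w = ip I u (frame_op I \<tau> F V w)" for u w
    unfolding frame_op_def ip_add_left ip_add_right ip_scale_left ip_scale_right ip_sum_left ip_sum_right
    by (simp add: cnj_ip mult_ac)
  show "0 \<le> Re (ip I u (frame_op I \<tau> F V u))" for u
    by (rule order_trans[OF _ ip_frame_op_ge]) (simp add: b_nonneg ip_self sum_nonneg)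
qed (rule fin)

lemma moment_1_ge: "b * moment u 0 \<le> moment u 1"
  using ip_frame_op_ge[of u] by (simp add: moment_def)

lemma moment_1_ge_0: "0 \<le> \<tau> \<Longrightarrow> moment u 0 \<le> moment u 1"
  by (simp add: moment_def ip_frame_op sum_nonneg)

lemma moment_1_le_0: "\<tau> \<le> 0 \<Longrightarrow> moment u 1 \<le> moment u 0"
  by (simp add: moment_def ip_frame_op sum_nonneg mult_nonpos_nonneg)

lemma trace_pow_mono: "0 \<le> \<tau> \<Longrightarrow> trace_pow n \<le> trace_pow (Suc n)"
  unfolding trace_pow_def using moment_Suc_ge[of 1] moment_1_ge_0 by (intro sum_mono) simp

lemma trace_pow_antimono: "\<tau> \<le> 0 \<Longrightarrow> trace_pow (Suc n) \<le> trace_pow n"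
  unfolding trace_pow_def by (intro sum_mono moment_Suc_le moment_1_le_0)

lemma trace_pow_ge: "b * trace_pow n \<le> trace_pow (Suc n)"
  unfolding trace_pow_def sum_distrib_left by (intro sum_mono moment_Suc_ge moment_1_ge b_nonneg)

end

section \<open>A tail bound for random frame operators\<close>

lemma measurable_cnj [measurable]: "cnj \<in> borel \<rightarrow>\<^sub>M borel"
  by (intro borel_measurable_continuous_onI continuous_intros)

text \<open>Separates the probabilistic part from Fourier analysis: \<open>V_norm\<close> fixes the
  length of the random vector, \<open>V_orth\<close> makes its covariance the identity, and
  \<open>V_supp\<close> allows its expansion in the basis.\<close>

locale isotropic_sampling = prob_space \<nu>
  for \<nu> :: "'y measure" +
  fixes I :: "'i set" and V :: "'y \<Rightarrow> 'i \<Rightarrow> complex"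
  assumes fin: "finite I"
    and V_meas [measurable]: "\<And>i. (\<lambda>y. V y i) \<in> borel_measurable \<nu>"
    and V_norm: "\<And>y i. i \<in> I \<Longrightarrow> cmod (V y i) = 1"
    and V_supp: "\<And>y i. i \<notin> I \<Longrightarrow> V y i = 0"
    and V_orth: "\<And>i j. i \<in> I \<Longrightarrow> j \<in> I \<Longrightarrow> (LINT y|\<nu>. cnj (V y i) * V y j) = of_bool (i = j)"
begin

abbreviation dim :: real where "dim \<equiv> real (card I)"

abbreviation sample_op :: "real \<Rightarrow> 's set \<Rightarrow> ('s \<Rightarrow> 'y) \<Rightarrow> ('i \<Rightarrow> complex) \<Rightarrow> 'i \<Rightarrow> complex" where
  "sample_op \<tau> F x \<equiv> frame_op I \<tau> F (\<lambda>s. V (x s))"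

lemma ip_V_V: "ip I (V y) (V y) = of_real dim"
  by (simp add: ip_self V_norm)

lemma integrable_V_V: "i \<in> I \<Longrightarrow> j \<in> I \<Longrightarrow> integrable \<nu> (\<lambda>y. cnj (V y i) * V y j)"
  by (rule integrable_const_bound[where B = 1]) (simp_all add: norm_mult V_norm)

text \<open>After expansion in the entries of the random vector, averaging keeps only the diagonal
  terms of the fixed matrix of B^n, hence its trace.\<close>

lemma has_integral_moment:
  assumes "psd_op I B"
  shows "integrable \<nu> (\<lambda>y. psd_op.moment I B (V y) n)"
    and "(LINT y|\<nu>. psd_op.moment I B (V y) n) = psd_op.trace_pow I B n"
proof -
  interpret psd_op I B by fact
  let ?g = "\<lambda>y. \<Sum>i\<in>I. \<Sum>j\<in>I. cnj (V y i) * V y j * (B ^^ n) (basis_vec j) i"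
  have moment_eq: "moment (V y) n = Re (?g y)" for y
    by (rule moment_expand) (rule V_supp)
  have int: "integrable \<nu> ?g"
    by (intro Bochner_Integration.integrable_sum integrable_mult_left integrable_V_V)
  then show "integrable \<nu> (\<lambda>y. psd_op.moment I B (V y) n)"
    unfolding moment_eq by (rule integrable_Re)
  have "(LINT y|\<nu>. ?g y) = (\<Sum>i\<in>I. \<Sum>j\<in>I. of_bool (i = j) * (B ^^ n) (basis_vec j) i)"
    by (simp add: Bochner_Integration.integral_sum integrable_V_V V_orth
        Bochner_Integration.integrable_sum)
  also have "\<dots> = (\<Sum>i\<in>I. (B ^^ n) (basis_vec i) i)"
    using fin by (intro sum.cong refl) (simp add: of_bool_def if_distrib[where f = "\<lambda>x. x * _"] sum.delta' cong: if_cong)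
  finally show "(LINT y|\<nu>. psd_op.moment I B (V y) n) = psd_op.trace_pow I B n"
    unfolding moment_eq integral_Re[OF int] using fin
    by (simp add: trace_pow_def moment_def ip_basis_left)
qed

text \<open>One step of the recursion: the earlier samples are frozen and the new one is averaged.
  The trace expansion produces the powers n - 1 and n - 2. The first is replaced by n because the
  trace is monotone in the exponent in the direction matching the sign of \<tau>; the second costs a
  factor 1/b^2.\<close>

lemma nn_integral_trace_update:
  fixes F :: "'s set" and x :: "'s \<Rightarrow> 'y"
  assumes "finite F" "s \<notin> F" "0 < b" "b \<le> 1" "b \<le> 1 + \<tau> * (dim * card (insert s F))" "2 \<le> n"
  shows "(\<integral>\<^sup>+y. ennreal (psd_op.trace_pow I (sample_op \<tau> (insert s F) (x(s := y))) n) \<partial>\<nu>)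
    \<le> ennreal ((1 + \<tau> * real n + (\<tau> * real n)\<^sup>2 * (exp (dim * \<bar>\<tau>\<bar> * real n) / b\<^sup>2 * dim))
        * psd_op.trace_pow I (sample_op \<tau> F x) n)"
proof -
  let ?B = "sample_op \<tau> F x" and ?B' = "\<lambda>y. sample_op \<tau> (insert s F) (x(s := y))"
  have "b \<le> 1 + \<tau> * (dim * card F)"
  proof (cases "0 \<le> \<tau>")
    case True
    then have "0 \<le> \<tau> * (dim * card F)" by simp
    then show ?thesis using assms(4) by linarith
  next
    case False
    then have "\<tau> * (dim * card (insert s F)) \<le> \<tau> * (dim * card F)"
      using assms by (intro mult_left_mono_neg mult_left_mono) auto
    then show ?thesis using assms(5) by linarith
  qed
  then interpret B: frame_operator I \<tau> F "\<lambda>s. V (x s)" dim b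
    using assms fin by unfold_locales (auto simp: ip_V_V)
  have psd_of_frame: "psd_op I (frame_op I \<tau> F' V')" if "frame_operator I \<tau> F' V' dim b"
    for F' :: "'s set" and V'
  proof -
    interpret frame_operator I \<tau> F' V' dim b by fact
    show ?thesis by unfold_locales
  qed
  have psd': "frame_operator I \<tau> (insert s F) (\<lambda>r. V ((x(s := y)) r)) dim b" for y
    using assms fin by unfold_locales (auto simp: ip_V_V)
  \<comment> \<open>A growth factor valid for all exponents d < n: if \<tau> \<ge> 0 then (1 +
    \<tau> dim)^d is at most exp(\<tau> dim n), while a negative \<tau> lowers the moments and any
    factor \<ge> 1 will do.\<close>
  define K where "K = exp (dim * \<bar>\<tau>\<bar> * real n)"
  have K: "1 \<le> K" unfolding K_def by simp
  define G where "G = (\<lambda>y. B.trace_pow n + \<tau> * real n * B.moment (V y) (n - 1)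
      + (\<tau> * real n)\<^sup>2 * K * (dim * B.moment (V y) (n - 2)))"
  have le_G: "psd_op.trace_pow I (?B' y) n \<le> G y" for y
  proof -
    interpret B': frame_operator I \<tau> "insert s F" "\<lambda>r. V ((x(s := y)) r)" dim b by (rule psd')
    interpret psd_op_update I ?B "?B' y" \<tau> "V y"
    proof
      fix u
      have "(\<Sum>r\<in>F. ip I (V ((x(s := y)) r)) u * V ((x(s := y)) r) j)
        = (\<Sum>r\<in>F. ip I (V (x r)) u * V (x r) j)" for j
        using assms by (intro sum.cong) auto
      then show "?B' y u = (\<lambda>j. ?B u j + complex_of_real \<tau> * ip I (V y) u * V y j)"
        unfolding frame_op_def using assms by (simp add: algebra_simps)
    qed
    have m0: "B.moment (V y) 0 = dim" by (simp add: B.moment_def ip_V_V)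
    have "B'.moment (V y) d \<le> K * B.moment (V y) d" if "d < n" for d
    proof (cases "0 \<le> \<tau>")
      case True
      have "B'.moment (V y) d \<le> (1 + \<tau> * dim) ^ d * B.moment (V y) d"
        unfolding m0[symmetric]
        by (rule moment_update_le_pos[OF True]) (use B.moment_Suc_ge[of 1] B.moment_1_ge_0[OF True] in simp)
      also have "\<dots> \<le> K * B.moment (V y) d"
      proof (rule mult_right_mono[OF _ B.moment_nonneg])
        have "(1 + \<tau> * dim) ^ d \<le> exp (\<tau> * dim) ^ d"
          using True by (intro power_mono) auto
        also have "\<dots> \<le> exp (\<tau> * dim) ^ n"
          using True that by (intro power_increasing) auto
        also have "\<dots> = K" using True by (simp add: K_def mult_ac flip: exp_of_nat_mult)
        finally show "(1 + \<tau> * dim) ^ d \<le> K" .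
      qed
      finally show ?thesis .
    next
      case False
      have "B'.moment (V y) d \<le> 1 * B.moment (V y) d"
        using moment_update_le_neg[of d] False by simp
      also have "\<dots> \<le> K * B.moment (V y) d"
        by (intro mult_right_mono K B.moment_nonneg)
      finally show ?thesis .
    qed
    from trace_update_le[OF this] K show ?thesis
      unfolding m0 G_def by simp
  qed
  have int: "integrable \<nu> G"
    unfolding G_def by (intro Bochner_Integration.integrable_add integrable_mult_right integrable_const
        has_integral_moment(1) B.psd_op_axioms)
  \<comment> \<open>The sign of \<open>G\<close> is inherited from the trace below it; it allows
    \<open>G\<close> to be integrated as a real function, term by term.\<close>
  have G_nonneg: "0 \<le> G y" for y
    using le_G[of y]
      psd_op.trace_pow_nonneg[OF psd_of_frame[OF psd'[of y]], of n] by linarith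
  have "(\<integral>\<^sup>+y. ennreal (psd_op.trace_pow I (?B' y) n) \<partial>\<nu>) \<le> (\<integral>\<^sup>+y. ennreal (G y) \<partial>\<nu>)"
    by (intro nn_integral_mono ennreal_leI le_G)
  also have "\<dots> = ennreal (LINT y|\<nu>. G y)"
    using int G_nonneg by (simp add: nn_integral_eq_integral)
  also have "(LINT y|\<nu>. G y) = B.trace_pow n + \<tau> * real n * B.trace_pow (n - 1)
      + (\<tau> * real n)\<^sup>2 * K * (dim * B.trace_pow (n - 2))"
    unfolding G_def
    by (simp add: has_integral_moment[OF B.psd_op_axioms] prob_space)
  also have "\<dots> \<le> (1 + \<tau> * real n + (\<tau> * real n)\<^sup>2 * (K / b\<^sup>2 * dim)) * B.trace_pow n"
  proof -
    obtain p where n: "n = Suc (Suc p)" using \<open>2 \<le> n\<close> by (metis add_2_eq_Suc le_Suc_ex)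
    have "\<tau> * B.trace_pow (n - 1) \<le> \<tau> * B.trace_pow n"
      using B.trace_pow_mono[of "Suc p"] B.trace_pow_antimono[of "Suc p"] n
      by (cases "0 \<le> \<tau>") (auto intro: mult_left_mono mult_left_mono_neg)
    then have 1: "\<tau> * real n * B.trace_pow (n - 1) \<le> \<tau> * real n * B.trace_pow n"
      using mult_left_mono[of "\<tau> * B.trace_pow (n - 1)" "\<tau> * B.trace_pow n" "real n"] by (simp add: mult_ac)
    have "b * (b * B.trace_pow (n - 2)) \<le> b * B.trace_pow (n - 1)"
      using B.trace_pow_ge[of p] n \<open>0 < b\<close> by simp
    also have "\<dots> \<le> B.trace_pow n" using B.trace_pow_ge[of "Suc p"] n by simp
    finally have "B.trace_pow (n - 2) \<le> B.trace_pow n / b\<^sup>2"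
      using \<open>0 < b\<close> by (simp add: field_simps power2_eq_square)
    then have "(\<tau> * real n)\<^sup>2 * K * (dim * B.trace_pow (n - 2))
        \<le> (\<tau> * real n)\<^sup>2 * K * (dim * (B.trace_pow n / b\<^sup>2))"
      using K by (intro mult_left_mono) auto
    with 1 show ?thesis by (simp add: algebra_simps)
  qed
  finally show ?thesis by (simp add: K_def ennreal_leI)
qed

section \<open>Measurability of the trace and the recursion over the samples\<close>

lemma borel_measurable_sample_op_pow:
  assumes "finite F"
  shows "(\<lambda>x. (sample_op \<tau> F x ^^ n) u j) \<in> borel_measurable (Pi\<^sub>M F (\<lambda>_. \<nu>))"
proof (induction n arbitrary: j)
  case (Suc n)
  let ?w = "\<lambda>x. (sample_op \<tau> F x ^^ n) u"
  note [measurable] = Suc.IH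
  have [measurable]: "(\<lambda>x. V (x s) i) \<in> borel_measurable (Pi\<^sub>M F (\<lambda>_. \<nu>))" if "s \<in> F" for s i
    using that by measurable
  have [measurable]: "(\<lambda>x. cnj (V (x s) i)) \<in> borel_measurable (Pi\<^sub>M F (\<lambda>_. \<nu>))" if "s \<in> F" for s i
    using that by measurable
  have "(\<lambda>x. ?w x j + complex_of_real \<tau> * (\<Sum>s\<in>F. (\<Sum>i\<in>I. cnj (V (x s) i) * ?w x i) * V (x s) j))
      \<in> borel_measurable (Pi\<^sub>M F (\<lambda>_. \<nu>))"
    by measurable
  then show ?case
    by (simp add: frame_op_def[of _ _ _ _ "?w _"] ip_def)
qed simp

text \<open>\<open>psd_op.trace_pow\<close> written out for every sample, so that measurability on
  the product space can be stated without a positivity hypothesis.\<close>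

definition sample_trace :: "real \<Rightarrow> nat \<Rightarrow> 's set \<Rightarrow> ('s \<Rightarrow> 'y) \<Rightarrow> real" where
  "sample_trace \<tau> n F x = (\<Sum>i\<in>I. Re (ip I (basis_vec i) ((sample_op \<tau> F x ^^ n) (basis_vec i))))"

lemma sample_trace_eq:
  "psd_op I (sample_op \<tau> F x) \<Longrightarrow> psd_op.trace_pow I (sample_op \<tau> F x) n = sample_trace \<tau> n F x"
  by (simp add: sample_trace_def psd_op.trace_pow_def psd_op.moment_def)

lemma borel_measurable_sample_trace [measurable]:
  assumes "finite F"
  shows "sample_trace \<tau> n F \<in> borel_measurable (Pi\<^sub>M F (\<lambda>_. \<nu>))"
proof -
  note [measurable] = borel_measurable_sample_op_pow[OF assms]
  show ?thesis unfolding sample_trace_def[abs_def] ip_def by measurable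
qed
lemma psd_op_sample_op:
  assumes "finite F" "0 \<le> b" "b \<le> 1" "b \<le> 1 + \<tau> * (dim * card F)"
  shows "psd_op I (sample_op \<tau> F x)"
proof -
  interpret frame_operator I \<tau> F "\<lambda>s. V (x s)" dim b
    using assms fin by unfold_locales (auto simp: ip_V_V)
  show ?thesis by unfold_locales
qed

text \<open>Fubini peels off one sample at a time, each contributing a factor \<open>q\<close>; the
  empty sample gives the trace of the identity. The condition on \<open>b\<close> uses |\<tau>| so
  that it passes to subsets of \<open>F\<close> and covers both signs.\<close>

lemma nn_integral_sample_trace_le:
  fixes F :: "'s set"
  assumes "finite F" "0 < b" "b \<le> 1" "b \<le> 1 - \<bar>\<tau>\<bar> * (dim * card F)" "2 \<le> n"
    and q: "q = 1 + \<tau> * real n + (\<tau> * real n)\<^sup>2 * (exp (dim * \<bar>\<tau>\<bar> * real n) / b\<^sup>2 * dim)" "0 \<le> q"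
  shows "(\<integral>\<^sup>+x. ennreal (sample_trace \<tau> n F x) \<partial>Pi\<^sub>M F (\<lambda>_. \<nu>)) \<le> ennreal (dim * q ^ card F)"
  using assms(1,4)
proof (induction F rule: finite_induct)
  case empty
  have [simp]: "sample_op \<tau> {} x = (\<lambda>u. u)" for x :: "'s \<Rightarrow> 'y"
    by (simp add: frame_op_def fun_eq_iff)
  have [simp]: "((\<lambda>u. u) ^^ n) w = w" for w :: "'i \<Rightarrow> complex"
    by (induction n) auto
  show ?case
    using fin by (simp add: sample_trace_def ip_basis_left PiM_empty)
next
  case (insert s F)
  interpret product_sigma_finite "\<lambda>_. \<nu>" by standard
  have card_le: "\<bar>\<tau>\<bar> * (dim * card F) \<le> \<bar>\<tau>\<bar> * (dim * card (insert s F))"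
    using insert.hyps by (intro mult_left_mono) auto
  have neg: "- (\<bar>\<tau>\<bar> * c) \<le> \<tau> * c" if "0 \<le> c" for c
    using that mult_right_mono[of "- \<bar>\<tau>\<bar>" \<tau> c] by simp
  have b: "b \<le> 1 + \<tau> * (dim * card F)" "b \<le> 1 + \<tau> * (dim * card (insert s F))"
    using insert.prems card_le neg[of "dim * card F"] neg[of "dim * card (insert s F)"] by auto
  have psd: "psd_op I (sample_op \<tau> F x)" "psd_op I (sample_op \<tau> (insert s F) x)" for x
    using psd_op_sample_op[of F b \<tau> x] psd_op_sample_op[of "insert s F" b \<tau> x] b insert.hyps assms by auto
  have [measurable]: "finite (insert s F)" "finite F" using insert.hyps by auto
  have "(\<integral>\<^sup>+x. ennreal (sample_trace \<tau> n (insert s F) x) \<partial>Pi\<^sub>M (insert s F) (\<lambda>_. \<nu>))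
      = (\<integral>\<^sup>+x. \<integral>\<^sup>+y. ennreal (sample_trace \<tau> n (insert s F) (x(s := y))) \<partial>\<nu> \<partial>Pi\<^sub>M F (\<lambda>_. \<nu>))"
    using insert.hyps by (intro product_nn_integral_insert) auto
  also have "\<dots> \<le> (\<integral>\<^sup>+x. ennreal (q * sample_trace \<tau> n F x) \<partial>Pi\<^sub>M F (\<lambda>_. \<nu>))"
    using nn_integral_trace_update[OF insert.hyps(1,2) assms(2,3) b(2) assms(5)]
    unfolding psd[THEN sample_trace_eq] q(1) by (rule nn_integral_mono)
  also have "\<dots> = ennreal q * (\<integral>\<^sup>+x. ennreal (sample_trace \<tau> n F x) \<partial>Pi\<^sub>M F (\<lambda>_. \<nu>))"
    using q(2) insert.hyps by (simp add: ennreal_mult' nn_integral_cmult)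
  also have "\<dots> \<le> ennreal q * ennreal (dim * q ^ card F)"
    using insert.prems card_le by (intro mult_left_mono insert.IH) auto
  also have "\<dots> = ennreal (dim * q ^ card (insert s F))"
    using q(2) insert.hyps by (simp add: mult_ac flip: ennreal_mult)
  finally show ?case .
qed

text \<open>At the normalised vector \<open>w\<close>, the n-th power of moment 1 is at most moment
  n, hence at most the trace, hence below (1 + \<tau> g)^n; an n-th root remains to be taken. The
  factor \<tau> is kept in the conclusion: its sign decides between an upper and a lower
  bound.\<close>

lemma frame_sum_le_of_sample_trace:
  assumes "finite F" "0 \<le> b" "b \<le> 1" "b \<le> 1 + \<tau> * (dim * card F)"
    and n: "n = 2 * p" and g: "0 \<le> 1 + \<tau> * g"
    and less: "sample_trace \<tau> n F x < (1 + \<tau> * g) ^ n"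
    and supp: "\<And>i. i \<notin> I \<Longrightarrow> u i = 0"
  shows "\<tau> * (\<Sum>s\<in>F. (cmod (ip I (V (x s)) u))\<^sup>2) \<le> \<tau> * g * (\<Sum>i\<in>I. (cmod (u i))\<^sup>2)"
proof -
  let ?N = "\<Sum>i\<in>I. (cmod (u i))\<^sup>2"
  note psd_B = psd_op_sample_op[OF assms(1-4), of x]
  interpret psd_op I "sample_op \<tau> F x" by (rule psd_B)
  show ?thesis
  proof (cases "?N = 0")
    case True
    then have "\<forall>i\<in>I. u i = 0" using fin by (simp add: sum_nonneg_eq_0_iff)
    then show ?thesis by (simp add: ip_def)
  next
    case False
    moreover have "0 \<le> ?N" by (rule sum_nonneg) simp
    ultimately have N: "0 < ?N" by linarith
    define w where "w = (\<lambda>j. complex_of_real (1 / sqrt ?N) * u j)"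
    have w0: "moment w 0 = 1"
      using N by (simp add: moment_0 w_def norm_mult power_mult_distrib power_divide norm_divide flip: sum_divide_distrib)
    have "moment w 1 ^ n \<le> moment w n" by (rule moment_ge_power[OF w0])
    also have "\<dots> \<le> moment w 0 * trace_pow n"
      unfolding n by (rule moment_le_trace) (simp add: w_def supp)
    also have "\<dots> < (1 + \<tau> * g) ^ n"
      using less by (simp add: w0 sample_trace_eq[OF psd_B])
    finally have "moment w 1 < 1 + \<tau> * g" using g by (rule power_less_imp_less_base)
    moreover have "moment w 1 = 1 + \<tau> * ((\<Sum>s\<in>F. (cmod (ip I (V (x s)) u))\<^sup>2) / ?N)"
    proof -
      have "(cmod (ip I v w))\<^sup>2 = (cmod (ip I v u))\<^sup>2 / ?N" for v
        unfolding w_def ip_scale_right using N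
        by (simp add: norm_mult norm_divide power_divide)
      then show ?thesis
        using w0 by (simp add: moment_def ip_frame_op flip: sum_divide_distrib)
    qed
    ultimately have "\<tau> * ((\<Sum>s\<in>F. (cmod (ip I (V (x s)) u))\<^sup>2) / ?N) \<le> \<tau> * g" by linarith
    from mult_right_mono[OF this less_imp_le[OF N]] show ?thesis using N by simp
  qed
qed
text \<open>\<sigma> = 1 is the upper tail and \<sigma> = -1 the lower one. Markov's inequality for
  the trace of the n-th power bounds one fixed exceptional set for every n, so n may tend to
  infinity in the bound and the powers become exponentials.\<close>

theorem frame_sum_tail:
  fixes X :: "'s \<Rightarrow> 'a \<Rightarrow> 'y" and M :: "'a measure" and \<sigma> \<alpha> :: real
  assumes M: "prob_space M" and J: "finite J" "J \<noteq> {}"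
    and indep: "prob_space.indep_vars M (\<lambda>_. N) X J"
    and distr: "\<And>s. s \<in> J \<Longrightarrow> distr M N (X s) = \<nu>"
    and \<sigma>: "\<sigma> \<in> {-1, 1}" and \<alpha>: "0 < \<alpha>" "\<alpha> < 1" and I: "I \<noteq> {}"
  shows "\<exists>A\<in>sets M. measure M A \<le> dim * exp (- \<alpha>\<^sup>2 * card J / (8 * dim)) \<and>
    (\<forall>w\<in>space M - A. \<forall>u. (\<forall>i. i \<notin> I \<longrightarrow> u i = 0) \<longrightarrow>
      \<sigma> * (\<Sum>s\<in>J. (cmod (ip I (V (X s w)) u))\<^sup>2) \<le> \<sigma> * ((1 + \<sigma> * \<alpha>) * card J) * (\<Sum>i\<in>I. (cmod (u i))\<^sup>2))"
proof -
  interpret M: prob_space M by fact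
  have dim: "1 \<le> dim" using fin I by (simp add: Suc_le_eq card_gt_0_iff)
  define m where "m = real (card J)"
  have m: "1 \<le> m" unfolding m_def using J by (simp add: Suc_le_eq card_gt_0_iff)
  \<comment> \<open>The minimiser of 2 dim \<theta>^2 - \<alpha>\<theta>, which is the exponent per
    sample once exp(dim \<theta>) is bounded by 2. The minimum is -\<alpha>^2/(8 dim).\<close>
  define \<theta> where "\<theta> = \<alpha> / (4 * dim)"
  have \<theta>: "0 < \<theta>" "\<theta> < 1" unfolding \<theta>_def using \<alpha> dim by (auto simp: field_simps)
  define g where "g = (1 + \<sigma> * \<alpha>) * m"
  have g: "0 \<le> g" "\<bar>g\<bar> \<le> 2 * m" unfolding g_def using \<sigma> \<alpha> m by (auto simp: algebra_simps)
  \<comment> \<open>Even, at least 2, and so large that both \<open>b p\<close> and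
    \<open>1 + \<tau> p * g\<close> are positive: the summand \<theta> dim m serves the former and
    2m the latter.\<close>
  define n where "n = (\<lambda>p::nat. 2 * (p + 1 + nat \<lceil>\<theta> * dim * m + 2 * m\<rceil>))"
  define \<tau> where "\<tau> = (\<lambda>p. \<sigma> * \<theta> / real (n p))"
  define b where "b = (\<lambda>p. 1 - \<theta> * dim * m / real (n p))"
  have n_even: "n p = 2 * (p + 1 + nat \<lceil>\<theta> * dim * m + 2 * m\<rceil>)" for p by (simp only: n_def)
  have n_ge: "2 \<le> n p" for p by (simp add: n_def)
  have n_gt: "\<theta> * dim * m + 2 * m < real (n p)" for p
  proof -
    have "\<theta> * dim * m + 2 * m \<le> real (nat \<lceil>\<theta> * dim * m + 2 * m\<rceil>)" by linarith
    then show ?thesis unfolding n_def by simp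
  qed
  have npos: "0 < real (n p)" for p using n_ge[of p] by linarith
  have \<tau>n: "\<tau> p * real (n p) = \<sigma> * \<theta>" "\<bar>\<tau> p\<bar> * real (n p) = \<theta>" "(\<tau> p * real (n p))\<^sup>2 = \<theta>\<^sup>2"
    "\<bar>\<tau> p\<bar> = \<theta> / real (n p)" for p
    using npos[of p] \<sigma> \<theta> by (auto simp: \<tau>_def abs_mult)
  have b: "0 < b p" "b p \<le> 1" "b p \<le> 1 - \<bar>\<tau> p\<bar> * (dim * card J)" for p
  proof -
    show "0 < b p" unfolding b_def using n_gt[of p] npos[of p] m by (simp add: field_simps)
    show "b p \<le> 1" unfolding b_def using npos[of p] \<theta> m dim by (simp add: field_simps)
    show "b p \<le> 1 - \<bar>\<tau> p\<bar> * (dim * card J)" unfolding \<tau>n b_def m_def by simp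
  qed
  have b': "b p \<le> 1 + \<tau> p * (dim * card J)" for p
  proof -
    have "- \<bar>\<tau> p\<bar> \<le> \<tau> p" by linarith
    then have "- \<bar>\<tau> p\<bar> * (dim * card J) \<le> \<tau> p * (dim * card J)" by (intro mult_right_mono) auto
    then show ?thesis using b(3)[of p] by simp
  qed
  define q where "q = (\<lambda>p. 1 + \<sigma> * \<theta> + \<theta>\<^sup>2 * (exp (dim * \<theta>) / (b p)\<^sup>2 * dim))"
  have q_eq: "q p = 1 + \<tau> p * real (n p) + (\<tau> p * real (n p))\<^sup>2 *
      (exp (dim * \<bar>\<tau> p\<bar> * real (n p)) / (b p)\<^sup>2 * dim)" for p
    unfolding q_def using \<tau>n(1-3)[of p] by (simp add: mult.assoc)
  have q: "0 \<le> q p" for p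
  proof -
    have "0 \<le> 1 + \<sigma> * \<theta>" using \<sigma> \<theta> by auto
    then show ?thesis unfolding q_def by simp
  qed
  have c: "0 < 1 + \<tau> p * g" for p
  proof -
    have "\<bar>\<tau> p * g\<bar> < 1"
    proof -
      have "\<bar>\<tau> p * g\<bar> \<le> 1 / real (n p) * (2 * m)"
        unfolding abs_mult \<tau>n using g \<theta> npos[of p] by (intro mult_mono divide_right_mono) auto
      also have "\<dots> < 1"
      proof -
        have "0 \<le> \<theta> * dim * m" using \<theta> m by simp
        then show ?thesis using n_gt[of p] npos[of p] by (simp add: field_simps)
      qed
      finally show ?thesis .
    qed
    then show ?thesis by linarith
  qed
  \<comment> \<open>The joint sample as a point of the product space; independence says that its law
    is the product measure over which the trace was integrated.\<close>
  define Y where "Y = (\<lambda>w. \<lambda>s\<in>J. X s w)"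
  have rv: "X s \<in> M \<rightarrow>\<^sub>M N" if "s \<in> J" for s
    using indep that unfolding M.indep_vars_def by blast
  have sets_N: "sets \<nu> = sets N" using distr J by (metis all_not_in_conv sets_distr)
  have Y [measurable]: "Y \<in> M \<rightarrow>\<^sub>M Pi\<^sub>M J (\<lambda>_. \<nu>)"
    unfolding Y_def using rv by (intro measurable_restrict) (simp cong: measurable_cong_sets add: sets_N)
  have Y_distr: "distr M (Pi\<^sub>M J (\<lambda>_. \<nu>)) Y = Pi\<^sub>M J (\<lambda>_. \<nu>)"
  proof -
    have "distr M (Pi\<^sub>M J (\<lambda>_. \<nu>)) Y = distr M (Pi\<^sub>M J (\<lambda>_. N)) Y"
      by (intro distr_cong sets_PiM_cong refl sets_N)
    also have "\<dots> = Pi\<^sub>M J (\<lambda>s. distr M N (X s))"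
      using M.indep_vars_iff_distr_eq_PiM'[of J X "\<lambda>_. N"] indep J rv unfolding Y_def by blast
    also have "\<dots> = Pi\<^sub>M J (\<lambda>_. \<nu>)" by (intro PiM_cong refl distr)
    finally show ?thesis .
  qed
  define T where "T = (\<lambda>p. sample_trace (\<tau> p) (n p) J)"
  have T_meas [measurable]: "T p \<in> borel_measurable (Pi\<^sub>M J (\<lambda>_. \<nu>))" for p
    unfolding T_def using J by simp
  \<comment> \<open>An intersection over all exponents: its measure is bounded by Markov's
    inequality for each of them, while a point outside \<open>A\<close> has some exponent at which
    the trace is small, and one exponent suffices.\<close>
  define A where "A = (\<Inter>p. {w \<in> space M. (1 + \<tau> p * g) ^ n p \<le> T p (Y w)})"
  have A_sets: "A \<in> sets M" unfolding A_def by measurable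
  have bound: "measure M A * (1 + \<tau> p * g) ^ n p \<le> dim * q p ^ card J" for p
  proof -
    let ?c = "(1 + \<tau> p * g) ^ n p"
    have "ennreal ?c * emeasure M A = (\<integral>\<^sup>+w. ennreal ?c * indicator A w \<partial>M)"
      using A_sets by (simp add: nn_integral_cmult)
    also have "\<dots> \<le> (\<integral>\<^sup>+w. ennreal (T p (Y w)) \<partial>M)"
      by (intro nn_integral_mono) (auto simp: A_def indicator_def intro!: ennreal_leI)
    also have "\<dots> = (\<integral>\<^sup>+x. ennreal (T p x) \<partial>distr M (Pi\<^sub>M J (\<lambda>_. \<nu>)) Y)"
      by (subst nn_integral_distr) simp_all
    also have "\<dots> \<le> ennreal (dim * q p ^ card J)"
      unfolding Y_distr T_def
      by (rule nn_integral_sample_trace_le[OF J(1) b n_ge q_eq q])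
    finally show ?thesis
      using c[of p] q[of p] by (simp add: M.emeasure_eq_measure mult_ac flip: ennreal_mult)
  qed
  have n_lim: "filterlim n at_top sequentially"
    unfolding n_def by (rule filterlim_subseq) (simp add: strict_mono_def)
  have n_lim': "filterlim (\<lambda>p. real (n p)) at_top sequentially"
    by (rule filterlim_compose[OF filterlim_real_sequentially n_lim])
  have "(\<lambda>p. (1 + (\<sigma> * \<theta> * g) / real (n p)) ^ n p) \<longlonglongrightarrow> exp (\<sigma> * \<theta> * g)"
    by (rule filterlim_compose[OF tendsto_exp_limit_sequentially n_lim])
  then have c_lim: "(\<lambda>p. (1 + \<tau> p * g) ^ n p) \<longlonglongrightarrow> exp (\<sigma> * \<theta> * g)"
    by (simp add: \<tau>_def)
  have "b \<longlonglongrightarrow> 1 - 0"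
    unfolding b_def by (intro tendsto_diff tendsto_const tendsto_divide_0[OF tendsto_const] filterlim_at_top_imp_at_infinity n_lim')
  then have q_lim: "q \<longlonglongrightarrow> 1 + \<sigma> * \<theta> + \<theta>\<^sup>2 * (exp (dim * \<theta>) / (1 - 0)\<^sup>2 * dim)"
    unfolding q_def by (intro tendsto_intros) auto
  define z where "z = \<sigma> * \<theta> + \<theta>\<^sup>2 * (exp (dim * \<theta>) * dim)"
  have "measure M A * exp (\<sigma> * \<theta> * g) \<le> dim * (1 + z) ^ card J"
  proof (rule LIMSEQ_le)
    show "(\<lambda>p. measure M A * (1 + \<tau> p * g) ^ n p) \<longlonglongrightarrow> measure M A * exp (\<sigma> * \<theta> * g)"
      by (intro tendsto_intros c_lim)
    show "(\<lambda>p. dim * q p ^ card J) \<longlonglongrightarrow> dim * (1 + z) ^ card J"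
      using q_lim by (intro tendsto_intros) (simp add: z_def add_ac)
  qed (use bound in blast)
  also have "\<dots> \<le> dim * exp z ^ card J"
  proof (intro mult_left_mono power_mono)
    have "0 \<le> 1 + \<sigma> * \<theta>" "0 \<le> \<theta>\<^sup>2 * (exp (dim * \<theta>) * dim)" using \<sigma> \<theta> by auto
    then show "0 \<le> 1 + z" unfolding z_def by linarith
  qed auto
  also have "\<dots> = dim * exp (z * m)" by (simp add: m_def mult.commute flip: exp_of_nat_mult)
  finally have "measure M A * exp (\<sigma> * \<theta> * g) * exp (- (\<sigma> * \<theta> * g)) \<le> dim * exp (z * m) * exp (- (\<sigma> * \<theta> * g))"
    by (intro mult_right_mono) auto
  then have "measure M A \<le> dim * exp (z * m - \<sigma> * \<theta> * g)"
    by (simp add: mult.assoc flip: exp_add)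
  also have "\<dots> \<le> dim * exp (- \<alpha>\<^sup>2 * card J / (8 * dim))"
  proof (intro mult_left_mono exp_le_cancel_iff[THEN iffD2])
    \<comment> \<open>Here dim \<theta> = \<alpha>/4 < 1/4.\<close>
    have "exp (dim * \<theta>) \<le> 1 + dim * \<theta> + (dim * \<theta>)\<^sup>2"
      using dim \<alpha> by (intro exp_bound) (auto simp: \<theta>_def)
    also have "\<dots> \<le> 1 + 1/4 + (1/4)\<^sup>2"
      using dim \<alpha> by (intro add_mono power_mono) (auto simp: \<theta>_def)
    also have "\<dots> \<le> 2" by (simp add: power2_eq_square)
    finally have e: "exp (dim * \<theta>) \<le> 2" .
    have "\<sigma> * \<sigma> = 1" using \<sigma> by auto
    then have "z * m - \<sigma> * \<theta> * g = m * (\<theta>\<^sup>2 * (exp (dim * \<theta>) * dim) - \<theta> * \<alpha>)"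
      by (simp add: z_def g_def algebra_simps)
    also have "\<dots> \<le> m * (\<theta>\<^sup>2 * (2 * dim) - \<theta> * \<alpha>)"
      using e m dim by (intro mult_left_mono diff_right_mono mult_right_mono) auto
    also have "\<dots> = - \<alpha>\<^sup>2 * card J / (8 * dim)"
      using dim by (simp add: \<theta>_def m_def field_simps power2_eq_square)
    finally show "z * m - \<sigma> * \<theta> * g \<le> - \<alpha>\<^sup>2 * card J / (8 * dim)" .
  qed simp
  finally have A_measure: "measure M A \<le> dim * exp (- \<alpha>\<^sup>2 * card J / (8 * dim))" .
  have "\<sigma> * (\<Sum>s\<in>J. (cmod (ip I (V (X s w)) u))\<^sup>2) \<le> \<sigma> * ((1 + \<sigma> * \<alpha>) * card J) * (\<Sum>i\<in>I. (cmod (u i))\<^sup>2)"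
    if w: "w \<in> space M - A" and u: "\<forall>i. i \<notin> I \<longrightarrow> u i = 0" for w u
  proof -
    from w obtain p where p: "T p (Y w) < (1 + \<tau> p * g) ^ n p"
      unfolding A_def by (auto simp: not_le)
    have "\<tau> p * (\<Sum>s\<in>J. (cmod (ip I (V (Y w s)) u))\<^sup>2) \<le> \<tau> p * g * (\<Sum>i\<in>I. (cmod (u i))\<^sup>2)"
      using p u c[of p] b[of p] b'[of p] J
      by (intro frame_sum_le_of_sample_trace[where b = "b p" and n = "n p", OF _ _ _ _ n_even]) (auto simp: T_def)
    \<comment> \<open>Rescaling turns \<open>\<tau> p\<close> into \<sigma>, and the inequality no
      longer depends on \<open>p\<close>.\<close>
    then have "real (n p) / \<theta> * (\<tau> p * (\<Sum>s\<in>J. (cmod (ip I (V (X s w)) u))\<^sup>2))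
        \<le> real (n p) / \<theta> * (\<tau> p * g * (\<Sum>i\<in>I. (cmod (u i))\<^sup>2))"
      using \<theta> npos[of p] by (intro mult_left_mono) (auto simp: Y_def cong: sum.cong_simp)
    then show ?thesis
      using \<theta> npos[of p] by (simp add: \<tau>_def g_def m_def)
  qed
  with A_measure A_sets show ?thesis by blast
qed

end

section \<open>The Fourier transform and Gaussian damping\<close>

definition chr :: "real \<Rightarrow> complex" where
  "chr t = cis (2 * pi * t)"

lemma chr_0 [simp]: "chr 0 = 1"
  by (simp add: chr_def)

lemma chr_add: "chr (s + t) = chr s * chr t"
  by (simp add: chr_def cis_mult ring_distribs)

lemma chr_sum: "chr (\<Sum>i\<in>A. f i) = (\<Prod>i\<in>A. chr (f i))"
  by (induction A rule: infinite_finite_induct) (simp_all add: chr_add)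

lemma cnj_chr [simp]: "cnj (chr t) = chr (- t)"
  by (simp add: chr_def cis_cnj)

lemma cmod_chr [simp]: "cmod (chr t) = 1"
  by (simp add: chr_def)

lemma chr_Ints: "t \<in> \<int> \<Longrightarrow> chr t = 1"
  by (elim Ints_cases) (simp add: chr_def cis_multiple_2pi)

lemma continuous_on_chr [continuous_intros]:
  "continuous_on S f \<Longrightarrow> continuous_on S (\<lambda>x. chr (f x))"
  unfolding chr_def cis_conv_exp by (intro continuous_intros)

lemma measurable_chr [measurable]: "chr \<in> borel \<rightarrow>\<^sub>M borel"
  by (intro borel_measurable_continuous_onI continuous_intros)

text \<open>Lebesgue measure is the image of a product of one-dimensional Lebesgue measures under
  the coordinate map, so separable integrands factor.\<close>

lemma
  fixes f :: "'a::euclidean_space \<Rightarrow> real \<Rightarrow> complex"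
  assumes f: "\<And>b. b \<in> Basis \<Longrightarrow> integrable lborel (f b)"
  shows integrable_lborel_prod: "integrable lborel (\<lambda>x. \<Prod>b\<in>Basis. f b (x \<bullet> b))"
    and integral_lborel_prod:
      "(LINT x|lborel. (\<Prod>b\<in>Basis. f b (x \<bullet> b))) = (\<Prod>b\<in>Basis. (LINT t|lborel. f b t))"
proof -
  interpret product_sigma_finite "\<lambda>_::'a. lborel :: real measure" by standard
  have [measurable]: "f b \<in> borel_measurable borel" if "b \<in> Basis" for b
    using f[OF that] by (simp add: borel_measurable_integrable)
  have meas: "(\<lambda>g. \<Sum>b\<in>Basis. g b *\<^sub>R b) \<in> (\<Pi>\<^sub>M b\<in>(Basis::'a set). (lborel :: real measure)) \<rightarrow>\<^sub>M borel"
    by measurable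
  have meas2: "(\<lambda>x. \<Prod>b\<in>Basis. f b (x \<bullet> b)) \<in> borel_measurable borel" by measurable
  have eq: "(\<Prod>b\<in>Basis. f b ((\<Sum>b\<in>Basis. g b *\<^sub>R b) \<bullet> b)) = (\<Prod>b\<in>Basis. f b (g b))" for g
    by (intro prod.cong refl) simp
  show "integrable lborel (\<lambda>x. \<Prod>b\<in>Basis. f b (x \<bullet> b))"
    by (subst lborel_eq, subst integrable_distr_eq[OF meas meas2], unfold eq)
      (intro product_integrable_prod f finite_Basis)
  show "(LINT x|lborel. (\<Prod>b\<in>Basis. f b (x \<bullet> b))) = (\<Prod>b\<in>Basis. (LINT t|lborel. f b t))"
    by (subst lborel_eq, subst integral_distr[OF meas meas2], unfold eq)
      (intro product_integral_prod f finite_Basis)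
qed

lemma nn_integral_lborel_translate:
  fixes f :: "'a::euclidean_space \<Rightarrow> ennreal"
  assumes [measurable]: "f \<in> borel_measurable borel"
  shows "(\<integral>\<^sup>+x. f (t + x) \<partial>lborel) = (\<integral>\<^sup>+x. f x \<partial>lborel)"
  by (subst (2) lborel_distr_plus[symmetric, of t]) (simp add: nn_integral_distr)

lemma nn_integral_lborel_reflect:
  fixes f :: "'a::euclidean_space \<Rightarrow> ennreal"
  assumes [measurable]: "f \<in> borel_measurable borel"
  shows "(\<integral>\<^sup>+x. f (t - x) \<partial>lborel) = (\<integral>\<^sup>+x. f x \<partial>lborel)"
  by (subst (2) lborel_affine[of "- 1" t]) (simp_all add: nn_integral_density nn_integral_distr)

text \<open>The characteristic function of the standard normal distribution after the substitution x
  = ct with c^2 = 2 pi \<delta>.\<close>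

lemma
  assumes "0 < \<delta>"
  shows integrable_gaussian_real:
      "integrable lborel (\<lambda>t. complex_of_real (exp (- (pi * \<delta> * t\<^sup>2))) * chr (t * y))"
    and integral_gaussian_real:
      "(LINT t|lborel. complex_of_real (exp (- (pi * \<delta> * t\<^sup>2))) * chr (t * y))
        = of_real (exp (- (pi * y\<^sup>2 / \<delta>)) / sqrt \<delta>)"
proof -
  define c where "c = sqrt (2 * pi * \<delta>)"
  have c: "0 < c" "c\<^sup>2 = 2 * pi * \<delta>" using assms by (auto simp: c_def)
  define s where "s = 2 * pi * y / c"
  let ?f = "\<lambda>x. std_normal_density x *\<^sub>R iexp (s * x)"
  have int: "integrable lborel ?f"
    by (rule Bochner_Integration.integrable_bound[OF integrable_normal_density[of 1 0]]) auto
  have val: "(LINT x|lborel. ?f x) = of_real (exp (- (s\<^sup>2) / 2))"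
    unfolding char_std_normal_distribution[THEN fun_cong, of s, symmetric] char_def
    by (subst integral_density) auto
  have eq: "?f (0 + c * t) = of_real (1 / sqrt (2 * pi)) * (complex_of_real (exp (- (pi * \<delta> * t\<^sup>2))) * chr (t * y))" for t
  proof -
    have "(c * t)\<^sup>2 / 2 = pi * \<delta> * t\<^sup>2" by (simp add: power_mult_distrib c)
    moreover have "iexp (s * (c * t)) = chr (t * y)"
      using c by (simp add: s_def chr_def cis_conv_exp mult_ac)
    ultimately show ?thesis
      by (simp add: std_normal_density_def scaleR_conv_of_real mult_ac)
  qed
  have "integrable lborel (\<lambda>t. ?f (0 + c * t))"
    using c int by (intro lborel_integrable_real_affine) auto
  then have "integrable lborel (\<lambda>t. of_real (sqrt (2 * pi)) * ?f (0 + c * t))"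
    by (rule integrable_mult_right)
  then show "integrable lborel (\<lambda>t. complex_of_real (exp (- (pi * \<delta> * t\<^sup>2))) * chr (t * y))"
    unfolding eq by simp
  have "of_real (exp (- (s\<^sup>2) / 2)) = c *\<^sub>R (LINT t|lborel. ?f (0 + c * t))"
    using lborel_integral_real_affine[of c ?f 0] c unfolding val by simp
  also have "\<dots> = of_real (c / sqrt (2 * pi)) * (LINT t|lborel. complex_of_real (exp (- (pi * \<delta> * t\<^sup>2))) * chr (t * y))"
    unfolding eq integral_mult_right_zero by (simp add: scaleR_conv_of_real)
  also have "c / sqrt (2 * pi) = sqrt \<delta>" by (simp add: c_def real_sqrt_mult)
  also have "- s\<^sup>2 / 2 = - (pi * y\<^sup>2 / \<delta>)"
  proof -
    have "s\<^sup>2 = (2 * pi * y)\<^sup>2 / (2 * pi * \<delta>)" by (simp only: s_def power_divide c)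
    then show ?thesis using assms by (simp add: power2_eq_square field_simps)
  qed
  finally show "(LINT t|lborel. complex_of_real (exp (- (pi * \<delta> * t\<^sup>2))) * chr (t * y))
        = of_real (exp (- (pi * y\<^sup>2 / \<delta>)) / sqrt \<delta>)"
    using assms by (simp add: field_simps)
qed

definition gaussian :: "real \<Rightarrow> 'a::euclidean_space \<Rightarrow> real" where
  "gaussian \<delta> x = exp (- (pi * \<delta> * (x \<bullet> x)))"

text \<open>The Fourier transform of \<open>gaussian \<delta>\<close>: a probability density that
  concentrates at 0 as \<delta> tends to 0.\<close>

definition heat_kernel :: "real \<Rightarrow> 'a::euclidean_space \<Rightarrow> real" where
  "heat_kernel \<delta> x = gaussian (1 / \<delta>) x / sqrt \<delta> ^ DIM('a)"

lemma gaussian_pos: "0 < gaussian \<delta> x"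
  by (simp add: gaussian_def)

lemma gaussian_le_1: "0 \<le> \<delta> \<Longrightarrow> gaussian \<delta> x \<le> 1"
  by (simp add: gaussian_def)

lemma measurable_gaussian [measurable]: "gaussian \<delta> \<in> borel_measurable borel"
  unfolding gaussian_def[abs_def] by measurable

lemma heat_kernel_nonneg: "0 < \<delta> \<Longrightarrow> 0 \<le> heat_kernel \<delta> x"
  by (simp add: heat_kernel_def gaussian_pos less_imp_le)

lemma measurable_heat_kernel [measurable]: "heat_kernel \<delta> \<in> borel_measurable borel"
  unfolding heat_kernel_def[abs_def] by measurable

lemma gaussian_chr_prod:
  "complex_of_real (gaussian \<delta> x) * chr (x \<bullet> y)
    = (\<Prod>b\<in>Basis. complex_of_real (exp (- (pi * \<delta> * (x \<bullet> b)\<^sup>2))) * chr ((x \<bullet> b) * (y \<bullet> b)))"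
  unfolding gaussian_def prod.distrib chr_sum[symmetric] of_real_prod[symmetric]
  by (simp add: euclidean_inner[of x y] euclidean_inner[of x x] power2_eq_square sum_distrib_left
      flip: exp_sum sum_negf)

lemma
  fixes y :: "'a::euclidean_space"
  assumes "0 < \<delta>"
  shows integrable_gaussian_chr: "integrable lborel (\<lambda>x. complex_of_real (gaussian \<delta> x) * chr (x \<bullet> y))"
    and integral_gaussian_chr:
      "(LINT x|lborel. complex_of_real (gaussian \<delta> x) * chr (x \<bullet> y)) = of_real (heat_kernel \<delta> y)"
proof -
  show "integrable lborel (\<lambda>x. complex_of_real (gaussian \<delta> x) * chr (x \<bullet> y))"
    unfolding gaussian_chr_prod by (intro integrable_lborel_prod integrable_gaussian_real assms)
  have "(LINT x|lborel. complex_of_real (gaussian \<delta> x) * chr (x \<bullet> y))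
      = (\<Prod>b\<in>Basis. of_real (exp (- (pi * (y \<bullet> b)\<^sup>2 / \<delta>)) / sqrt \<delta>))"
    unfolding gaussian_chr_prod
    by (subst integral_lborel_prod) (simp_all add: integrable_gaussian_real integral_gaussian_real assms)
  also have "\<dots> = of_real (heat_kernel \<delta> y)"
    unfolding of_real_prod[symmetric] heat_kernel_def gaussian_def
    by (simp add: prod_dividef euclidean_inner[of y y] power2_eq_square sum_distrib_left sum_divide_distrib
        flip: exp_sum sum_negf)
  finally show "(LINT x|lborel. complex_of_real (gaussian \<delta> x) * chr (x \<bullet> y)) = of_real (heat_kernel \<delta> y)" .
qed

lemma integrable_gaussian: "0 < \<delta> \<Longrightarrow> integrable lborel (gaussian \<delta> :: 'a::euclidean_space \<Rightarrow> real)"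
  using integrable_Re[OF integrable_gaussian_chr[of \<delta> "0 :: 'a"]] by simp

lemma nn_integral_heat_kernel:
  assumes "0 < \<delta>"
  shows "(\<integral>\<^sup>+x. ennreal (heat_kernel \<delta> (x :: 'a::euclidean_space)) \<partial>lborel) = 1"
proof -
  have "(LINT x|lborel. complex_of_real (gaussian (1 / \<delta>) (x::'a))) = of_real (sqrt \<delta> ^ DIM('a))"
    using integral_gaussian_chr[of "1 / \<delta>" "0 :: 'a"] assms
    by (simp add: heat_kernel_def gaussian_def real_sqrt_divide power_divide)
  then have val: "(LINT x|lborel. gaussian (1 / \<delta>) (x::'a)) = sqrt \<delta> ^ DIM('a)"
    unfolding integral_complex_of_real of_real_eq_iff .
  have int: "integrable lborel (heat_kernel \<delta> :: 'a \<Rightarrow> real)"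
    unfolding heat_kernel_def[abs_def] using assms by (intro integrable_divide integrable_gaussian) simp
  have "(LINT x|lborel. heat_kernel \<delta> (x::'a)) = 1"
    unfolding heat_kernel_def integral_divide_zero val using assms by simp
  then show "(\<integral>\<^sup>+x. ennreal (heat_kernel \<delta> (x::'a)) \<partial>lborel) = 1"
    using nn_integral_eq_integral[OF int] assms by (simp add: heat_kernel_nonneg)
qed

lemma nn_integral_heat_kernel_diff:
  fixes x :: "'a::euclidean_space"
  assumes "0 < \<delta>"
  shows "(\<integral>\<^sup>+y. ennreal (heat_kernel \<delta> (x - y)) \<partial>lborel) = 1"
    and "(\<integral>\<^sup>+y. ennreal (heat_kernel \<delta> (y - x)) \<partial>lborel) = 1"
  using nn_integral_lborel_reflect[of "\<lambda>y. ennreal (heat_kernel \<delta> y)" x]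
    nn_integral_lborel_translate[of "\<lambda>y. ennreal (heat_kernel \<delta> y)" "- x"]
    nn_integral_heat_kernel[OF assms, where 'a = 'a]
  by simp_all

text \<open>Holds without integrability, since the Bochner integral then has the default value
  0.\<close>

lemma norm_integral_le_nn_integral:
  fixes f :: "'a \<Rightarrow> 'b::{banach, second_countable_topology}"
  shows "ennreal (norm (integral\<^sup>L M f)) \<le> (\<integral>\<^sup>+x. ennreal (norm (f x)) \<partial>M)"
  by (cases "integrable M f") (simp_all add: integral_norm_bound_ennreal not_integrable_integral_eq)

lemma lebesgue_integral_cnj: "(LINT x|M. cnj (f x)) = cnj (LINT x|M. f x)"
  by (rule integral_bounded_linear'[OF bounded_linear_cnj bounded_linear_cnj]) simp

section \<open>The Fourier integral and its norm inequality\<close>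

lemma fourier_chr: "fourier f \<omega> = (LINT x|lborel. f x * chr (- (x \<bullet> \<omega>)))"
  by (simp add: fourier_def chr_def cis_conv_exp mult_ac)

lemma measurable_fourier [measurable]:
  assumes [measurable]: "f \<in> borel_measurable borel"
  shows "fourier f \<in> borel_measurable borel"
  unfolding fourier_chr[abs_def] by measurable

lemma cmod_fourier_le: "cmod (fourier f \<omega>) \<le> (LINT x|lborel. cmod (f x))"
  unfolding fourier_chr by (rule order_trans[OF integral_norm_bound]) (simp add: norm_mult)

text \<open>Fubini for the absolutely integrable kernel h(x) g(\<omega>). With a modulated Gaussian
  as \<open>g\<close> it moves the transform from an arbitrary function to an explicit one.\<close>

lemma fourier_multiplication:
  fixes h g :: "real ^ 'd \<Rightarrow> complex"
  assumes h: "integrable lborel h" and g: "integrable lborel g"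
  shows "(LINT \<omega>|lborel. fourier h \<omega> * g \<omega>) = (LINT x|lborel. h x * fourier g x)"
proof -
  have [measurable]: "h \<in> borel_measurable borel" "g \<in> borel_measurable borel"
    using h g by (simp_all add: borel_measurable_integrable)
  let ?F = "\<lambda>x \<omega>. h x * g \<omega> * chr (- (x \<bullet> \<omega>))"
  have int1: "integrable lborel (\<lambda>\<omega>. ?F x \<omega>)" for x
    by (rule Bochner_Integration.integrable_bound[of _ "\<lambda>\<omega>. h x * g \<omega>"]) (use g in \<open>auto simp: norm_mult\<close>)
  have "integrable (lborel \<Otimes>\<^sub>M lborel) (case_prod ?F)"
  proof (rule lborel_pair.Fubini_integrable)
    show "integrable lborel (\<lambda>x. LINT \<omega>|lborel. cmod (case (x, \<omega>) of (x, \<omega>) \<Rightarrow> ?F x \<omega>))"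
      using h by (simp add: norm_mult)
  qed (use int1 in \<open>simp_all\<close>)
  then have "(LINT \<omega>|lborel. LINT x|lborel. ?F x \<omega>) = (LINT x|lborel. LINT \<omega>|lborel. ?F x \<omega>)"
    by (rule lborel_pair.Fubini_integral)
  moreover have "(LINT x|lborel. ?F x \<omega>) = fourier h \<omega> * g \<omega>" for \<omega>
    unfolding fourier_chr by (subst integral_mult_left_zero[symmetric]) (simp add: mult_ac)
  moreover have "(LINT \<omega>|lborel. ?F x \<omega>) = h x * fourier g x" for x
    unfolding fourier_chr
    by (subst integral_mult_right_zero[symmetric]) (simp add: mult_ac inner_commute)
  ultimately show ?thesis by simp
qed

lemma fourier_gaussian_chr:
  assumes "0 < \<delta>"
  shows "fourier (\<lambda>\<omega>. complex_of_real (gaussian \<delta> \<omega>) * chr (\<omega> \<bullet> y)) z = of_real (heat_kernel \<delta> (y - z))"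
proof -
  have "fourier (\<lambda>\<omega>. complex_of_real (gaussian \<delta> \<omega>) * chr (\<omega> \<bullet> y)) z
      = (LINT \<omega>|lborel. complex_of_real (gaussian \<delta> \<omega>) * chr (\<omega> \<bullet> (y - z)))"
    unfolding fourier_chr by (simp add: inner_diff_right mult.assoc flip: chr_add)
  then show ?thesis using integral_gaussian_chr[OF assms] by simp
qed

text \<open>Damping by a Gaussian turns \<open>\<integral>|fourier h|\<^sup>2\<close> into the integral of \<open>h y * cnj (h z)\<close> against a
  symmetric probability kernel, which \<open>2 * a * b \<le> a\<^sup>2 + b\<^sup>2\<close> bounds without any density argument.\<close>

lemma nn_integral_fourier_gaussian_le:
  fixes h :: "real ^ 'd \<Rightarrow> complex"
  assumes h: "integrable lborel h" and \<delta>: "0 < \<delta>"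
  shows "(\<integral>\<^sup>+\<omega>. ennreal (gaussian \<delta> \<omega> * (cmod (fourier h \<omega>))\<^sup>2) \<partial>lborel) \<le> (\<integral>\<^sup>+x. ennreal ((cmod (h x))\<^sup>2) \<partial>lborel)"
proof -
  have [measurable]: "h \<in> borel_measurable borel"
    using h by (simp add: borel_measurable_integrable)
  define C where "C = (LINT x|lborel. cmod (h x))"
  have C: "cmod (fourier h \<omega>) \<le> C" for \<omega> unfolding C_def by (rule cmod_fourier_le)
  have C0: "0 \<le> C" unfolding C_def by simp
  have intg: "integrable lborel (\<lambda>\<omega>::real^'d. C * gaussian \<delta> \<omega>)"
    by (intro integrable_mult_right integrable_gaussian \<delta>)
  define g where "g = (\<lambda>\<omega>. complex_of_real (gaussian \<delta> \<omega>) * cnj (fourier h \<omega>))"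
  have int_g: "integrable lborel g"
    unfolding g_def using intg
    by (rule Bochner_Integration.integrable_bound)
      (auto simp: norm_mult gaussian_pos less_imp_le abs_of_pos mult.commute C0 intro!: mult_right_mono C AE_I2)
  have ghat: "fourier g y = cnj (LINT z|lborel. h z * of_real (heat_kernel \<delta> (y - z)))" for y
  proof -
    have "fourier g y = (LINT \<omega>|lborel. cnj (fourier h \<omega> * (complex_of_real (gaussian \<delta> \<omega>) * chr (\<omega> \<bullet> y))))"
      unfolding fourier_chr[of g] unfolding g_def by (intro Bochner_Integration.integral_cong) (auto simp: mult_ac)
    also have "\<dots> = cnj (LINT \<omega>|lborel. fourier h \<omega> * (complex_of_real (gaussian \<delta> \<omega>) * chr (\<omega> \<bullet> y)))"
      by (rule lebesgue_integral_cnj)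
    also have "\<dots> = cnj (LINT z|lborel. h z * of_real (heat_kernel \<delta> (y - z)))"
      by (simp add: fourier_multiplication h integrable_gaussian_chr \<delta> fourier_gaussian_chr)
    finally show ?thesis .
  qed
  have int2: "integrable lborel (\<lambda>\<omega>. gaussian \<delta> \<omega> * (cmod (fourier h \<omega>))\<^sup>2)"
  proof (rule Bochner_Integration.integrable_bound)
    show "integrable lborel (\<lambda>\<omega>::real^'d. C\<^sup>2 * gaussian \<delta> \<omega>)"
      by (intro integrable_mult_right integrable_gaussian \<delta>)
  qed (auto simp: gaussian_pos less_imp_le abs_of_pos mult.commute C0 intro!: mult_right_mono power_mono C AE_I2)
  define a where "a = (\<lambda>y. ennreal ((cmod (h y))\<^sup>2 / 2))"
  define K where "K = (\<lambda>z::real^'d. ennreal (heat_kernel \<delta> z))"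
  have [measurable]: "a \<in> borel_measurable borel" "K \<in> borel_measurable borel"
    unfolding a_def K_def by measurable
  let ?J = "LINT \<omega>|lborel. gaussian \<delta> \<omega> * (cmod (fourier h \<omega>))\<^sup>2"
  have "complex_of_real ?J = (LINT \<omega>|lborel. fourier h \<omega> * g \<omega>)"
    unfolding integral_complex_of_real[symmetric] g_def
    by (intro Bochner_Integration.integral_cong refl) (simp add: complex_norm_square del: of_real_power)
  also have "\<dots> = (LINT y|lborel. h y * cnj (LINT z|lborel. h z * of_real (heat_kernel \<delta> (y - z))))"
    by (simp add: fourier_multiplication h int_g ghat)
  finally have J: "complex_of_real ?J = (LINT y|lborel. h y * cnj (LINT z|lborel. h z * of_real (heat_kernel \<delta> (y - z))))" .
  have "0 \<le> ?J" by (intro Bochner_Integration.integral_nonneg) (simp add: gaussian_pos less_imp_le)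
  then have "ennreal ?J = ennreal (cmod (LINT y|lborel. h y * cnj (LINT z|lborel. h z * of_real (heat_kernel \<delta> (y - z)))))"
    unfolding J[symmetric] norm_of_real by simp
  also have "\<dots> \<le> (\<integral>\<^sup>+y. ennreal (cmod (h y * cnj (LINT z|lborel. h z * of_real (heat_kernel \<delta> (y - z))))) \<partial>lborel)"
    by (rule norm_integral_le_nn_integral)
  also have "\<dots> \<le> (\<integral>\<^sup>+y. \<integral>\<^sup>+z. (a y * K (y - z) + a z * K (y - z)) \<partial>lborel \<partial>lborel)"
  proof (rule nn_integral_mono)
    fix y
    have "ennreal (cmod (h y * cnj (LINT z|lborel. h z * of_real (heat_kernel \<delta> (y - z)))))
        \<le> ennreal (cmod (h y)) * (\<integral>\<^sup>+z. ennreal (cmod (h z * of_real (heat_kernel \<delta> (y - z)))) \<partial>lborel)"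
      unfolding norm_mult[of "h y"] complex_mod_cnj ennreal_mult'[OF norm_ge_zero]
      by (intro mult_left_mono norm_integral_le_nn_integral) simp
    also have "\<dots> = (\<integral>\<^sup>+z. ennreal (cmod (h y)) * ennreal (cmod (h z * of_real (heat_kernel \<delta> (y - z)))) \<partial>lborel)"
      by (simp add: nn_integral_cmult)
    also have "\<dots> \<le> (\<integral>\<^sup>+z. (a y * K (y - z) + a z * K (y - z)) \<partial>lborel)"
    proof (rule nn_integral_mono)
      fix z
      have "cmod (h y) * cmod (h z) \<le> (cmod (h y))\<^sup>2 / 2 + (cmod (h z))\<^sup>2 / 2"
        using sum_squares_bound[of "cmod (h y)" "cmod (h z)"] by simp
      then have "cmod (h y) * cmod (h z) * heat_kernel \<delta> (y - z)
          \<le> ((cmod (h y))\<^sup>2 / 2 + (cmod (h z))\<^sup>2 / 2) * heat_kernel \<delta> (y - z)"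
        by (intro mult_right_mono heat_kernel_nonneg \<delta>)
      then have "ennreal (cmod (h y) * cmod (h z) * heat_kernel \<delta> (y - z))
          \<le> ennreal ((cmod (h y))\<^sup>2 / 2 * heat_kernel \<delta> (y - z) + (cmod (h z))\<^sup>2 / 2 * heat_kernel \<delta> (y - z))"
        by (intro ennreal_leI) (simp add: ring_distribs)
      then show "ennreal (cmod (h y)) * ennreal (cmod (h z * of_real (heat_kernel \<delta> (y - z)))) \<le> a y * K (y - z) + a z * K (y - z)"
        by (simp add: a_def K_def heat_kernel_nonneg \<delta> norm_mult mult.assoc ennreal_plus flip: ennreal_mult)
    qed
    finally show "ennreal (cmod (h y * cnj (LINT z|lborel. h z * of_real (heat_kernel \<delta> (y - z)))))
      \<le> (\<integral>\<^sup>+z. (a y * K (y - z) + a z * K (y - z)) \<partial>lborel)" .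
  qed
  also have "\<dots> = (\<integral>\<^sup>+y. \<integral>\<^sup>+z. a y * K (y - z) \<partial>lborel \<partial>lborel) + (\<integral>\<^sup>+y. \<integral>\<^sup>+z. a z * K (y - z) \<partial>lborel \<partial>lborel)"
    by (simp add: nn_integral_add)
  also have "(\<integral>\<^sup>+y. \<integral>\<^sup>+z. a z * K (y - z) \<partial>lborel \<partial>lborel) = (\<integral>\<^sup>+z. \<integral>\<^sup>+y. a z * K (y - z) \<partial>lborel \<partial>lborel)"
    by (rule lborel_pair.Fubini') measurable
  also have "\<dots> = (\<integral>\<^sup>+z. a z \<partial>lborel)"
    unfolding K_def by (simp add: nn_integral_cmult nn_integral_heat_kernel_diff \<delta>)
  also have "(\<integral>\<^sup>+y. \<integral>\<^sup>+z. a y * K (y - z) \<partial>lborel \<partial>lborel) = (\<integral>\<^sup>+z. a z \<partial>lborel)"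
    unfolding K_def by (simp add: nn_integral_cmult nn_integral_heat_kernel_diff \<delta>)
  also have "(\<integral>\<^sup>+z. a z \<partial>lborel) + (\<integral>\<^sup>+z. a z \<partial>lborel) = (\<integral>\<^sup>+x. ennreal ((cmod (h x))\<^sup>2) \<partial>lborel)"
    unfolding a_def by (subst nn_integral_add[symmetric]) (simp_all flip: ennreal_plus)
  finally show ?thesis
    using nn_integral_eq_integral[OF int2] by (simp add: gaussian_pos less_imp_le)
qed

text \<open>Fatou's lemma removes the Gaussian damping as \<delta> tends to 0. The right-hand side
  may be infinite, as \<open>h\<close> is only assumed integrable.\<close>

lemma nn_integral_fourier_le:
  fixes h :: "real ^ 'd \<Rightarrow> complex"
  assumes h: "integrable lborel h"
  shows "(\<integral>\<^sup>+\<omega>. ennreal ((cmod (fourier h \<omega>))\<^sup>2) \<partial>lborel) \<le> (\<integral>\<^sup>+x. ennreal ((cmod (h x))\<^sup>2) \<partial>lborel)"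
proof -
  have [measurable]: "h \<in> borel_measurable borel"
    using h by (simp add: borel_measurable_integrable)
  define \<delta> where "\<delta> = (\<lambda>n. inverse (real (Suc n)))"
  have \<delta>: "\<delta> \<longlonglongrightarrow> 0" "0 < \<delta> n" for n
    unfolding \<delta>_def by (rule LIMSEQ_inverse_real_of_nat) simp
  have "(\<integral>\<^sup>+\<omega>. ennreal ((cmod (fourier h \<omega>))\<^sup>2) \<partial>lborel)
      = (\<integral>\<^sup>+\<omega>. liminf (\<lambda>n. ennreal (gaussian (\<delta> n) \<omega> * (cmod (fourier h \<omega>))\<^sup>2)) \<partial>lborel)"
  proof (rule nn_integral_cong)
    fix \<omega> :: "real ^ 'd"
    have "(\<lambda>n. exp (- (pi * \<delta> n * (\<omega> \<bullet> \<omega>)))) \<longlonglongrightarrow> exp (- (pi * 0 * (\<omega> \<bullet> \<omega>)))"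
      by (intro tendsto_intros \<delta>)
    then have "(\<lambda>n. ennreal (gaussian (\<delta> n) \<omega> * (cmod (fourier h \<omega>))\<^sup>2)) \<longlonglongrightarrow> ennreal (1 * (cmod (fourier h \<omega>))\<^sup>2)"
      unfolding gaussian_def by (intro tendsto_ennrealI tendsto_mult tendsto_const) simp
    then show "ennreal ((cmod (fourier h \<omega>))\<^sup>2) = liminf (\<lambda>n. ennreal (gaussian (\<delta> n) \<omega> * (cmod (fourier h \<omega>))\<^sup>2))"
      by (simp add: lim_imp_Liminf)
  qed
  also have "\<dots> \<le> liminf (\<lambda>n. \<integral>\<^sup>+\<omega>. ennreal (gaussian (\<delta> n) \<omega> * (cmod (fourier h \<omega>))\<^sup>2) \<partial>lborel)"
    by (rule nn_integral_liminf) simp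
  also have "\<dots> \<le> liminf (\<lambda>n. \<integral>\<^sup>+x. ennreal ((cmod (h x))\<^sup>2) \<partial>lborel)"
    by (intro Liminf_mono always_eventually allI nn_integral_fourier_gaussian_le h \<delta>)
  also have "\<dots> = (\<integral>\<^sup>+x. ennreal ((cmod (h x))\<^sup>2) \<partial>lborel)" by (simp add: Liminf_const)
  finally show ?thesis .
qed

section \<open>Fourier inversion for the transform on the space of square integrable functions\<close>

lemma L2_D: "f \<in> L2 \<Longrightarrow> f \<in> borel_measurable borel" "f \<in> L2 \<Longrightarrow> integrable lborel (\<lambda>x. (cmod (f x))\<^sup>2)"
  by (simp_all add: L2_def)

lemma nn_integral_L2:
  "f \<in> L2 \<Longrightarrow> (\<integral>\<^sup>+x. ennreal ((cmod (f x))\<^sup>2) \<partial>lborel) = ennreal ((L2_norm f)\<^sup>2)"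
  by (simp add: nn_integral_eq_integral L2_D L2_norm_def)

lemma L2_I:
  assumes "f \<in> borel_measurable borel" "(\<integral>\<^sup>+x. ennreal ((cmod (f x))\<^sup>2) \<partial>lborel) < \<infinity>"
  shows "f \<in> L2"
  using assms by (auto simp: L2_def intro!: integrableI_bounded)

lemma integrable_mult_L2:
  assumes "f \<in> L2" "g \<in> L2"
  shows "integrable lborel (\<lambda>x. f x * g x)"
proof (rule Bochner_Integration.integrable_bound)
  show "integrable lborel (\<lambda>x. (cmod (f x))\<^sup>2 + (cmod (g x))\<^sup>2)"
    using assms by (simp add: L2_D)
  show "(\<lambda>x. f x * g x) \<in> borel_measurable lborel"
    using assms[THEN L2_D(1)] by simp
  have "cmod (f x * g x) \<le> (cmod (f x))\<^sup>2 + (cmod (g x))\<^sup>2" for x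
  proof -
    have "2 * cmod (f x) * cmod (g x) \<le> (cmod (f x))\<^sup>2 + (cmod (g x))\<^sup>2"
      by (rule sum_squares_bound)
    moreover have "0 \<le> cmod (f x) * cmod (g x)" by simp
    ultimately show ?thesis unfolding norm_mult by linarith
  qed
  then show "AE x in lborel. norm (f x * g x) \<le> norm ((cmod (f x))\<^sup>2 + (cmod (g x))\<^sup>2)"
    by (intro AE_I2 order_trans[OF _ abs_ge_self, folded real_norm_def]) auto
qed

text \<open>The weighted mean inequality. It replaces the triangle inequality for norms by one for
  squares, which carries over directly to extended integrals and, with counting measure, to lattice
  sums.\<close>

lemma cmod_sq_le_perturb:
  assumes "0 < \<eta>"
  shows "(cmod a)\<^sup>2 \<le> (1 + \<eta>) * (cmod b)\<^sup>2 + (1 + 1 / \<eta>) * (cmod (b - a))\<^sup>2"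
proof -
  let ?b = "cmod b" and ?c = "cmod (b - a)"
  have "cmod a \<le> ?b + ?c" by (metis norm_minus_commute norm_triangle_sub)
  then have "(cmod a)\<^sup>2 \<le> (?b + ?c)\<^sup>2" by (intro power_mono) auto
  also have "\<dots> = ?b\<^sup>2 + ?c\<^sup>2 + 2 * (sqrt \<eta> * ?b) * (?c / sqrt \<eta>)"
    using assms by (simp add: power2_eq_square algebra_simps)
  also have "\<dots> \<le> ?b\<^sup>2 + ?c\<^sup>2 + ((sqrt \<eta> * ?b)\<^sup>2 + (?c / sqrt \<eta>)\<^sup>2)"
    by (intro add_left_mono sum_squares_bound)
  also have "\<dots> = (1 + \<eta>) * ?b\<^sup>2 + (1 + 1 / \<eta>) * ?c\<^sup>2"
    using assms by (simp add: power_mult_distrib power_divide algebra_simps)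
  finally show ?thesis .
qed

lemma nn_integral_sq_le_perturb:
  assumes "0 < \<eta>" and [measurable]: "a \<in> borel_measurable M" "b \<in> borel_measurable M"
  shows "(\<integral>\<^sup>+x. ennreal ((cmod (a x))\<^sup>2) \<partial>M)
    \<le> ennreal (1 + \<eta>) * (\<integral>\<^sup>+x. ennreal ((cmod (b x))\<^sup>2) \<partial>M)
      + ennreal (1 + 1 / \<eta>) * (\<integral>\<^sup>+x. ennreal ((cmod (b x - a x))\<^sup>2) \<partial>M)"
proof -
  have "(\<integral>\<^sup>+x. ennreal ((cmod (a x))\<^sup>2) \<partial>M) \<le> (\<integral>\<^sup>+x. ennreal (1 + \<eta>) * ennreal ((cmod (b x))\<^sup>2)
      + ennreal (1 + 1 / \<eta>) * ennreal ((cmod (b x - a x))\<^sup>2) \<partial>M)"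
  proof (rule nn_integral_mono)
    fix x
    show "ennreal ((cmod (a x))\<^sup>2) \<le> ennreal (1 + \<eta>) * ennreal ((cmod (b x))\<^sup>2)
      + ennreal (1 + 1 / \<eta>) * ennreal ((cmod (b x - a x))\<^sup>2)"
      using ennreal_leI[OF cmod_sq_le_perturb[OF assms(1), of "a x" "b x"]] assms(1)
      by (simp add: ennreal_plus ennreal_mult)
  qed
  then show ?thesis by (simp add: nn_integral_add nn_integral_cmult)
qed

lemma ennreal_le_of_perturb:
  assumes le: "\<And>\<eta>. 0 < \<eta> \<Longrightarrow> a \<le> ennreal (1 + \<eta>) * b"
  shows "a \<le> b"
proof (cases "b < top")
  case True
  have "(\<lambda>n. b * ennreal (1 + inverse (real (Suc n)))) \<longlonglongrightarrow> b * ennreal (1 + 0)"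
    by (intro ennreal_tendsto_cmult True tendsto_ennrealI tendsto_add tendsto_const LIMSEQ_inverse_real_of_nat)
  then have "a \<le> b * ennreal (1 + 0)"
    by (rule LIMSEQ_le_const) (use le in \<open>auto simp: mult.commute\<close>)
  then show ?thesis by simp
qed (simp add: not_less top_unique)

text \<open>The norm inequality for the approximants is carried to the limit by two perturbations:
  from \<open>g\<close> to \<open>fourier (h n)\<close>, and from \<open>h n\<close> to
  \<open>f\<close>.\<close>

lemma has_fourier_L2_norm_le:
  assumes "has_fourier_L2 f g"
  shows "(\<integral>\<^sup>+x. ennreal ((cmod (g x))\<^sup>2) \<partial>lborel) \<le> (\<integral>\<^sup>+x. ennreal ((cmod (f x))\<^sup>2) \<partial>lborel)"
proof -
  let ?N = "\<lambda>u. \<integral>\<^sup>+x. ennreal ((cmod (u x))\<^sup>2) \<partial>lborel"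
  from assms obtain h where f: "f \<in> L2" and g: "g \<in> L2"
    and h: "\<And>n. integrable lborel (h n)" "\<And>n. h n \<in> L2"
    and lim: "L2_tendsto h f" "L2_tendsto (\<lambda>n. fourier (h n)) g"
    unfolding has_fourier_L2_def by blast
  note [measurable] = L2_D(1)[OF f] L2_D(1)[OF g] L2_D(1)[OF h(2)]
  have *: "?N g \<le> ennreal (1 + \<eta>) * (ennreal (1 + \<eta>) * ?N f)" if \<eta>: "0 < \<eta>" for \<eta>
  proof -
    define d where "d = (\<lambda>n. ?N (\<lambda>x. h n x - f x))"
    define d' where "d' = (\<lambda>n. ?N (\<lambda>x. fourier (h n) x - g x))"
    have d: "d \<longlonglongrightarrow> 0" "d' \<longlonglongrightarrow> 0" using lim unfolding L2_tendsto_def d_def d'_def by auto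
    have le: "?N g \<le> ennreal (1 + \<eta>) * (ennreal (1 + \<eta>) * ?N f + ennreal (1 + 1 / \<eta>) * d n) + ennreal (1 + 1 / \<eta>) * d' n" for n
    proof -
      have "?N g \<le> ennreal (1 + \<eta>) * ?N (fourier (h n)) + ennreal (1 + 1 / \<eta>) * d' n"
        unfolding d'_def by (rule nn_integral_sq_le_perturb[OF \<eta>]) measurable
      also have "?N (fourier (h n)) \<le> ?N (h n)" by (rule nn_integral_fourier_le[OF h(1)])
      also have "?N (h n) \<le> ennreal (1 + \<eta>) * ?N f + ennreal (1 + 1 / \<eta>) * ?N (\<lambda>x. f x - h n x)"
        by (rule nn_integral_sq_le_perturb[OF \<eta>]) measurable
      also have "?N (\<lambda>x. f x - h n x) = d n" unfolding d_def by (simp add: norm_minus_commute)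
      finally show ?thesis by (simp add: mult_left_mono add_mono)
    qed
    have "(\<lambda>n. ennreal (1 + \<eta>) * (ennreal (1 + \<eta>) * ?N f + ennreal (1 + 1 / \<eta>) * d n) + ennreal (1 + 1 / \<eta>) * d' n)
        \<longlonglongrightarrow> ennreal (1 + \<eta>) * (ennreal (1 + \<eta>) * ?N f + ennreal (1 + 1 / \<eta>) * 0) + ennreal (1 + 1 / \<eta>) * 0"
      by (intro tendsto_add tendsto_const ennreal_tendsto_cmult d) auto
    then have "?N g \<le> ennreal (1 + \<eta>) * (ennreal (1 + \<eta>) * ?N f + ennreal (1 + 1 / \<eta>) * 0) + ennreal (1 + 1 / \<eta>) * 0"
      by (rule LIMSEQ_le_const) (use le in blast)
    then show ?thesis by simp
  qed
  show ?thesis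
  proof (rule ennreal_le_of_perturb)
    fix \<eta> :: real assume \<eta>: "0 < \<eta>"
    \<comment> \<open>Each perturbation costs one factor, and the two factors must multiply to 1 +
      \<eta>.\<close>
    have "sqrt (1 + \<eta>) - 1 > 0" using \<eta> by simp
    from *[OF this] show "?N g \<le> ennreal (1 + \<eta>) * ?N f"
      using \<eta> by (simp flip: mult.assoc ennreal_mult)
  qed
qed

text \<open>Cauchy-Schwarz makes integration against a fixed square integrable function continuous.
  It is applied to extended integrals because \<open>L2_tendsto\<close> measures distance by
  them.\<close>

lemma L2_tendsto_integral_mult:
  assumes u: "\<And>n. u n \<in> L2" and v: "v \<in> L2" and w: "w \<in> L2" and lim: "L2_tendsto u v"
  shows "(\<lambda>n. LINT x|lborel. u n x * w x) \<longlonglongrightarrow> (LINT x|lborel. v x * w x)"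
proof -
  note [measurable] = L2_D(1)[OF u] L2_D(1)[OF v] L2_D(1)[OF w]
  define D where "D = (\<lambda>n. cmod ((LINT x|lborel. u n x * w x) - (LINT x|lborel. v x * w x)))"
  let ?d = "\<lambda>n. \<integral>\<^sup>+x. ennreal ((cmod (u n x - v x))\<^sup>2) \<partial>lborel"
  let ?w = "\<integral>\<^sup>+x. ennreal ((cmod (w x))\<^sup>2) \<partial>lborel"
  have le: "ennreal ((D n)\<^sup>2) \<le> ?w * ?d n" for n
  proof -
    have "ennreal (D n) \<le> (\<integral>\<^sup>+x. ennreal (cmod (u n x - v x)) * ennreal (cmod (w x)) \<partial>lborel)"
      unfolding D_def
      by (subst Bochner_Integration.integral_diff[symmetric])
        (use norm_integral_le_nn_integral[of lborel "\<lambda>x. u n x * w x - v x * w x"]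
          in \<open>simp_all add: integrable_mult_L2 u v w norm_mult ennreal_mult flip: left_diff_distrib\<close>)
    then have "(ennreal (D n))\<^sup>2 \<le> (\<integral>\<^sup>+x. ennreal (cmod (u n x - v x)) * ennreal (cmod (w x)) \<partial>lborel)\<^sup>2"
      by (intro power_mono) auto
    also have "\<dots> \<le> (\<integral>\<^sup>+x. (ennreal (cmod (u n x - v x)))\<^sup>2 \<partial>lborel) * (\<integral>\<^sup>+x. (ennreal (cmod (w x)))\<^sup>2 \<partial>lborel)"
      by (rule Cauchy_Schwarz_nn_integral) measurable
    finally show ?thesis by (simp add: D_def ennreal_power mult.commute)
  qed
  have w_lim: "(\<lambda>n. ?w * ?d n) \<longlonglongrightarrow> ?w * 0"
    using lim unfolding L2_tendsto_def
    by (intro ennreal_tendsto_cmult) (simp_all add: nn_integral_L2 w)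
  have "(\<lambda>n. ennreal ((D n)\<^sup>2)) \<longlonglongrightarrow> 0"
  proof (rule tendsto_sandwich[OF _ _ tendsto_const])
    show "\<forall>\<^sub>F n in sequentially. ennreal ((D n)\<^sup>2) \<le> ?w * ?d n"
      using le by (intro always_eventually allI)
    show "(\<lambda>n. ?w * ?d n) \<longlonglongrightarrow> 0" using w_lim by (simp only: mult_zero_right)
  qed (intro always_eventually allI zero_le)
  then have "(\<lambda>n. (D n)\<^sup>2) \<longlonglongrightarrow> 0"
    using tendsto_ennreal_iff[of "\<lambda>n. (D n)\<^sup>2" sequentially 0] by simp
  then have "(\<lambda>n. sqrt ((D n)\<^sup>2)) \<longlonglongrightarrow> sqrt 0" by (rule tendsto_real_sqrt)
  then have "D \<longlonglongrightarrow> 0" by (simp add: D_def)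
  then show ?thesis unfolding D_def by (simp add: LIM_zero_iff tendsto_norm_zero_iff)
qed

section \<open>Gaussian means and inversion at points of continuity\<close>

lemma gaussian_chr_L2:
  assumes "0 < \<delta>"
  shows "(\<lambda>\<omega>. complex_of_real (gaussian \<delta> \<omega>) * chr (\<omega> \<bullet> (x :: real ^ 'd))) \<in> L2"
proof -
  have "integrable lborel (\<lambda>\<omega> :: real ^ 'd. (gaussian \<delta> \<omega>)\<^sup>2)"
    by (rule Bochner_Integration.integrable_bound[OF integrable_gaussian[OF assms]])
      (auto simp: power2_eq_square gaussian_pos less_imp_le abs_of_pos mult_left_le_one_le gaussian_le_1 assms intro!: AE_I2)
  then show ?thesis
    by (simp add: L2_def norm_mult)
qed

lemma heat_kernel_le:
  assumes "0 < \<delta>"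
  shows "heat_kernel \<delta> (x :: 'a::euclidean_space) \<le> 1 / sqrt \<delta> ^ DIM('a)"
  unfolding heat_kernel_def using assms by (intro divide_right_mono gaussian_le_1) auto

lemma integrable_heat_kernel_diff:
  assumes "0 < \<delta>"
  shows "integrable lborel (\<lambda>y :: 'a::euclidean_space. heat_kernel \<delta> (x - y))"
  by (rule integrableI_bounded)
    (simp_all add: heat_kernel_nonneg assms nn_integral_heat_kernel_diff)

lemma heat_kernel_L2:
  assumes "0 < \<delta>"
  shows "(\<lambda>y. complex_of_real (heat_kernel \<delta> ((x :: real ^ 'd) - y))) \<in> L2"
proof -
  let ?C = "1 / sqrt \<delta> ^ DIM(real ^ 'd)"
  have "integrable lborel (\<lambda>y. (heat_kernel \<delta> (x - y))\<^sup>2)"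
  proof (rule Bochner_Integration.integrable_bound)
    show "integrable lborel (\<lambda>y. ?C * heat_kernel \<delta> (x - y))"
      by (intro integrable_mult_right integrable_heat_kernel_diff assms)
    have "norm ((heat_kernel \<delta> (x - y))\<^sup>2) \<le> norm (?C * heat_kernel \<delta> (x - y))" for y
      unfolding power2_eq_square norm_mult
      using heat_kernel_le[OF assms, of "x - y"] heat_kernel_nonneg[OF assms, of "x - y"] assms
      by (intro mult_right_mono) auto
    then show "AE y in lborel. norm ((heat_kernel \<delta> (x - y))\<^sup>2) \<le> norm (?C * heat_kernel \<delta> (x - y))" by simp
  qed simp
  then show ?thesis by (simp add: L2_def)
qed

text \<open>For the approximants this is \<open>fourier_multiplication\<close>; on both sides the
  function is paired with a fixed square integrable one, so the identity survives the limit.\<close>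

lemma has_fourier_L2_gaussian_mean:
  assumes fg: "has_fourier_L2 f g" and \<delta>: "0 < \<delta>"
  shows "(LINT \<omega>|lborel. g \<omega> * (complex_of_real (gaussian \<delta> \<omega>) * chr (\<omega> \<bullet> x)))
    = (LINT y|lborel. f y * complex_of_real (heat_kernel \<delta> (x - y)))"
proof -
  from fg obtain h where f: "f \<in> L2" and g: "g \<in> L2"
    and h: "\<And>n. integrable lborel (h n)" "\<And>n. h n \<in> L2"
    and lim: "L2_tendsto h f" "L2_tendsto (\<lambda>n. fourier (h n)) g"
    unfolding has_fourier_L2_def by blast
  let ?p = "\<lambda>\<omega>. complex_of_real (gaussian \<delta> \<omega>) * chr (\<omega> \<bullet> x)"
  have h': "fourier (h n) \<in> L2" for n
    using L2_D(1)[OF h(2)] nn_integral_fourier_le[OF h(1), of n] h(2)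
    by (intro L2_I measurable_fourier) (auto simp: nn_integral_L2 intro: order.strict_trans1)
  have "(\<lambda>n. LINT \<omega>|lborel. fourier (h n) \<omega> * ?p \<omega>) \<longlonglongrightarrow> (LINT \<omega>|lborel. g \<omega> * ?p \<omega>)"
    by (intro L2_tendsto_integral_mult h' g gaussian_chr_L2 \<delta> lim)
  moreover have "(\<lambda>n. LINT y|lborel. h n y * complex_of_real (heat_kernel \<delta> (x - y)))
      \<longlonglongrightarrow> (LINT y|lborel. f y * complex_of_real (heat_kernel \<delta> (x - y)))"
    by (intro L2_tendsto_integral_mult h f heat_kernel_L2 \<delta> lim)
  moreover have "(LINT \<omega>|lborel. fourier (h n) \<omega> * ?p \<omega>)
      = (LINT y|lborel. h n y * complex_of_real (heat_kernel \<delta> (x - y)))" for n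
    by (simp add: fourier_multiplication h integrable_gaussian_chr \<delta> fourier_gaussian_chr)
  ultimately show ?thesis using LIMSEQ_unique by simp
qed

text \<open>An approximate identity at a point of continuity. Since \<open>f\<close> may be
  unbounded, the part far from \<open>x\<close> is controlled by comparing the n-th kernel with a
  small multiple of the fixed kernel \<open>k 0\<close>, against which \<open>f\<close> is
  integrable.\<close>

lemma heat_kernel_mean_tendsto:
  fixes f :: "real ^ 'd \<Rightarrow> complex"
  assumes f: "f \<in> L2" and cont: "isCont f x"
  shows "(\<lambda>n. LINT y|lborel. f y * complex_of_real (heat_kernel (1 / real (Suc n)) (x - y))) \<longlonglongrightarrow> f x"
proof -
  note [measurable] = L2_D(1)[OF f]
  let ?D = "DIM(real ^ 'd)"
  define k where "k = (\<lambda>n y. heat_kernel (1 / real (Suc n)) (x - y))"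
  have k_nonneg: "0 \<le> k n y" for n y unfolding k_def by (intro heat_kernel_nonneg) simp
  have k_int: "integrable lborel (k n)" for n
    unfolding k_def by (intro integrable_heat_kernel_diff) simp
  have k_one: "(LINT y|lborel. k n y) = 1" for n
  proof -
    have "ennreal (LINT y|lborel. k n y) = (\<integral>\<^sup>+y. ennreal (k n y) \<partial>lborel)"
      by (rule nn_integral_eq_integral[symmetric]) (use k_int k_nonneg in auto)
    also have "\<dots> = 1" unfolding k_def by (rule nn_integral_heat_kernel_diff) simp
    finally show ?thesis by simp
  qed
  have fk_int: "integrable lborel (\<lambda>y. f y * complex_of_real (k n y))" for n
    unfolding k_def by (intro integrable_mult_L2 f heat_kernel_L2) simp
  define B where "B = (LINT y|lborel. (cmod (f y) + cmod (f x)) * k 0 y)"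
  have B_int: "integrable lborel (\<lambda>y. (cmod (f y) + cmod (f x)) * k 0 y)"
    using integrable_norm[OF fk_int[of 0]] integrable_mult_right[OF k_int[of 0], of "cmod (f x)"]
    by (simp add: norm_mult k_nonneg ring_distribs)
  show ?thesis
  proof (rule LIMSEQ_I)
    fix \<epsilon> :: real assume \<epsilon>: "0 < \<epsilon>"
    from cont[unfolded continuous_at_eps_delta, rule_format, of "\<epsilon> / 2"] \<epsilon>
    obtain \<eta> where \<eta>: "0 < \<eta>" and near: "\<And>y. dist y x < \<eta> \<Longrightarrow> dist (f y) (f x) < \<epsilon> / 2"
      by auto
    define c where "c = pi * \<eta>\<^sup>2"
    have c: "0 < c" using \<eta> by (simp add: c_def)
    \<comment> \<open>Bounds the ratio of \<open>k n\<close> to \<open>k 0\<close> at distance at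
      least \<eta>: the normalisations contribute at most (n+1)^D, and the exponents differ by pi n
      |x - y|^2, which is at least c n.\<close>
    define C where "C = (\<lambda>n. real (Suc n) ^ ?D * exp (- (c * real n)))"
    have C_lim: "C \<longlonglongrightarrow> 0"
    proof -
      have "filterlim (\<lambda>n. c * real (Suc n)) at_top sequentially"
        by (rule filterlim_tendsto_pos_mult_at_top[OF tendsto_const c])
          (rule filterlim_compose[OF filterlim_real_sequentially filterlim_Suc])
      from filterlim_compose[OF tendsto_power_div_exp_0 this, of ?D]
      have "(\<lambda>n. (exp c / c ^ ?D) * ((c * real (Suc n)) ^ ?D / exp (c * real (Suc n)))) \<longlonglongrightarrow> (exp c / c ^ ?D) * 0"
        by (intro tendsto_mult tendsto_const)
      moreover have "(exp c / c ^ ?D) * ((c * real (Suc n)) ^ ?D / exp (c * real (Suc n))) = C n" for n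
      proof -
        have "exp (c * real (Suc n)) = exp (c * real n) * exp c"
          unfolding exp_add[symmetric] by (simp add: algebra_simps)
        then show ?thesis
          using c by (simp add: C_def power_mult_distrib exp_minus divide_simps del: of_nat_Suc)
      qed
      ultimately show ?thesis by simp
    qed
    have far: "k n y \<le> C n * k 0 y" if "\<eta> \<le> norm (x - y)" for n y
    proof -
      let ?s = "(x - y) \<bullet> (x - y)"
      have "\<eta>\<^sup>2 \<le> ?s" using that \<eta> by (simp add: dot_square_norm power_mono)
      then have "c * real n \<le> pi * real n * ?s"
        unfolding c_def by (simp add: mult_ac mult_left_mono)
      then have "- (pi * real (Suc n) * ?s) \<le> - (c * real n) + - (pi * ?s)"
        by (simp add: algebra_simps)
      then have "gaussian (real (Suc n)) (x - y) \<le> exp (- (c * real n)) * gaussian 1 (x - y)"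
        unfolding gaussian_def by (simp flip: exp_add)
      moreover have "sqrt (real (Suc n)) \<le> real (Suc n)"
        by (rule real_le_lsqrt) (auto simp: power2_eq_square)
      then have "sqrt (real (Suc n)) ^ ?D \<le> real (Suc n) ^ ?D" by (intro power_mono) auto
      ultimately have "sqrt (real (Suc n)) ^ ?D * gaussian (real (Suc n)) (x - y)
          \<le> real (Suc n) ^ ?D * (exp (- (c * real n)) * gaussian 1 (x - y))"
        by (intro mult_mono) (auto simp: gaussian_pos less_imp_le)
      moreover have "k n y = sqrt (real (Suc n)) ^ ?D * gaussian (real (Suc n)) (x - y)"
        by (simp add: k_def heat_kernel_def real_sqrt_divide power_divide mult.commute del: of_nat_Suc)
      moreover have "k 0 y = gaussian 1 (x - y)" by (simp add: k_def heat_kernel_def)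
      ultimately show ?thesis by (simp only: C_def mult.assoc)
    qed
    have bound: "cmod ((LINT y|lborel. f y * complex_of_real (k n y)) - f x) \<le> \<epsilon> / 2 + C n * B" for n
    proof -
      have "(LINT y|lborel. f y * complex_of_real (k n y)) - f x
          = (LINT y|lborel. f y * complex_of_real (k n y)) - (LINT y|lborel. f x * complex_of_real (k n y))"
        by (simp add: k_one)
      also have "\<dots> = (LINT y|lborel. f y * complex_of_real (k n y) - f x * complex_of_real (k n y))"
        by (intro Bochner_Integration.integral_diff[symmetric] fk_int integrable_mult_right integrable_of_real k_int)
      finally have "cmod ((LINT y|lborel. f y * complex_of_real (k n y)) - f x)
          = cmod (LINT y|lborel. f y * complex_of_real (k n y) - f x * complex_of_real (k n y))" by simp
      also have "\<dots> \<le> (LINT y|lborel. \<epsilon> / 2 * k n y + C n * ((cmod (f y) + cmod (f x)) * k 0 y))"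
      proof (rule order_trans[OF integral_norm_bound Bochner_Integration.integral_mono])
        show "integrable lborel (\<lambda>y. cmod (f y * complex_of_real (k n y) - f x * complex_of_real (k n y)))"
          by (intro integrable_norm Bochner_Integration.integrable_diff fk_int integrable_mult_right integrable_of_real k_int)
        show "integrable lborel (\<lambda>y. \<epsilon> / 2 * k n y + C n * ((cmod (f y) + cmod (f x)) * k 0 y))"
          by (intro Bochner_Integration.integrable_add integrable_mult_right k_int B_int)
        fix y
        have C0: "0 \<le> C n" by (simp add: C_def)
        have eq: "cmod (f y * complex_of_real (k n y) - f x * complex_of_real (k n y)) = cmod (f y - f x) * k n y"
          by (simp add: k_nonneg norm_mult flip: left_diff_distrib)
        show "cmod (f y * complex_of_real (k n y) - f x * complex_of_real (k n y))
          \<le> \<epsilon> / 2 * k n y + C n * ((cmod (f y) + cmod (f x)) * k 0 y)"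
        proof (cases "dist y x < \<eta>")
          case True
          then have "cmod (f y - f x) * k n y \<le> \<epsilon> / 2 * k n y"
            using near[OF True] by (intro mult_right_mono k_nonneg) (simp add: dist_norm)
          moreover have "0 \<le> C n * ((cmod (f y) + cmod (f x)) * k 0 y)"
            using C0 k_nonneg by simp
          ultimately show ?thesis unfolding eq by linarith
        next
          case False
          then have "k n y \<le> C n * k 0 y" by (intro far) (simp add: dist_norm norm_minus_commute)
          then have "cmod (f y - f x) * k n y \<le> (cmod (f y) + cmod (f x)) * (C n * k 0 y)"
            using k_nonneg by (intro mult_mono norm_triangle_ineq4) auto
          moreover have "0 \<le> \<epsilon> / 2 * k n y" using \<epsilon> k_nonneg[of n y] by simp
          ultimately show ?thesis unfolding eq by (simp add: mult_ac)
        qed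
      qed
      also have "\<dots> = \<epsilon> / 2 + C n * B"
        unfolding B_def
        by (subst Bochner_Integration.integral_add)
          (simp_all only: integrable_mult_right k_int B_int integral_mult_right_zero k_one mult_1_right)
      finally show ?thesis .
    qed
    have "(\<lambda>n. C n * B) \<longlonglongrightarrow> 0 * B" by (intro tendsto_mult C_lim tendsto_const)
    then have "\<forall>\<^sub>F n in sequentially. C n * B < \<epsilon> / 2"
      using \<epsilon> by (intro order_tendstoD(2)) auto
    then obtain n0 where n0: "\<And>n. n \<ge> n0 \<Longrightarrow> C n * B < \<epsilon> / 2"
      by (auto simp: eventually_sequentially)
    show "\<exists>no. \<forall>n\<ge>no. norm ((LINT y|lborel. f y * complex_of_real (heat_kernel (1 / real (Suc n)) (x - y))) - f x) < \<epsilon>"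
    proof (intro exI allI impI)
      fix n assume "n \<ge> n0"
      from n0[OF this] bound[of n]
      show "norm ((LINT y|lborel. f y * complex_of_real (heat_kernel (1 / real (Suc n)) (x - y))) - f x) < \<epsilon>"
        unfolding k_def by simp
    qed
  qed
qed

text \<open>The Gaussian means tend to the inversion integral by dominated convergence and to
  \<open>f x\<close> by continuity. This gives the value at the given point rather than almost
  everywhere.\<close>

lemma fourier_inversion:
  fixes f :: "real ^ 'd \<Rightarrow> complex"
  assumes fg: "has_fourier_L2 f g" and cont: "isCont f x" and g: "integrable lborel g"
  shows "f x = (LINT \<omega>|lborel. g \<omega> * chr (\<omega> \<bullet> x))"
proof -
  note [measurable] = borel_measurable_integrable[OF g]
  have f: "f \<in> L2" using fg by (simp add: has_fourier_L2_def)
  let ?\<delta> = "\<lambda>n. 1 / real (Suc n)"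
  have "(\<lambda>n. LINT \<omega>|lborel. g \<omega> * (complex_of_real (gaussian (?\<delta> n) \<omega>) * chr (\<omega> \<bullet> x)))
      \<longlonglongrightarrow> (LINT \<omega>|lborel. g \<omega> * chr (\<omega> \<bullet> x))"
  proof (rule integral_dominated_convergence)
    show "integrable lborel (\<lambda>\<omega>. cmod (g \<omega>))" using g by simp
    have \<delta>: "?\<delta> \<longlonglongrightarrow> 0" using LIMSEQ_inverse_real_of_nat by (simp add: inverse_eq_divide)
    have "(\<lambda>n. g \<omega> * (complex_of_real (gaussian (?\<delta> n) \<omega>) * chr (\<omega> \<bullet> x)))
      \<longlonglongrightarrow> g \<omega> * (complex_of_real (exp (- (pi * 0 * (\<omega> \<bullet> \<omega>)))) * chr (\<omega> \<bullet> x))" for \<omega>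
      unfolding gaussian_def by (intro tendsto_intros \<delta>)
    then show "AE \<omega> in lborel. (\<lambda>n. g \<omega> * (complex_of_real (gaussian (?\<delta> n) \<omega>) * chr (\<omega> \<bullet> x)))
      \<longlonglongrightarrow> g \<omega> * chr (\<omega> \<bullet> x)" by simp
    show "AE \<omega> in lborel. cmod (g \<omega> * (complex_of_real (gaussian (?\<delta> n) \<omega>) * chr (\<omega> \<bullet> x))) \<le> cmod (g \<omega>)" for n
      by (auto simp: norm_mult gaussian_pos less_imp_le abs_of_pos gaussian_le_1 intro!: AE_I2 mult_left_le)
  qed measurable
  moreover have "(\<lambda>n. LINT \<omega>|lborel. g \<omega> * (complex_of_real (gaussian (?\<delta> n) \<omega>) * chr (\<omega> \<bullet> x))) \<longlonglongrightarrow> f x"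
    using heat_kernel_mean_tendsto[OF f cont] by (simp add: has_fourier_L2_gaussian_mean[OF fg])
  ultimately show ?thesis by (rule LIMSEQ_unique[symmetric])
qed

text \<open>The complement of the support is a union of possibly uncountably many open sets;
  Lindelof's theorem selects countably many, so that the null sets can be united.\<close>

lemma AE_zero_outside_ess_support: "AE x in lborel. x \<notin> ess_support g \<longrightarrow> g x = 0"
proof -
  let ?\<F> = "{U. open U \<and> (AE x in lborel. x \<in> U \<longrightarrow> g x = 0)}"
  obtain \<F>' where \<F>': "\<F>' \<subseteq> ?\<F>" "countable \<F>'" "\<Union>\<F>' = \<Union>?\<F>"
    using Lindelof[of ?\<F>] by auto
  have "AE x in lborel. \<forall>U\<in>\<F>'. x \<in> U \<longrightarrow> g x = 0"
    using \<F>' by (intro AE_ball_countable[THEN iffD2]) auto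
  then show ?thesis
  proof eventually_elim
    case (elim x)
    show ?case
    proof
      assume "x \<notin> ess_support g"
      then have "x \<in> \<Union>\<F>'" unfolding ess_support_def \<F>'(3) by blast
      then show "g x = 0" using elim by blast
    qed
  qed
qed

section \<open>Fourier coefficients on the cube\<close>

lemma int_lattice_add: "j \<in> int_lattice \<Longrightarrow> k \<in> int_lattice \<Longrightarrow> j + k \<in> int_lattice"
  by (simp add: int_lattice_def)

lemma int_lattice_diff: "j \<in> int_lattice \<Longrightarrow> k \<in> int_lattice \<Longrightarrow> j - k \<in> int_lattice"
  by (simp add: int_lattice_def)

lemma int_lattice_inner: "j \<in> int_lattice \<Longrightarrow> k \<in> int_lattice \<Longrightarrow> j \<bullet> k \<in> \<int>"
  by (auto simp: int_lattice_def inner_vec_def intro!: Ints_sum)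

lemma countable_int_lattice: "countable (int_lattice :: (real ^ 'd) set)"
proof (rule countable_subset)
  show "(int_lattice :: (real ^ 'd) set) \<subseteq> range (\<lambda>f :: 'd \<Rightarrow> int. \<chi> i. of_int (f i))"
  proof
    fix j :: "real ^ 'd" assume "j \<in> int_lattice"
    then have j: "j = (\<chi> i. of_int \<lfloor>j $ i\<rfloor>)"
      by (auto simp: vec_eq_iff int_lattice_def elim: Ints_cases)
    show "j \<in> range (\<lambda>f :: 'd \<Rightarrow> int. \<chi> i. of_int (f i))"
      by (rule image_eqI[where x = "\<lambda>i. \<lfloor>j $ i\<rfloor>"]) (use j in simp_all)
  qed
qed simp

text \<open>Its integer translates partition space, whereas the translates of
  \<open>unit_cube\<close> overlap in their faces; the two cubes differ by a null set.\<close>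

definition half_open_cube :: "(real ^ 'd) set" where
  "half_open_cube = {x. \<forall>i. - 1 / 2 \<le> x $ i \<and> x $ i < 1 / 2}"

lemma half_open_cube_eq_Int:
  "half_open_cube = (\<Inter>i. {x :: real ^ 'd. - 1 / 2 \<le> x $ i} \<inter> {x. x $ i < 1 / 2})"
  by (auto simp: half_open_cube_def)

lemma half_open_cube_borel [measurable]: "half_open_cube \<in> sets borel"
  unfolding half_open_cube_eq_Int
  by (intro sets.countable_INT' sets.Int borel_closed borel_open closed_halfspace_component_ge
      open_halfspace_component_lt_cart closed_halfspace_component_ge_cart) (auto simp: countable_finite)

lemma half_open_cube_subset: "half_open_cube \<subseteq> unit_cube"
  by (auto simp: half_open_cube_def unit_cube_def mem_box_cart less_imp_le)

lemma AE_unit_cube_iff: "AE x in lborel. x \<in> unit_cube \<longleftrightarrow> x \<in> (half_open_cube :: (real ^ 'd) set)"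
proof -
  let ?a = "(\<chi> i. - 1 / 2) :: real ^ 'd" and ?b = "(\<chi> i. 1 / 2) :: real ^ 'd"
  have "AE x in lborel. x \<notin> cbox ?a ?b - box ?a ?b"
    by (intro AE_not_in null_sets_cbox_Diff_box)
  then show ?thesis
  proof eventually_elim
    case (elim x)
    have "x \<in> box ?a ?b \<Longrightarrow> x \<in> half_open_cube"
      by (auto simp: half_open_cube_def mem_box_cart less_imp_le)
    then show ?case using elim half_open_cube_subset unfolding unit_cube_def by auto
  qed
qed

lemma half_open_cube_tiling:
  fixes x :: "real ^ 'd"
  shows "\<exists>!j. j \<in> int_lattice \<and> x - j \<in> half_open_cube"
proof
  let ?j = "\<chi> i. of_int \<lfloor>x $ i + 1 / 2\<rfloor> :: real ^ 'd"
  show "?j \<in> int_lattice \<and> x - ?j \<in> half_open_cube"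
    by (auto simp: int_lattice_def half_open_cube_def; linarith)
  fix j assume j: "j \<in> int_lattice \<and> x - j \<in> half_open_cube"
  have "j $ i = of_int \<lfloor>x $ i + 1 / 2\<rfloor>" for i
  proof -
    obtain z where z: "j $ i = of_int z" using j by (auto simp: int_lattice_def elim: Ints_cases)
    have "- 1 / 2 \<le> x $ i - j $ i" "x $ i - j $ i < 1 / 2"
      using j by (auto simp: half_open_cube_def)
    then have "\<lfloor>x $ i + 1 / 2\<rfloor> = z" unfolding z by linarith
    then show ?thesis using z by simp
  qed
  then show "j = ?j" by (simp add: vec_eq_iff)
qed

lemma half_open_cube_diff_eq:
  assumes "x - j \<in> half_open_cube" "x - k \<in> half_open_cube" "j \<in> int_lattice" "k \<in> int_lattice"
  shows "j = k"
  using half_open_cube_tiling[of x] assms by blast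

section \<open>Extended nonnegative sums over countable sets\<close>

lemma infsum_ennreal_eq_suminf:
  fixes f :: "'a \<Rightarrow> ennreal"
  assumes "countable A" "infinite A"
  shows "(\<Sum>\<^sub>\<infinity>j\<in>A. f j) = (\<Sum>n. f (from_nat_into A n))"
proof -
  let ?g = "from_nat_into A"
  have bij: "bij_betw ?g UNIV A"
    using assms by (rule bij_betw_from_nat_into)
  have "((\<lambda>n. f (?g n)) has_sum (\<Sum>\<^sub>\<infinity>n. f (?g n))) UNIV"
    by (intro has_sum_infsum nonneg_summable_on_complete) simp
  note sums = sums_unique[OF has_sum_imp_sums[OF this]]
  have "(\<Sum>\<^sub>\<infinity>j\<in>A. f j) = (\<Sum>\<^sub>\<infinity>n. f (?g n))"
    by (rule infsum_reindex_bij_betw[OF bij, symmetric])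
  also note sums
  finally show ?thesis .
qed

text \<open>As an integral for counting measure, a lattice sum becomes accessible to Tonelli's
  theorem and to integral inequalities.\<close>

lemma infsum_eq_nn_integral_count_space:
  fixes f :: "'a \<Rightarrow> ennreal"
  assumes "countable A"
  shows "(\<Sum>\<^sub>\<infinity>j\<in>A. f j) = (\<integral>\<^sup>+j. f j \<partial>count_space A)"
proof (cases "finite A")
  case True
  then show ?thesis by (simp add: nn_integral_count_space_finite)
next
  case False
  have "(\<Sum>\<^sub>\<infinity>j\<in>A. f j) = (\<integral>\<^sup>+n. f (from_nat_into A n) \<partial>count_space UNIV)"
    unfolding nn_integral_count_space_nat by (rule infsum_ennreal_eq_suminf[OF assms False])
  also have "\<dots> = (\<integral>\<^sup>+j. f j \<partial>count_space A)"
    by (rule nn_integral_bij_count_space[OF bij_betw_from_nat_into[OF assms False]])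
  finally show ?thesis .
qed

lemma borel_measurable_infsum_ennreal:
  fixes f :: "'a \<Rightarrow> 'b \<Rightarrow> ennreal"
  assumes A: "countable A" and f: "\<And>j. j \<in> A \<Longrightarrow> f j \<in> borel_measurable M"
  shows "(\<lambda>x. \<Sum>\<^sub>\<infinity>j\<in>A. f j x) \<in> borel_measurable M"
proof (cases "finite A")
  case True
  then show ?thesis using f by simp
next
  case False
  have [measurable]: "f (from_nat_into A n) \<in> borel_measurable M" for n
    using False by (intro f from_nat_into) auto
  show ?thesis unfolding infsum_ennreal_eq_suminf[OF A False] by measurable
qed

text \<open>Periodization: the indicators of the cube at x - j sum to 1 over the lattice; inserting
  them, exchanging sum and integral and translating each term gives the claim.\<close>

lemma nn_integral_tiling:
  fixes f :: "real ^ 'd \<Rightarrow> ennreal"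
  assumes [measurable]: "f \<in> borel_measurable borel"
  shows "(\<integral>\<^sup>+x. f x \<partial>lborel)
    = (\<integral>\<^sup>+x. indicator half_open_cube x * (\<Sum>\<^sub>\<infinity>j\<in>int_lattice. f (x + j)) \<partial>lborel)"
proof -
  let ?L = "count_space (int_lattice :: (real ^ 'd) set)" and ?C = "half_open_cube :: (real ^ 'd) set"
  have one: "(\<integral>\<^sup>+j. indicator ?C (x - j) \<partial>?L) = 1" for x
  proof -
    obtain j0 where j0: "j0 \<in> int_lattice" "x - j0 \<in> ?C" and
      uniq: "\<And>j. j \<in> int_lattice \<Longrightarrow> x - j \<in> ?C \<Longrightarrow> j = j0"
      using half_open_cube_tiling[of x] by blast
    have "(\<integral>\<^sup>+j. indicator ?C (x - j) \<partial>?L) = (\<integral>\<^sup>+j. indicator {j0} j \<partial>?L)"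
    proof (rule nn_integral_cong)
      fix j assume "j \<in> space ?L"
      then have "x - j \<in> ?C \<longleftrightarrow> j = j0" using j0(2) uniq[of j] by auto
      then show "indicator ?C (x - j) = (indicator {j0} j :: ennreal)" by (simp add: indicator_def)
    qed
    also have "\<dots> = 1" using j0 by (subst nn_integral_indicator) auto
    finally show ?thesis .
  qed
  have "(\<integral>\<^sup>+x. f x \<partial>lborel) = (\<integral>\<^sup>+x. \<integral>\<^sup>+j. f x * indicator ?C (x - j) \<partial>?L \<partial>lborel)"
    by (simp add: nn_integral_cmult one)
  also have "\<dots> = (\<integral>\<^sup>+j. \<integral>\<^sup>+x. f x * indicator ?C (x - j) \<partial>lborel \<partial>?L)"
    by (intro nn_integral_count_space_nn_integral countable_int_lattice) measurable
  also have "\<dots> = (\<integral>\<^sup>+j. \<integral>\<^sup>+x. indicator ?C x * f (x + j) \<partial>lborel \<partial>?L)"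
  proof (rule nn_integral_cong)
    fix j :: "real ^ 'd"
    show "(\<integral>\<^sup>+x. f x * indicator ?C (x - j) \<partial>lborel) = (\<integral>\<^sup>+x. indicator ?C x * f (x + j) \<partial>lborel)"
      using nn_integral_lborel_translate[of "\<lambda>x. f x * indicator ?C (x - j)" j]
      by (simp add: add.commute mult.commute)
  qed
  also have "\<dots> = (\<integral>\<^sup>+x. \<integral>\<^sup>+j. indicator ?C x * f (x + j) \<partial>?L \<partial>lborel)"
    by (intro nn_integral_count_space_nn_integral[symmetric] countable_int_lattice) measurable
  also have "\<dots> = (\<integral>\<^sup>+x. indicator ?C x * (\<Sum>\<^sub>\<infinity>j\<in>int_lattice. f (x + j)) \<partial>lborel)"
    by (simp add: nn_integral_cmult infsum_eq_nn_integral_count_space countable_int_lattice)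
  finally show ?thesis .
qed

section \<open>Orthonormality of the characters on the cube and Bessel's inequality\<close>

lemma
  fixes n :: int
  shows integrable_chr_Icc: "integrable lborel (\<lambda>t. indicator {- 1/2..1/2 :: real} t *\<^sub>R chr (of_int n * t))"
    and integral_chr_Icc: "(LINT t|lborel. indicator {- 1/2..1/2 :: real} t *\<^sub>R chr (of_int n * t)) = of_bool (n = 0)"
proof -
  have cont: "continuous_on S (\<lambda>t. chr (of_int n * t))" for S by (intro continuous_intros)
  show "integrable lborel (\<lambda>t. indicator {- 1/2..1/2 :: real} t *\<^sub>R chr (of_int n * t))"
    by (rule borel_integrable_compact) (auto intro: cont)
  show "(LINT t|lborel. indicator {- 1/2..1/2 :: real} t *\<^sub>R chr (of_int n * t)) = of_bool (n = 0)"
  proof (cases "n = 0")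
    case True
    then show ?thesis by simp
  next
    case False
    define c where "c = 2 * complex_of_real pi * \<i> * of_int n"
    have c: "c \<noteq> 0" using False by (simp add: c_def)
    have chr_eq: "chr (of_int n * t) = exp (c * of_real t)" for t
      by (simp add: chr_def cis_conv_exp c_def mult_ac)
    let ?F = "\<lambda>t. exp (c * of_real t) / c"
    have "(?F has_vector_derivative chr (of_int n * t)) (at t within S)" for t S
      unfolding chr_eq
      by (rule has_vector_derivative_real_field)
        (use c in \<open>auto intro!: derivative_eq_intros\<close>)
    then have "(LINT t|lborel. indicator {- 1/2..1/2 :: real} t *\<^sub>R chr (of_int n * t)) = ?F (1/2) - ?F (- 1/2)"
      by (intro integral_FTC_atLeastAtMost cont) auto
    also have "\<dots> = 0"
    proof -
      \<comment> \<open>The end points differ by 1, so the two values of the character differ by a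
        factor \<open>chr\<close> of an integer.\<close>
      have "chr (of_int n * (1/2)) = chr (of_int n + of_int n * (- 1/2))" by simp
      also have "\<dots> = chr (of_int n * (- 1/2))" unfolding chr_add by (simp add: chr_Ints)
      finally show ?thesis unfolding chr_eq by simp
    qed
    finally show ?thesis using False by simp
  qed
qed

lemma
  fixes j :: "real ^ 'd"
  assumes j: "j \<in> int_lattice"
  shows integrable_chr_cube: "integrable lborel (\<lambda>x. indicator half_open_cube x * chr (j \<bullet> x))"
    and integral_chr_cube: "(LINT x|lborel. indicator half_open_cube x * chr (j \<bullet> x)) = of_bool (j = 0)"
proof -
  \<comment> \<open>The floor supplies the integer frequency required by the one-dimensional
    integral; on the basis it is exact because \<open>j\<close> is a lattice point.\<close>
  define f where "f = (\<lambda>b t. indicator {- 1/2..1/2 :: real} t *\<^sub>R chr (of_int \<lfloor>j \<bullet> b\<rfloor> * t))"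
  have ji: "of_int \<lfloor>j \<bullet> b\<rfloor> = j \<bullet> b" if "b \<in> Basis" for b
  proof -
    have "j \<bullet> b \<in> \<int>" using that j by (auto simp: Basis_vec_def inner_axis int_lattice_def)
    then show ?thesis by (elim Ints_cases) simp
  qed
  have "AE x in lborel. indicator half_open_cube x * chr (j \<bullet> x) = (\<Prod>b\<in>Basis. f b (x \<bullet> b))"
    using AE_unit_cube_iff
  proof eventually_elim
    case (elim x)
    have "(\<Prod>b\<in>Basis. f b (x \<bullet> b)) = (\<Prod>b\<in>Basis. indicator {- 1/2..1/2 :: real} (x \<bullet> b)) * (\<Prod>b\<in>Basis. chr ((j \<bullet> b) * (x \<bullet> b)))"
      unfolding prod.distrib[symmetric] f_def
      by (intro prod.cong refl) (simp add: ji scaleR_conv_of_real of_real_indicator)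
    also have "(\<Prod>b\<in>Basis. chr ((j \<bullet> b) * (x \<bullet> b))) = chr (j \<bullet> x)"
      by (simp add: euclidean_inner[of j x] chr_sum)
    also have "(\<Prod>b\<in>Basis. indicator {- 1/2..1/2 :: real} (x \<bullet> b)) = (indicator half_open_cube x :: complex)"
    proof -
      have "(\<Prod>b\<in>Basis. indicator {- 1/2..1/2 :: real} (x \<bullet> b)) = (indicator unit_cube x :: complex)"
      proof (cases "x \<in> unit_cube")
        case True
        then have "x \<bullet> b \<in> {- 1/2..1/2}" if "b \<in> Basis" for b
          using that by (auto simp: unit_cube_def mem_box_cart Basis_vec_def inner_axis)
        then show ?thesis using True by simp
      next
        case False
        then obtain i where "x $ i \<notin> {- 1/2..1/2}" by (auto simp: unit_cube_def mem_box_cart)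
        then have "(indicator {- 1/2..1/2 :: real} (x \<bullet> axis i 1) :: complex) = 0"
          by (simp add: inner_axis)
        moreover have "axis i (1::real) \<in> Basis" by simp
        ultimately have "(\<Prod>b\<in>Basis. indicator {- 1/2..1/2 :: real} (x \<bullet> b)) = (0 :: complex)"
          by (intro prod_zero[OF finite_Basis]) blast
        then show ?thesis using False by simp
      qed
      then show ?thesis using elim by (simp add: indicator_def)
    qed
    finally show ?case ..
  qed
  note AE = this
  have f_int: "integrable lborel (f b)" for b unfolding f_def by (rule integrable_chr_Icc)
  have [measurable]: "f b \<in> borel_measurable borel" for b
    using f_int by (simp add: borel_measurable_integrable)
  have meas: "(\<lambda>x. \<Prod>b\<in>Basis. f b (x \<bullet> b)) \<in> borel_measurable lborel"
     "(\<lambda>x. indicator half_open_cube x * chr (j \<bullet> x)) \<in> borel_measurable lborel"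
    by measurable
  show "integrable lborel (\<lambda>x. indicator half_open_cube x * chr (j \<bullet> x))"
    by (rule integrable_cong_AE[OF meas(2,1) AE, THEN iffD2]) (intro integrable_lborel_prod f_int)
  have "(LINT x|lborel. indicator half_open_cube x * chr (j \<bullet> x)) = (\<Prod>b\<in>Basis. (LINT t|lborel. f b t))"
    by (rule trans[OF integral_cong_AE[OF meas(2,1) AE] integral_lborel_prod]) (rule f_int)
  also have "\<dots> = (\<Prod>b\<in>Basis. of_bool (j \<bullet> b = 0))"
  proof (intro prod.cong refl)
    fix b :: "real ^ 'd" assume "b \<in> Basis"
    then have "real_of_int \<lfloor>j \<bullet> b\<rfloor> = j \<bullet> b" by (rule ji)
    then have "\<lfloor>j \<bullet> b\<rfloor> = 0 \<longleftrightarrow> j \<bullet> b = 0" by linarith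
    then show "(LINT t|lborel. f b t) = of_bool (j \<bullet> b = 0)"
      unfolding f_def integral_chr_Icc by simp
  qed
  also have "\<dots> = of_bool (j = 0)"
  proof (cases "j = 0")
    case False
    then obtain b where "b \<in> Basis" "j \<bullet> b \<noteq> 0" using euclidean_all_zero_iff by blast
    then have "(\<Prod>b\<in>Basis. of_bool (j \<bullet> b = 0)) = (0 :: complex)"
      by (intro prod_zero[OF finite_Basis]) auto
    then show ?thesis using False by simp
  qed simp
  finally show "(LINT x|lborel. indicator half_open_cube x * chr (j \<bullet> x)) = of_bool (j = 0)" .
qed

lemma indicator_half_open_cube_L2: "(indicator half_open_cube :: real ^ 'd \<Rightarrow> complex) \<in> L2"
proof -
  have "(\<lambda>\<omega> :: real ^ 'd. (cmod (indicator half_open_cube \<omega> :: complex))\<^sup>2) = (\<lambda>\<omega>. Re (indicator half_open_cube \<omega> * chr (0 \<bullet> \<omega>)))"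
    by (auto simp: indicator_def)
  moreover have "integrable lborel \<dots>"
    by (intro integrable_Re integrable_chr_cube) (simp add: int_lattice_def)
  ultimately show ?thesis by (simp add: L2_def)
qed

text \<open>The squared distance from \<open>F\<close> to the finite sum with coefficients
  \<open>c j\<close> is nonnegative, and by orthonormality it equals the squared norm of
  \<open>F\<close> minus the sum of |c j|^2. Finite sums then exhaust the lattice sum.\<close>

lemma bessel_cube:
  fixes F :: "real ^ 'd \<Rightarrow> complex"
  assumes F: "F \<in> L2" and supp: "\<And>x. x \<notin> half_open_cube \<Longrightarrow> F x = 0"
  shows "(\<Sum>\<^sub>\<infinity>j\<in>int_lattice. ennreal ((cmod (LINT x|lborel. F x * chr (j \<bullet> x)))\<^sup>2))
    \<le> (\<integral>\<^sup>+x. ennreal ((cmod (F x))\<^sup>2) \<partial>lborel)"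
proof -
  note [measurable] = L2_D(1)[OF F]
  define e where "e = (\<lambda>j x :: real ^ 'd. indicator half_open_cube x * chr (- (j \<bullet> x)))"
  define c where "c = (\<lambda>j. LINT x|lborel. F x * chr (j \<bullet> x))"
  have [measurable]: "e j \<in> borel_measurable borel" for j unfolding e_def by measurable
  have cnj_e: "cnj (e j x) = indicator half_open_cube x * chr (j \<bullet> x)" for j x
    by (simp add: e_def indicator_def)
  have ee: "e j x * cnj (e k x) = indicator half_open_cube x * chr ((k - j) \<bullet> x)" for j k x
    unfolding cnj_e by (simp add: e_def indicator_def inner_diff_left flip: chr_add)
  have e_L2: "e j \<in> L2" if "j \<in> int_lattice" for j
  proof -
    have "complex_of_real ((cmod (e j x))\<^sup>2) = indicator half_open_cube x * chr (0 \<bullet> x)" for x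
      by (simp add: e_def indicator_def)
    then have "integrable lborel (\<lambda>x. complex_of_real ((cmod (e j x))\<^sup>2))"
      using integrable_chr_cube[of 0] by (simp add: int_lattice_def)
    then show ?thesis unfolding complex_of_real_integrable_eq by (simp add: L2_def)
  qed
  have Fe: "F x * cnj (e j x) = F x * chr (j \<bullet> x)" for j x
    unfolding cnj_e by (cases "x \<in> half_open_cube") (simp_all add: supp)
  have int_Fe: "integrable lborel (\<lambda>x. F x * cnj (e j x))" if "j \<in> int_lattice" for j
  proof (rule integrable_mult_L2[OF F])
    show "(\<lambda>x. cnj (e j x)) \<in> L2" using e_L2[OF that] by (simp add: L2_def)
  qed
  have "(\<Sum>j\<in>J. (cmod (c j))\<^sup>2) \<le> (LINT x|lborel. (cmod (F x))\<^sup>2)" if J: "finite J" "J \<subseteq> int_lattice" for J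
  proof -
    define S where "S = (\<lambda>x. \<Sum>j\<in>J. c j * e j x)"
    have inL: "j \<in> int_lattice" if "j \<in> J" for j using J that by auto
    have FS: "F x * cnj (S x) = (\<Sum>j\<in>J. cnj (c j) * (F x * cnj (e j x)))" for x
      by (simp add: S_def sum_distrib_left mult_ac)
    have SS: "S x * cnj (S x) = (\<Sum>j\<in>J. \<Sum>k\<in>J. c j * cnj (c k) * (indicator half_open_cube x * chr ((k - j) \<bullet> x)))" for x
      unfolding S_def cnj_sum sum_product ee[symmetric] by (simp add: mult_ac)
    have int_FS: "integrable lborel (\<lambda>x. F x * cnj (S x))"
      unfolding FS by (intro Bochner_Integration.integrable_sum integrable_mult_right int_Fe inL)
    have int_SS: "integrable lborel (\<lambda>x. S x * cnj (S x))"
      unfolding SS by (intro Bochner_Integration.integrable_sum integrable_mult_right integrable_chr_cube int_lattice_diff inL)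
    have "(LINT x|lborel. F x * cnj (S x)) = (\<Sum>j\<in>J. cnj (c j) * (LINT x|lborel. F x * cnj (e j x)))"
      unfolding FS by (subst Bochner_Integration.integral_sum) (auto intro!: integrable_mult_right int_Fe inL)
    also have "\<dots> = (\<Sum>j\<in>J. cnj (c j) * c j)" unfolding Fe c_def ..
    also have "\<dots> = of_real (\<Sum>j\<in>J. (cmod (c j))\<^sup>2)"
      by (simp add: complex_norm_square mult.commute del: of_real_power)
    finally have val_FS: "(LINT x|lborel. F x * cnj (S x)) = of_real (\<Sum>j\<in>J. (cmod (c j))\<^sup>2)" .
    have int_jk: "integrable lborel (\<lambda>x. c j * cnj (c k) * (indicator half_open_cube x * chr ((k - j) \<bullet> x)))"
      if "j \<in> J" "k \<in> J" for j k
      using that by (intro integrable_mult_right integrable_chr_cube int_lattice_diff inL)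
    have "(LINT x|lborel. S x * cnj (S x)) = (\<Sum>j\<in>J. LINT x|lborel. (\<Sum>k\<in>J. c j * cnj (c k) * (indicator half_open_cube x * chr ((k - j) \<bullet> x))))"
      unfolding SS by (intro Bochner_Integration.integral_sum Bochner_Integration.integrable_sum int_jk)
    also have "\<dots> = (\<Sum>j\<in>J. \<Sum>k\<in>J. LINT x|lborel. c j * cnj (c k) * (indicator half_open_cube x * chr ((k - j) \<bullet> x)))"
      by (intro sum.cong refl Bochner_Integration.integral_sum int_jk)
    also have "\<dots> = (\<Sum>j\<in>J. \<Sum>k\<in>J. c j * cnj (c k) * of_bool (k = j))"
      unfolding integral_mult_right_zero
      by (intro sum.cong refl) (simp add: integral_chr_cube int_lattice_diff inL)
    also have "\<dots> = (\<Sum>j\<in>J. c j * cnj (c j))"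
      using J by (intro sum.cong refl) (simp add: of_bool_def if_distrib sum.delta' cong: if_cong)
    also have "\<dots> = of_real (\<Sum>j\<in>J. (cmod (c j))\<^sup>2)"
      by (simp add: complex_norm_square del: of_real_power)
    finally have val_SS: "(LINT x|lborel. S x * cnj (S x)) = of_real (\<Sum>j\<in>J. (cmod (c j))\<^sup>2)" .
    have expand: "(cmod (F x - S x))\<^sup>2 = (cmod (F x))\<^sup>2 - 2 * Re (F x * cnj (S x)) + Re (S x * cnj (S x))" for x
      unfolding cmod_power2 by (simp add: power2_eq_square algebra_simps)
    have "0 \<le> (LINT x|lborel. (cmod (F x - S x))\<^sup>2)" by simp
    also have "\<dots> = (LINT x|lborel. (cmod (F x))\<^sup>2) - 2 * (LINT x|lborel. Re (F x * cnj (S x)))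
        + (LINT x|lborel. Re (S x * cnj (S x)))"
    proof -
      have lin: "(LINT x|lborel. a x - 2 * b x + d x) = (LINT x|lborel. a x) - 2 * (LINT x|lborel. b x) + (LINT x|lborel. d x)"
        if "integrable lborel a" "integrable lborel b" "integrable lborel d" for a b d :: "real ^ 'd \<Rightarrow> real"
        using that by simp
      show ?thesis
        unfolding expand by (rule lin[OF L2_D(2)[OF F] integrable_Re[OF int_FS] integrable_Re[OF int_SS]])
    qed
    finally have "0 \<le> (LINT x|lborel. (cmod (F x))\<^sup>2) - 2 * Re (LINT x|lborel. F x * cnj (S x)) + Re (LINT x|lborel. S x * cnj (S x))"
      unfolding integral_Re[OF int_FS] integral_Re[OF int_SS] .
    then show ?thesis unfolding val_FS val_SS by simp
  qed
  then have "(\<Sum>j\<in>J. ennreal ((cmod (c j))\<^sup>2)) \<le> (\<integral>\<^sup>+x. ennreal ((cmod (F x))\<^sup>2) \<partial>lborel)"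
    if "finite J" "J \<subseteq> int_lattice" for J
    using that L2_D(2)[OF F] by (simp add: nn_integral_eq_integral sum_nonneg ennreal_leI)
  then have "(\<Sum>\<^sub>\<infinity>j\<in>int_lattice. ennreal ((cmod (c j))\<^sup>2)) \<le> (\<integral>\<^sup>+x. ennreal ((cmod (F x))\<^sup>2) \<partial>lborel)"
    by (subst nonneg_infsum_complete) (auto intro!: SUP_least)
  then show ?thesis by (simp add: c_def)
qed

section \<open>Sampling sums of multiband functions\<close>

lemma norm_sum_sq_le: "(cmod (\<Sum>i\<in>I. a i))\<^sup>2 \<le> real (card I) * (\<Sum>i\<in>I. (cmod (a i))\<^sup>2)"
proof -
  have "(cmod (\<Sum>i\<in>I. a i))\<^sup>2 \<le> (\<Sum>i\<in>I. 1 * cmod (a i))\<^sup>2"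
    by (intro power_mono) (auto intro: norm_sum)
  also have "\<dots> \<le> (\<Sum>i\<in>I. 1\<^sup>2) * (\<Sum>i\<in>I. (cmod (a i))\<^sup>2)"
    by (rule Cauchy_Schwarz_ineq_sum)
  finally show ?thesis by simp
qed

lemma AE_lborel_open_obtain:
  fixes U :: "'a::euclidean_space set"
  assumes "AE x in lborel. P x" "open U" "U \<noteq> {}"
  obtains x where "x \<in> U" "P x"
proof -
  have "\<exists>x\<in>U. P x"
  proof (rule ccontr)
    assume "\<not> (\<exists>x\<in>U. P x)"
    then have "AE x in lborel. x \<notin> U" using assms(1) by (auto elim: eventually_mono)
    then have "U \<in> null_sets lborel"
      using assms(2) by (subst AE_iff_null_sets) auto
    then have "negligible U" by (simp add: negligible_iff_null_sets null_sets_completionI)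
    then show False using open_not_negligible assms by blast
  qed
  then show ?thesis using that by blast
qed

lemma nn_integral_trig_poly_cube:
  fixes l :: "'i \<Rightarrow> real ^ 'd"
  assumes I: "finite I" and l: "\<And>i. i \<in> I \<Longrightarrow> l i \<in> int_lattice" and inj: "inj_on l I"
  shows "(\<integral>\<^sup>+x. indicator half_open_cube x * ennreal ((cmod (\<Sum>i\<in>I. a i * chr (l i \<bullet> x)))\<^sup>2) \<partial>lborel)
    = ennreal (\<Sum>i\<in>I. (cmod (a i))\<^sup>2)"
proof -
  let ?t = "\<lambda>i k x. a i * cnj (a k) * (indicator half_open_cube x * chr ((l i - l k) \<bullet> x))"
  let ?f = "\<lambda>x. indicator half_open_cube x * (cmod (\<Sum>i\<in>I. a i * chr (l i \<bullet> x)))\<^sup>2"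
  have eq: "complex_of_real (?f x) = (\<Sum>i\<in>I. \<Sum>k\<in>I. ?t i k x)" for x
  proof -
    have "complex_of_real ((cmod (\<Sum>i\<in>I. a i * chr (l i \<bullet> x)))\<^sup>2)
        = (\<Sum>i\<in>I. \<Sum>k\<in>I. (a i * chr (l i \<bullet> x)) * cnj (a k * chr (l k \<bullet> x)))"
      unfolding complex_norm_square cnj_sum sum_product ..
    also have "\<dots> = (\<Sum>i\<in>I. \<Sum>k\<in>I. a i * cnj (a k) * chr ((l i - l k) \<bullet> x))"
      by (intro sum.cong refl) (simp add: inner_diff_left chr_add[of "_ \<bullet> _" "- (_ \<bullet> _)", simplified])
    finally show ?thesis
      by (simp add: of_real_indicator sum_distrib_left mult_ac del: of_real_power)
  qed
  have t_int: "integrable lborel (?t i k)" if "i \<in> I" "k \<in> I" for i k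
    using that by (intro integrable_mult_right integrable_chr_cube int_lattice_diff l)
  have int: "integrable lborel (\<lambda>x. complex_of_real (?f x))"
    unfolding eq by (intro Bochner_Integration.integrable_sum t_int)
  have "(LINT x|lborel. complex_of_real (?f x)) = (\<Sum>i\<in>I. LINT x|lborel. (\<Sum>k\<in>I. ?t i k x))"
    unfolding eq by (intro Bochner_Integration.integral_sum Bochner_Integration.integrable_sum t_int)
  also have "\<dots> = (\<Sum>i\<in>I. \<Sum>k\<in>I. LINT x|lborel. ?t i k x)"
    by (intro sum.cong refl Bochner_Integration.integral_sum t_int)
  also have "\<dots> = (\<Sum>i\<in>I. \<Sum>k\<in>I. a i * cnj (a k) * of_bool (k = i))"
    unfolding integral_mult_right_zero
    using inj by (intro sum.cong refl) (auto simp: integral_chr_cube int_lattice_diff l inj_on_def)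
  also have "\<dots> = (\<Sum>i\<in>I. a i * cnj (a i))"
    using I by (intro sum.cong refl) (simp add: of_bool_def if_distrib sum.delta' cong: if_cong)
  also have "\<dots> = of_real (\<Sum>i\<in>I. (cmod (a i))\<^sup>2)"
    by (simp add: complex_norm_square del: of_real_power)
  finally have val: "(LINT x|lborel. ?f x) = (\<Sum>i\<in>I. (cmod (a i))\<^sup>2)"
    unfolding integral_complex_of_real of_real_eq_iff .
  have "(\<integral>\<^sup>+x. ennreal (?f x) \<partial>lborel) = ennreal (LINT x|lborel. ?f x)"
    using int unfolding complex_of_real_integrable_eq by (intro nn_integral_eq_integral) auto
  moreover have "ennreal (?f x) = indicator half_open_cube x * ennreal ((cmod (\<Sum>i\<in>I. a i * chr (l i \<bullet> x)))\<^sup>2)" for x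
    by (simp add: indicator_def)
  ultimately show ?thesis unfolding val by simp
qed

locale multiband =
  fixes I :: "'i set" and l :: "'i \<Rightarrow> real ^ 'd" and u :: "'i \<Rightarrow> real ^ 'd \<Rightarrow> complex"
  assumes fin: "finite I" and l_lattice: "\<And>i. i \<in> I \<Longrightarrow> l i \<in> int_lattice" and l_inj: "inj_on l I"
    and u_L2: "\<And>i. i \<in> I \<Longrightarrow> u i \<in> L2"
    and u_supp: "\<And>i \<omega>. i \<in> I \<Longrightarrow> \<omega> \<notin> half_open_cube \<Longrightarrow> u i \<omega> = 0"
begin

text \<open>The spectrum weighted for evaluation at \<open>x\<close>, with all bands moved into one
  cube. Its integral \<open>synth\<close> is the inverse Fourier transform of the spectrum with
  bands \<open>u i\<close>, and its squared norm \<open>energy\<close> is the candidate for the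
  value of the lattice sum.\<close>

definition fold_band :: "real ^ 'd \<Rightarrow> real ^ 'd \<Rightarrow> complex" where
  "fold_band x \<omega> = (\<Sum>i\<in>I. u i \<omega> * chr ((\<omega> + l i) \<bullet> x))"

definition synth :: "real ^ 'd \<Rightarrow> complex" where
  "synth x = (LINT \<omega>|lborel. fold_band x \<omega>)"

definition energy :: "real ^ 'd \<Rightarrow> real" where
  "energy x = (LINT \<omega>|lborel. (cmod (fold_band x \<omega>))\<^sup>2)"

definition sample_sum :: "real ^ 'd \<Rightarrow> ennreal" where
  "sample_sum x = (\<Sum>\<^sub>\<infinity>j\<in>int_lattice. ennreal ((cmod (synth (x + j)))\<^sup>2))"

text \<open>Dominates the squared folded spectrum independently of \<open>x\<close>, for the limits
  in \<open>x\<close> under the integral.\<close>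

definition majorant :: "real ^ 'd \<Rightarrow> real" where
  "majorant \<omega> = real (card I) * (\<Sum>i\<in>I. (cmod (u i \<omega>))\<^sup>2)"

lemma u_meas [measurable]: "i \<in> I \<Longrightarrow> u i \<in> borel_measurable borel"
  by (rule L2_D(1)[OF u_L2])

lemma fold_band_meas [measurable]: "fold_band x \<in> borel_measurable borel"
  unfolding fold_band_def[abs_def] by measurable

lemma integrable_majorant: "integrable lborel majorant"
  unfolding majorant_def[abs_def]
  by (intro integrable_mult_right Bochner_Integration.integrable_sum L2_D(2) u_L2)

lemma fold_band_le: "(cmod (fold_band x \<omega>))\<^sup>2 \<le> majorant \<omega>"
  unfolding fold_band_def majorant_def
  using norm_sum_sq_le[of "\<lambda>i. u i \<omega> * chr ((\<omega> + l i) \<bullet> x)" I] by (simp add: norm_mult)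

lemma majorant_nonneg: "0 \<le> majorant \<omega>"
  using fold_band_le[of 0 \<omega>] by (rule order_trans[rotated]) simp

lemma fold_band_L2: "fold_band x \<in> L2"
proof -
  have "integrable lborel (\<lambda>\<omega>. (cmod (fold_band x \<omega>))\<^sup>2)"
    by (rule Bochner_Integration.integrable_bound[OF integrable_majorant])
      (auto simp: fold_band_le majorant_nonneg)
  then show ?thesis by (simp add: L2_def)
qed

lemma fold_band_supp: "\<omega> \<notin> half_open_cube \<Longrightarrow> fold_band x \<omega> = 0"
  by (simp add: fold_band_def u_supp)

text \<open>A lattice shift of \<open>x\<close> multiplies all bands by the same character, because
  \<open>l i \<bullet> j\<close> is an integer. Hence the values on a shifted lattice are Fourier
  coefficients of a single function.\<close>

lemma fold_band_shift:
  assumes j: "j \<in> int_lattice"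
  shows "fold_band (x + j) \<omega> = fold_band x \<omega> * chr (j \<bullet> \<omega>)"
proof -
  have "chr ((\<omega> + l i) \<bullet> (x + j)) = chr ((\<omega> + l i) \<bullet> x) * chr (j \<bullet> \<omega>)" if "i \<in> I" for i
  proof -
    have "(\<omega> + l i) \<bullet> (x + j) = (\<omega> + l i) \<bullet> x + j \<bullet> \<omega> + l i \<bullet> j"
      by (simp add: inner_add_left inner_add_right inner_commute)
    then show ?thesis
      using chr_Ints[OF int_lattice_inner[OF l_lattice[OF that] j]] by (simp add: chr_add)
  qed
  then show ?thesis
    unfolding fold_band_def sum_distrib_right by (intro sum.cong) (simp_all add: mult.assoc)
qed

lemma synth_shift: "j \<in> int_lattice \<Longrightarrow> synth (x + j) = (LINT \<omega>|lborel. fold_band x \<omega> * chr (j \<bullet> \<omega>))"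
  by (simp add: synth_def fold_band_shift)

lemma energy_shift: "j \<in> int_lattice \<Longrightarrow> energy (x + j) = energy x"
  by (simp add: energy_def fold_band_shift norm_mult)

lemma sample_sum_shift:
  assumes "j \<in> int_lattice"
  shows "sample_sum (x + j) = sample_sum x"
proof -
  have "bij_betw (\<lambda>k. j + k) int_lattice int_lattice"
    by (rule bij_betw_byWitness[where f' = "\<lambda>k. k - j"])
      (use assms in \<open>auto simp: int_lattice_add int_lattice_diff\<close>)
  from infsum_reindex_bij_betw[OF this, of "\<lambda>k. ennreal ((cmod (synth (x + k)))\<^sup>2)"]
  show ?thesis unfolding sample_sum_def by (simp add: add.assoc)
qed

lemma ennreal_energy: "ennreal (energy x) = (\<integral>\<^sup>+\<omega>. ennreal ((cmod (fold_band x \<omega>))\<^sup>2) \<partial>lborel)"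
  unfolding energy_def by (intro nn_integral_eq_integral[symmetric] L2_D(2) fold_band_L2) simp

lemma sample_sum_le_energy: "sample_sum x \<le> ennreal (energy x)"
proof -
  have "sample_sum x = (\<Sum>\<^sub>\<infinity>j\<in>int_lattice. ennreal ((cmod (LINT \<omega>|lborel. fold_band x \<omega> * chr (j \<bullet> \<omega>)))\<^sup>2))"
    unfolding sample_sum_def by (intro infsum_cong) (simp add: synth_shift)
  also have "\<dots> \<le> (\<integral>\<^sup>+\<omega>. ennreal ((cmod (fold_band x \<omega>))\<^sup>2) \<partial>lborel)"
    by (rule bessel_cube[OF fold_band_L2 fold_band_supp])
  finally show ?thesis by (simp add: ennreal_energy)
qed

lemma fold_band_integrable: "integrable lborel (\<lambda>\<omega>. fold_band x \<omega> * chr (j \<bullet> \<omega>))"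
proof (rule Bochner_Integration.integrable_bound)
  have "(\<lambda>\<omega>. fold_band x \<omega> * indicator half_open_cube \<omega>) = fold_band x"
    by (rule ext) (simp add: fold_band_supp split: split_indicator)
  then show "integrable lborel (fold_band x)"
    using integrable_mult_L2[OF fold_band_L2[of x] indicator_half_open_cube_L2] by simp
qed (auto simp: norm_mult)

lemma synth_diff_sum_le:
  "(\<Sum>\<^sub>\<infinity>j\<in>int_lattice. ennreal ((cmod (synth (x + j) - synth (y + j)))\<^sup>2))
    \<le> ennreal (LINT \<omega>|lborel. (cmod (fold_band x \<omega> - fold_band y \<omega>))\<^sup>2)"
proof -
  let ?F = "\<lambda>\<omega>. fold_band x \<omega> - fold_band y \<omega>"
  have F_L2: "?F \<in> L2"
  proof -
    have "integrable lborel (\<lambda>\<omega>. (cmod (?F \<omega>))\<^sup>2)"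
    proof (rule Bochner_Integration.integrable_bound)
      show "integrable lborel (\<lambda>\<omega>. 4 * majorant \<omega>)" by (intro integrable_mult_right integrable_majorant)
      have "(cmod (?F \<omega>))\<^sup>2 \<le> 4 * majorant \<omega>" for \<omega>
        using cmod_sq_le_perturb[of 1 "?F \<omega>" "fold_band x \<omega>"] fold_band_le[of x \<omega>] fold_band_le[of y \<omega>] by simp
      then show "AE \<omega> in lborel. norm ((cmod (?F \<omega>))\<^sup>2) \<le> norm (4 * majorant \<omega>)"
        by (simp add: majorant_nonneg)
    qed simp
    then show ?thesis by (simp add: L2_def)
  qed
  have "synth (x + j) - synth (y + j) = (LINT \<omega>|lborel. ?F \<omega> * chr (j \<bullet> \<omega>))" if "j \<in> int_lattice" for j
    using that by (simp add: synth_shift fold_band_integrable left_diff_distrib)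
  then have "(\<Sum>\<^sub>\<infinity>j\<in>int_lattice. ennreal ((cmod (synth (x + j) - synth (y + j)))\<^sup>2))
      = (\<Sum>\<^sub>\<infinity>j\<in>int_lattice. ennreal ((cmod (LINT \<omega>|lborel. ?F \<omega> * chr (j \<bullet> \<omega>)))\<^sup>2))"
    by (intro infsum_cong) simp
  also have "\<dots> \<le> (\<integral>\<^sup>+\<omega>. ennreal ((cmod (?F \<omega>))\<^sup>2) \<partial>lborel)"
    by (rule bessel_cube[OF F_L2]) (simp add: fold_band_supp)
  also have "\<dots> = ennreal (LINT \<omega>|lborel. (cmod (?F \<omega>))\<^sup>2)"
    by (intro nn_integral_eq_integral L2_D(2) F_L2) simp
  finally show ?thesis .
qed

lemma fold_band_tendsto:
  assumes "X \<longlonglongrightarrow> x"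
  shows "(\<lambda>n. fold_band (X n) \<omega>) \<longlonglongrightarrow> fold_band x \<omega>"
proof -
  have "continuous_on UNIV (\<lambda>y. fold_band y \<omega>)"
    unfolding fold_band_def by (intro continuous_intros)
  then show ?thesis using assms continuous_on_tendsto_compose[of UNIV] by fastforce
qed

lemma energy_tendsto:
  assumes X: "X \<longlonglongrightarrow> x"
  shows "(\<lambda>n. energy (X n)) \<longlonglongrightarrow> energy x"
  unfolding energy_def
proof (rule integral_dominated_convergence[OF _ _ integrable_majorant])
  show "AE \<omega> in lborel. (\<lambda>n. (cmod (fold_band (X n) \<omega>))\<^sup>2) \<longlonglongrightarrow> (cmod (fold_band x \<omega>))\<^sup>2"
    by (intro AE_I2 tendsto_power tendsto_norm fold_band_tendsto X)
qed (auto simp: fold_band_le)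

lemma continuous_energy: "continuous_on UNIV energy"
  by (intro continuous_at_imp_continuous_on ballI) (simp add: continuous_at_sequentially energy_tendsto o_def)

lemma fold_band_L2_tendsto:
  assumes X: "X \<longlonglongrightarrow> x"
  shows "(\<lambda>n. LINT \<omega>|lborel. (cmod (fold_band x \<omega> - fold_band (X n) \<omega>))\<^sup>2) \<longlonglongrightarrow> 0"
proof -
  have "(\<lambda>n. LINT \<omega>|lborel. (cmod (fold_band x \<omega> - fold_band (X n) \<omega>))\<^sup>2) \<longlonglongrightarrow> (LINT \<omega>|(lborel :: (real ^ 'd) measure). 0)"
  proof (rule integral_dominated_convergence)
    show "integrable lborel (\<lambda>\<omega>. 4 * majorant \<omega>)" by (intro integrable_mult_right integrable_majorant)
    show "AE \<omega> in lborel. (\<lambda>n. (cmod (fold_band x \<omega> - fold_band (X n) \<omega>))\<^sup>2) \<longlonglongrightarrow> 0"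
    proof (intro AE_I2)
      fix \<omega>
      have "(\<lambda>n. (cmod (fold_band x \<omega> - fold_band (X n) \<omega>))\<^sup>2) \<longlonglongrightarrow> (cmod (fold_band x \<omega> - fold_band x \<omega>))\<^sup>2"
        by (intro tendsto_power tendsto_norm tendsto_diff tendsto_const fold_band_tendsto X)
      then show "(\<lambda>n. (cmod (fold_band x \<omega> - fold_band (X n) \<omega>))\<^sup>2) \<longlonglongrightarrow> 0" by simp
    qed
    have "(cmod (fold_band x \<omega> - fold_band y \<omega>))\<^sup>2 \<le> 4 * majorant \<omega>" for y \<omega>
      using cmod_sq_le_perturb[of 1 "fold_band x \<omega> - fold_band y \<omega>" "fold_band x \<omega>"]
        fold_band_le[of x \<omega>] fold_band_le[of y \<omega>] by simp
    then show "AE \<omega> in lborel. norm ((cmod (fold_band x \<omega> - fold_band (X n) \<omega>))\<^sup>2) \<le> 4 * majorant \<omega>" for n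
      by simp
  qed simp_all
  then show ?thesis by simp
qed

lemma cmod_fold_band: "cmod (fold_band x \<omega>) = cmod (\<Sum>i\<in>I. u i \<omega> * chr (l i \<bullet> x))"
proof -
  have "fold_band x \<omega> = chr (\<omega> \<bullet> x) * (\<Sum>i\<in>I. u i \<omega> * chr (l i \<bullet> x))"
    unfolding fold_band_def sum_distrib_left
    by (intro sum.cong refl) (simp add: inner_add_left chr_add mult_ac)
  then show ?thesis by (simp add: norm_mult)
qed

lemma nn_integral_energy_cube:
  "(\<integral>\<^sup>+x. indicator half_open_cube x * ennreal (energy x) \<partial>lborel)
    = (\<Sum>i\<in>I. \<integral>\<^sup>+\<omega>. ennreal ((cmod (u i \<omega>))\<^sup>2) \<partial>lborel)"
proof -
  let ?g = "\<lambda>x \<omega>. indicator half_open_cube x * ennreal ((cmod (\<Sum>i\<in>I. u i \<omega> * chr (l i \<bullet> x)))\<^sup>2)"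
  have "(\<integral>\<^sup>+x. indicator half_open_cube x * ennreal (energy x) \<partial>lborel)
      = (\<integral>\<^sup>+x. \<integral>\<^sup>+\<omega>. ?g x \<omega> \<partial>lborel \<partial>lborel)"
    unfolding ennreal_energy cmod_fold_band by (simp add: nn_integral_cmult)
  also have "\<dots> = (\<integral>\<^sup>+\<omega>. \<integral>\<^sup>+x. ?g x \<omega> \<partial>lborel \<partial>lborel)"
    by (rule lborel_pair.Fubini') measurable
  also have "\<dots> = (\<integral>\<^sup>+\<omega>. ennreal (\<Sum>i\<in>I. (cmod (u i \<omega>))\<^sup>2) \<partial>lborel)"
    by (simp add: nn_integral_trig_poly_cube fin l_lattice l_inj)
  also have "\<dots> = (\<integral>\<^sup>+\<omega>. (\<Sum>i\<in>I. ennreal ((cmod (u i \<omega>))\<^sup>2)) \<partial>lborel)"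
    by simp
  also have "\<dots> = (\<Sum>i\<in>I. \<integral>\<^sup>+\<omega>. ennreal ((cmod (u i \<omega>))\<^sup>2) \<partial>lborel)"
    by (rule nn_integral_sum) simp
  finally show ?thesis .
qed

text \<open>Bessel's inequality gives \<open>sample_sum \<le> energy\<close> pointwise. If the norm of \<open>synth\<close> is not
  smaller than that of its spectrum, the two have the same integral over the cube and hence agree
  almost everywhere; Bessel's inequality for differences makes \<open>sample_sum\<close> continuous, which upgrades
  this to equality everywhere, without the completeness of the exponentials.\<close>

lemma sample_sum_eq_energy:
  assumes [measurable]: "synth \<in> borel_measurable borel"
    and norm: "(\<Sum>i\<in>I. \<integral>\<^sup>+\<omega>. ennreal ((cmod (u i \<omega>))\<^sup>2) \<partial>lborel) \<le> (\<integral>\<^sup>+x. ennreal ((cmod (synth x))\<^sup>2) \<partial>lborel)"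
  shows "sample_sum x = ennreal (energy x)"
proof -
  have [measurable]: "sample_sum \<in> borel_measurable borel"
    unfolding sample_sum_def[abs_def]
    by (intro borel_measurable_infsum_ennreal countable_int_lattice) measurable
  have [measurable]: "energy \<in> borel_measurable borel"
    by (rule borel_measurable_continuous_onI[OF continuous_energy])
  let ?P = "\<lambda>x. indicator half_open_cube x * sample_sum x"
  let ?Q = "\<lambda>x. indicator half_open_cube x * ennreal (energy x)"
  have PQ: "?P x \<le> ?Q x" for x by (intro mult_left_mono sample_sum_le_energy) simp
  have Q_fin: "(\<integral>\<^sup>+x. ?Q x \<partial>lborel) \<noteq> \<infinity>"
    unfolding nn_integral_energy_cube by (simp add: nn_integral_L2 u_L2)
  have QP: "(\<integral>\<^sup>+x. ?Q x \<partial>lborel) \<le> (\<integral>\<^sup>+x. ?P x \<partial>lborel)"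
    unfolding nn_integral_energy_cube sample_sum_def
    using norm by (subst nn_integral_tiling[symmetric]) measurable
  have PQ': "(\<integral>\<^sup>+x. ?P x \<partial>lborel) \<le> (\<integral>\<^sup>+x. ?Q x \<partial>lborel)" by (intro nn_integral_mono PQ)
  have "(\<integral>\<^sup>+x. ?Q x - ?P x \<partial>lborel) = (\<integral>\<^sup>+x. ?Q x \<partial>lborel) - (\<integral>\<^sup>+x. ?P x \<partial>lborel)"
    using Q_fin PQ' PQ by (intro nn_integral_diff) (auto simp: top_unique)
  also have "\<dots> = 0" using QP PQ' Q_fin by (simp add: diff_eq_0_iff_ennreal less_top)
  finally have "AE x in lborel. ?Q x - ?P x = 0"
    by (subst (asm) nn_integral_0_iff_AE) auto
  then have AE_eq: "AE x in lborel. x \<in> half_open_cube \<longrightarrow> ennreal (energy x) \<le> sample_sum x"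
    by eventually_elim (auto simp: diff_eq_0_iff_ennreal)
  have cube: "ennreal (energy c) \<le> sample_sum c" if c: "c \<in> half_open_cube" for c
  proof -
    let ?a = "(\<chi> i. - 1 / 2) :: real ^ 'd" and ?b = "(\<chi> i. 1 / 2) :: real ^ 'd"
    have box: "box ?a ?b \<subseteq> half_open_cube"
      by (auto simp: half_open_cube_def mem_box_cart less_imp_le)
    have "0 \<in> box ?a ?b" by (simp add: mem_box_cart)
    then have ne: "box ?a ?b \<noteq> {}" by blast
    have cl: "c \<in> closure (box ?a ?b)"
      unfolding closure_box[OF ne] using c half_open_cube_subset unfolding unit_cube_def by blast
    \<comment> \<open>The point \<open>c\<close> may lie on a face. Near it the open box has
      nonempty open pieces, and none of them is null, so each contains a point where the inequality
      holds.\<close>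
    have "\<exists>y. y \<in> half_open_cube \<and> dist y c < inverse (real (Suc n)) \<and> ennreal (energy y) \<le> sample_sum y" for n
    proof -
      let ?U = "box ?a ?b \<inter> ball c (inverse (real (Suc n)))"
      obtain z where "z \<in> box ?a ?b" "dist z c < inverse (real (Suc n))"
        using cl unfolding closure_approachable by (meson inverse_positive_iff_positive of_nat_0_less_iff zero_less_Suc)
      then have "z \<in> ?U" by (simp only: Int_iff mem_ball dist_commute[of c] simp_thms)
      then have U: "?U \<noteq> {}" "open ?U" by (blast, intro open_Int open_box open_ball)
      obtain y where "y \<in> ?U" "y \<in> half_open_cube \<longrightarrow> ennreal (energy y) \<le> sample_sum y"
        by (rule AE_lborel_open_obtain[OF AE_eq U(2,1)])
      then show ?thesis using box by (intro exI[of _ y]) (simp only: Int_iff mem_ball dist_commute[of c], blast)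
    qed
    then obtain Y where Y: "\<And>n. dist (Y n) c < inverse (real (Suc n))" "\<And>n. ennreal (energy (Y n)) \<le> sample_sum (Y n)"
      by metis
    have Y_lim: "Y \<longlonglongrightarrow> c"
    proof (rule metric_tendsto_imp_tendsto[OF LIMSEQ_inverse_real_of_nat])
      show "\<forall>\<^sub>F n in sequentially. dist (Y n) c \<le> dist (inverse (real (Suc n))) 0"
        using Y(1) by (intro always_eventually allI) (simp add: less_imp_le)
    qed
    show ?thesis
    proof (rule ennreal_le_of_perturb)
      fix \<eta> :: real assume \<eta>: "0 < \<eta>"
      let ?D = "\<lambda>n. ennreal (LINT \<omega>|lborel. (cmod (fold_band c \<omega> - fold_band (Y n) \<omega>))\<^sup>2)"
      have le: "ennreal (energy (Y n)) \<le> ennreal (1 + \<eta>) * sample_sum c + ennreal (1 + 1 / \<eta>) * ?D n" for n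
      proof -
        \<comment> \<open>The perturbation inequality for counting measure on the lattice.\<close>
        have "sample_sum (Y n) \<le> ennreal (1 + \<eta>) * sample_sum c
            + ennreal (1 + 1 / \<eta>) * (\<Sum>\<^sub>\<infinity>j\<in>int_lattice. ennreal ((cmod (synth (c + j) - synth (Y n + j)))\<^sup>2))"
          unfolding sample_sum_def infsum_eq_nn_integral_count_space[OF countable_int_lattice]
          by (rule nn_integral_sq_le_perturb[OF \<eta>]) auto
        also have "\<dots> \<le> ennreal (1 + \<eta>) * sample_sum c + ennreal (1 + 1 / \<eta>) * ?D n"
          by (intro add_left_mono mult_left_mono synth_diff_sum_le) simp
        finally show ?thesis using Y(2)[of n] by (rule order_trans[rotated])
      qed
      have "?D \<longlonglongrightarrow> ennreal 0"
        by (intro tendsto_ennrealI fold_band_L2_tendsto Y_lim)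
      then have lim: "(\<lambda>n. ennreal (1 + \<eta>) * sample_sum c + ennreal (1 + 1 / \<eta>) * ?D n)
          \<longlonglongrightarrow> ennreal (1 + \<eta>) * sample_sum c + ennreal (1 + 1 / \<eta>) * ennreal 0"
        by (intro tendsto_add tendsto_const ennreal_tendsto_cmult) auto
      have "(\<lambda>n. ennreal (energy (Y n))) \<longlonglongrightarrow> ennreal (energy c)"
        by (intro tendsto_ennrealI energy_tendsto Y_lim)
      from LIMSEQ_le[OF this lim] le have "ennreal (energy c) \<le> ennreal (1 + \<eta>) * sample_sum c + ennreal (1 + 1 / \<eta>) * ennreal 0"
        by blast
      then show "ennreal (energy c) \<le> ennreal (1 + \<eta>) * sample_sum c" by simp
    qed
  qed
  \<comment> \<open>Both functions are invariant under lattice shifts, so the inequality on the cube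
    is enough.\<close>
  obtain j where j: "j \<in> int_lattice" "x - j \<in> half_open_cube"
    using half_open_cube_tiling[of x] by blast
  have "energy x = energy (x - j)" "sample_sum x = sample_sum (x - j)"
    using energy_shift[OF j(1), of "x - j"] sample_sum_shift[OF j(1), of "x - j"] by simp_all
  then show ?thesis
    using cube[OF j(2)] sample_sum_le_energy[of x] by simp
qed

end

section \<open>Functions in the Paley-Wiener space\<close>

lemma
  fixes f :: "'a::euclidean_space \<Rightarrow> 'b::{banach, second_countable_topology}"
  assumes [measurable]: "f \<in> borel_measurable borel"
  shows integrable_lborel_translate_iff: "integrable lborel (\<lambda>x. f (t + x)) \<longleftrightarrow> integrable lborel f"
    and integral_lborel_translate: "(LINT x|lborel. f (t + x)) = (LINT x|lborel. f x)"
  using integrable_distr_eq[of "(+) t" lborel borel f] integral_distr[of "(+) t" lborel borel f]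
  by (simp_all add: lborel_distr_plus)

lemma unit_cube_borel [measurable]: "unit_cube \<in> sets borel"
  by (simp add: unit_cube_def)

lemma emeasure_unit_cube: "emeasure lborel (unit_cube :: (real ^ 'd) set) = 1"
proof -
  have "((\<chi> i. 1 / 2) - (\<chi> i. - 1 / 2) :: real ^ 'd) \<bullet> b = 1" if "b \<in> Basis" for b
    using that by (auto simp: Basis_vec_def inner_axis)
  moreover have "(\<chi> i. - 1 / 2 :: real ^ 'd) \<bullet> b \<le> (\<chi> i. 1 / 2) \<bullet> b" if "b \<in> Basis" for b
    using that by (auto simp: Basis_vec_def inner_axis)
  ultimately show ?thesis by (simp add: unit_cube_def)
qed

lemma uniform_measure_unit_cube:
  "uniform_measure lborel unit_cube = density lborel (\<lambda>x. ennreal (indicator unit_cube x))"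
  unfolding uniform_measure_def emeasure_unit_cube by (simp add: ennreal_indicator divide_ennreal_def)

lemma AE_translate_unit_cube_iff:
  fixes t :: "real ^ 'd"
  shows "AE x in lborel. x - t \<in> unit_cube \<longleftrightarrow> x - t \<in> half_open_cube"
proof -
  have "AE x in distr lborel borel ((+) (- t)). x \<in> unit_cube \<longleftrightarrow> x \<in> (half_open_cube :: (real ^ 'd) set)"
    unfolding lborel_distr_plus by (rule AE_unit_cube_iff)
  then have "AE x in lborel. - t + x \<in> unit_cube \<longleftrightarrow> - t + x \<in> half_open_cube"
    by (subst (asm) AE_distr_iff) measurable
  then show ?thesis by (simp add: add.commute[of "- t"])
qed

text \<open>\<open>g\<close> is cut along the half-open cubes, which changes it only on a null set.
  Being square integrable with bands of finite measure it is integrable, so inversion identifies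
  \<open>f\<close> with \<open>synth\<close> at every point.\<close>

lemma paley_wiener_multiband:
  fixes l :: "'i \<Rightarrow> real ^ 'd"
  assumes I: "finite I" and l: "\<And>i. i \<in> I \<Longrightarrow> l i \<in> int_lattice" and inj: "inj_on l I"
    and f: "f \<in> paley_wiener (\<Union>i\<in>I. (\<lambda>y. y + l i) ` unit_cube)"
  obtains u where "multiband I l u"
    and "\<And>x. (\<Sum>\<^sub>\<infinity>j\<in>int_lattice. ennreal ((cmod (f (x + j)))\<^sup>2)) = ennreal (multiband.energy I l u x)"
    and "ennreal ((L2_norm f)\<^sup>2) = (\<Sum>i\<in>I. \<integral>\<^sup>+\<omega>. ennreal ((cmod (u i \<omega>))\<^sup>2) \<partial>lborel)"
proof -
  from f obtain g where f_L2: "f \<in> L2" and cont: "continuous_on UNIV f" and fg: "has_fourier_L2 f g"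
    and supp: "ess_support g \<subseteq> (\<Union>i\<in>I. (\<lambda>y. y + l i) ` unit_cube)"
    unfolding paley_wiener_def by blast
  have g_L2: "g \<in> L2" using fg by (simp add: has_fourier_L2_def)
  note [measurable] = L2_D(1)[OF f_L2] L2_D(1)[OF g_L2]
  let ?C = "half_open_cube :: (real ^ 'd) set"
  define u where "u = (\<lambda>i \<omega>. indicator ?C \<omega> * g (l i + \<omega>))"
  have [measurable]: "u i \<in> borel_measurable borel" for i unfolding u_def by measurable
  have u_sq: "ennreal ((cmod (u i \<omega>))\<^sup>2) = indicator ?C \<omega> * ennreal ((cmod (g (l i + \<omega>)))\<^sup>2)" for i \<omega>
    by (simp add: u_def indicator_def)
  have "AE \<omega> in lborel. \<forall>i\<in>I. \<omega> - l i \<in> unit_cube \<longleftrightarrow> \<omega> - l i \<in> ?C"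
    by (intro AE_finite_allI I AE_translate_unit_cube_iff)
  then have AE1: "AE \<omega> in lborel. g \<omega> = 0 \<or> (\<exists>i\<in>I. \<omega> - l i \<in> ?C)"
    using AE_zero_outside_ess_support[of g]
  proof eventually_elim
    case (elim \<omega>)
    show ?case
    proof (cases "g \<omega> = 0")
      case False
      then obtain i where i: "i \<in> I" "\<omega> \<in> (\<lambda>y. y + l i) ` unit_cube" using elim supp by blast
      then have "\<omega> - l i \<in> unit_cube" by auto
      then show ?thesis using elim i by blast
    qed simp
  qed
  \<comment> \<open>Half-open cubes at distinct lattice points are disjoint, so at most one summand
    is nonzero. The type of \<open>c\<close> is general because complex and extended values both
    occur below.\<close>
  have sum_ind: "(\<Sum>i\<in>I. indicator ?C (\<omega> - l i) * c) = (if \<exists>i\<in>I. \<omega> - l i \<in> ?C then c else 0)"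
    for \<omega> and c :: "'b::semiring_1"
  proof (cases "\<exists>i\<in>I. \<omega> - l i \<in> ?C")
    case True
    then obtain i where i: "i \<in> I" "\<omega> - l i \<in> ?C" by blast
    have "indicator ?C (\<omega> - l k) * c = (if k = i then c else 0)" if "k \<in> I" for k
    proof (cases "k = i")
      case False
      then have "\<omega> - l k \<notin> ?C"
        using half_open_cube_diff_eq[of \<omega> "l k" "l i"] that i l inj by (auto dest: inj_onD)
      then show ?thesis using False by simp
    qed (use i in simp)
    then have "(\<Sum>k\<in>I. indicator ?C (\<omega> - l k) * c) = (\<Sum>k\<in>I. if k = i then c else 0)"
      by (intro sum.cong refl)
    also have "\<dots> = c" using I i by (simp add: sum.delta')
    finally show ?thesis using True by simp
  qed (auto intro!: sum.neutral)
  have AE_g: "AE \<omega> in lborel. g \<omega> * c \<omega> = (\<Sum>i\<in>I. indicator ?C (\<omega> - l i) * (g \<omega> * c \<omega>))" for c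
    using AE1 by eventually_elim (auto simp: sum_ind)
  have AE_g2: "AE \<omega> in lborel. ennreal ((cmod (g \<omega>))\<^sup>2) = (\<Sum>i\<in>I. indicator ?C (\<omega> - l i) * ennreal ((cmod (g \<omega>))\<^sup>2))"
    using AE1 by eventually_elim (auto simp: sum_ind)
  have norm_g: "(\<integral>\<^sup>+\<omega>. ennreal ((cmod (g \<omega>))\<^sup>2) \<partial>lborel) = (\<Sum>i\<in>I. \<integral>\<^sup>+\<omega>. ennreal ((cmod (u i \<omega>))\<^sup>2) \<partial>lborel)"
  proof -
    have "(\<integral>\<^sup>+\<omega>. ennreal ((cmod (g \<omega>))\<^sup>2) \<partial>lborel)
        = (\<integral>\<^sup>+\<omega>. (\<Sum>i\<in>I. indicator ?C (\<omega> - l i) * ennreal ((cmod (g \<omega>))\<^sup>2)) \<partial>lborel)"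
      by (rule nn_integral_cong_AE[OF AE_g2])
    also have "\<dots> = (\<Sum>i\<in>I. \<integral>\<^sup>+\<omega>. indicator ?C (\<omega> - l i) * ennreal ((cmod (g \<omega>))\<^sup>2) \<partial>lborel)"
      by (rule nn_integral_sum) measurable
    also have "\<dots> = (\<Sum>i\<in>I. \<integral>\<^sup>+\<omega>. ennreal ((cmod (u i \<omega>))\<^sup>2) \<partial>lborel)"
    proof (rule sum.cong[OF refl])
      fix i
      show "(\<integral>\<^sup>+\<omega>. indicator ?C (\<omega> - l i) * ennreal ((cmod (g \<omega>))\<^sup>2) \<partial>lborel) = (\<integral>\<^sup>+\<omega>. ennreal ((cmod (u i \<omega>))\<^sup>2) \<partial>lborel)"
        unfolding u_sq
        by (subst nn_integral_lborel_translate[symmetric, where t = "l i"]) simp_all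
    qed
    finally show ?thesis .
  qed
  have u_L2: "u i \<in> L2" if "i \<in> I" for i
  proof (rule L2_I)
    have "(\<integral>\<^sup>+\<omega>. ennreal ((cmod (u i \<omega>))\<^sup>2) \<partial>lborel) \<le> (\<integral>\<^sup>+\<omega>. ennreal ((cmod (g \<omega>))\<^sup>2) \<partial>lborel)"
      unfolding norm_g using I that by (intro member_le_sum) auto
    also have "\<dots> < \<infinity>" by (simp add: nn_integral_L2 g_L2)
    finally show "(\<integral>\<^sup>+\<omega>. ennreal ((cmod (u i \<omega>))\<^sup>2) \<partial>lborel) < \<infinity>" .
  qed simp
  interpret multiband I l u
  proof
    show "u i \<omega> = 0" if "\<omega> \<notin> ?C" for i \<omega> using that by (simp add: u_def)
  qed (use I l inj u_L2 in auto)
  have u_int: "integrable lborel (\<lambda>\<omega>. u i \<omega> * chr ((\<omega> + l i) \<bullet> x))" if "i \<in> I" for i x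
  proof (rule Bochner_Integration.integrable_bound)
    have "(\<lambda>\<omega>. u i \<omega> * indicator ?C \<omega>) = u i" by (auto simp: u_def indicator_def)
    then show "integrable lborel (u i)"
      using integrable_mult_L2[OF u_L2[OF that] indicator_half_open_cube_L2] by simp
  qed (auto simp: norm_mult)
  have shift: "indicator ?C (l i + \<omega> - l i) * (g (l i + \<omega>) * chr ((l i + \<omega>) \<bullet> x)) = u i \<omega> * chr ((\<omega> + l i) \<bullet> x)" for i \<omega> x
    by (simp add: u_def add.commute)
  have part_int: "integrable lborel (\<lambda>\<omega>. indicator ?C (\<omega> - l i) * (g \<omega> * chr (\<omega> \<bullet> x)))" if "i \<in> I" for i x
    using u_int[OF that, of x] unfolding shift[symmetric]
    by (subst (asm) integrable_lborel_translate_iff[where t = "l i" and f = "\<lambda>\<omega>. indicator ?C (\<omega> - l i) * (g \<omega> * chr (\<omega> \<bullet> x))"]) simp_all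
  have part_val: "(LINT \<omega>|lborel. indicator ?C (\<omega> - l i) * (g \<omega> * chr (\<omega> \<bullet> x))) = (LINT \<omega>|lborel. u i \<omega> * chr ((\<omega> + l i) \<bullet> x))" for i x
    unfolding shift[symmetric]
    by (subst integral_lborel_translate[where t = "l i" and f = "\<lambda>\<omega>. indicator ?C (\<omega> - l i) * (g \<omega> * chr (\<omega> \<bullet> x))"]) simp_all
  have sum_int: "integrable lborel (\<lambda>\<omega>. \<Sum>i\<in>I. indicator ?C (\<omega> - l i) * (g \<omega> * chr (\<omega> \<bullet> x)))" for x
    by (intro Bochner_Integration.integrable_sum part_int)
  have g_int: "integrable lborel g"
  proof (rule integrable_cong_AE_imp[OF sum_int[of 0]])
    show "AE \<omega> in lborel. (\<Sum>i\<in>I. indicator ?C (\<omega> - l i) * (g \<omega> * chr (\<omega> \<bullet> 0))) = g \<omega>"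
      using AE_g[of "\<lambda>_. 1"] by eventually_elim simp
  qed simp
  have synth_eq: "synth x = f x" for x
  proof -
    have "f x = (LINT \<omega>|lborel. g \<omega> * chr (\<omega> \<bullet> x))"
      using cont by (intro fourier_inversion[OF fg _ g_int]) (simp add: continuous_on_eq_continuous_at)
    also have "\<dots> = (LINT \<omega>|lborel. (\<Sum>i\<in>I. indicator ?C (\<omega> - l i) * (g \<omega> * chr (\<omega> \<bullet> x))))"
      by (intro integral_cong_AE AE_g) measurable
    also have "\<dots> = (\<Sum>i\<in>I. LINT \<omega>|lborel. indicator ?C (\<omega> - l i) * (g \<omega> * chr (\<omega> \<bullet> x)))"
      by (intro Bochner_Integration.integral_sum part_int)
    also have "\<dots> = (\<Sum>i\<in>I. LINT \<omega>|lborel. u i \<omega> * chr ((\<omega> + l i) \<bullet> x))"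
      unfolding part_val ..
    also have "\<dots> = synth x"
      unfolding synth_def fold_band_def by (intro Bochner_Integration.integral_sum[symmetric] u_int)
    finally show ?thesis ..
  qed
  \<comment> \<open>The hypothesis of \<open>sample_sum_eq_energy\<close>: the one-sided Plancherel
    inequality suffices there.\<close>
  have le: "(\<Sum>i\<in>I. \<integral>\<^sup>+\<omega>. ennreal ((cmod (u i \<omega>))\<^sup>2) \<partial>lborel) \<le> (\<integral>\<^sup>+x. ennreal ((cmod (f x))\<^sup>2) \<partial>lborel)"
    unfolding norm_g[symmetric] by (rule has_fourier_L2_norm_le[OF fg])
  have synth_fun: "synth = f" using synth_eq by blast
  have energy: "sample_sum x = ennreal (energy x)" for x
    by (rule sample_sum_eq_energy) (simp_all add: synth_fun le)
  show ?thesis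
  proof (rule that)
    show "multiband I l u" by unfold_locales
    show "(\<Sum>\<^sub>\<infinity>j\<in>int_lattice. ennreal ((cmod (f (x + j)))\<^sup>2)) = ennreal (energy x)" for x
      using energy[of x] unfolding sample_sum_def synth_fun .
    have "ennreal ((L2_norm f)\<^sup>2) = (\<integral>\<^sup>+x. ennreal ((cmod (f x))\<^sup>2) \<partial>lborel)"
      by (simp add: nn_integral_L2 f_L2)
    \<comment> \<open>Periodization and the equality of lattice sum and energy now give the full
      norm identity.\<close>
    also have "\<dots> = (\<integral>\<^sup>+x. indicator half_open_cube x * sample_sum x \<partial>lborel)"
      unfolding sample_sum_def synth_fun by (rule nn_integral_tiling) measurable
    also have "\<dots> = (\<Sum>i\<in>I. \<integral>\<^sup>+\<omega>. ennreal ((cmod (u i \<omega>))\<^sup>2) \<partial>lborel)"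
      unfolding energy by (rule nn_integral_energy_cube)
    finally show "ennreal ((L2_norm f)\<^sup>2) = (\<Sum>i\<in>I. \<integral>\<^sup>+\<omega>. ennreal ((cmod (u i \<omega>))\<^sup>2) \<partial>lborel)" .
  qed
qed

text \<open>Closedness, unlike measurability, survives intersection over the uncountable family of
  all Paley-Wiener functions.\<close>

lemma closed_product_bounds:
  fixes E :: "'x::topological_space \<Rightarrow> real"
  assumes "continuous_on UNIV E"
  shows "closed {x :: nat \<Rightarrow> 'x. a \<le> (\<Sum>r\<in>J. E (x r)) \<and> (\<Sum>r\<in>J. E (x r)) \<le> b}"
proof -
  have "continuous_on UNIV (\<lambda>x :: nat \<Rightarrow> 'x. E (x r))" for r
    by (rule continuous_on_compose2[OF assms]) (auto intro: continuous_on_product_coordinates)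
  then have "continuous_on UNIV (\<lambda>x :: nat \<Rightarrow> 'x. \<Sum>r\<in>J. E (x r))"
    by (intro continuous_intros)
  then show ?thesis
    unfolding Collect_conj_eq by (intro closed_Int closed_Collect_le continuous_on_const)
qed

text \<open>The minus sign compensates the conjugation in the first argument of \<open>ip\<close>,
  so that pairing with \<open>u\<close> gives the trigonometric polynomial with positive frequencies
  \<open>l i\<close>.\<close>

lemma isotropic_sampling_unit_cube:
  fixes l :: "'i \<Rightarrow> real ^ 'd"
  assumes I: "finite I" and l: "\<And>i. i \<in> I \<Longrightarrow> l i \<in> int_lattice" and inj: "inj_on l I"
  shows "isotropic_sampling (uniform_measure lborel unit_cube) I (\<lambda>y i. if i \<in> I then chr (- (l i \<bullet> y)) else 0)"
proof -
  let ?\<nu> = "uniform_measure lborel (unit_cube :: (real ^ 'd) set)"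
  have "prob_space ?\<nu>" by (rule prob_space_uniform_measure) (simp_all add: emeasure_unit_cube)
  then interpret prob_space ?\<nu> .
  show ?thesis
  proof
    fix i j assume ij: "i \<in> I" "j \<in> I"
    have "(LINT y|?\<nu>. chr (l i \<bullet> y) * chr (- (l j \<bullet> y))) = (LINT y|?\<nu>. chr ((l i - l j) \<bullet> y))"
      by (simp add: inner_diff_left flip: chr_add)
    also have "\<dots> = (LINT y|lborel. indicator unit_cube y *\<^sub>R chr ((l i - l j) \<bullet> y))"
      unfolding uniform_measure_unit_cube by (rule integral_density) auto
    also have "\<dots> = (LINT y|lborel. indicator half_open_cube y * chr ((l i - l j) \<bullet> y))"
    proof (rule integral_cong_AE)
      show "AE y in lborel. indicator unit_cube y *\<^sub>R chr ((l i - l j) \<bullet> y) = indicator half_open_cube y * chr ((l i - l j) \<bullet> y)"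
        using AE_unit_cube_iff by eventually_elim (simp add: indicator_def)
    qed measurable
    also have "\<dots> = of_bool (i = j)"
      using ij inj by (auto simp: integral_chr_cube int_lattice_diff l inj_on_def)
    finally show "(LINT y|?\<nu>. cnj (if i \<in> I then chr (- (l i \<bullet> y)) else 0) * (if j \<in> I then chr (- (l j \<bullet> y)) else 0)) = of_bool (i = j)"
      using ij by simp
  next
    fix i
    show "(\<lambda>y. if i \<in> I then chr (- (l i \<bullet> y)) else 0) \<in> borel_measurable ?\<nu>"
      by (simp cong: measurable_cong_sets)
  qed (use I in auto)
qed

section \<open>From the matrix inequality to the sampled functions\<close>

context multiband
begin

text \<open>The matrix inequality is applied at each \<omega> to the vector of band values, up to a
  common unimodular factor of the folded spectrum, and integrated over \<omega>.\<close>

lemma sum_energy_bounds: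
  assumes J: "finite J"
    and bound: "\<And>w. (\<forall>i. i \<notin> I \<longrightarrow> w i = 0) \<Longrightarrow>
      a * (\<Sum>i\<in>I. (cmod (w i))\<^sup>2) \<le> (\<Sum>r\<in>J. (cmod (\<Sum>i\<in>I. w i * chr (l i \<bullet> X r)))\<^sup>2) \<and>
      (\<Sum>r\<in>J. (cmod (\<Sum>i\<in>I. w i * chr (l i \<bullet> X r)))\<^sup>2) \<le> b * (\<Sum>i\<in>I. (cmod (w i))\<^sup>2)"
  shows "a * (\<Sum>i\<in>I. (L2_norm (u i))\<^sup>2) \<le> (\<Sum>r\<in>J. energy (X r))"
    and "(\<Sum>r\<in>J. energy (X r)) \<le> b * (\<Sum>i\<in>I. (L2_norm (u i))\<^sup>2)"
proof -
  let ?U = "\<lambda>\<omega>. \<Sum>i\<in>I. (cmod (u i \<omega>))\<^sup>2" and ?S = "\<lambda>\<omega>. \<Sum>r\<in>J. (cmod (fold_band (X r) \<omega>))\<^sup>2"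
  have U_int: "integrable lborel ?U" by (intro Bochner_Integration.integrable_sum L2_D(2) u_L2)
  have S_int: "integrable lborel ?S" by (intro Bochner_Integration.integrable_sum L2_D(2) fold_band_L2)
  have U_val: "(LINT \<omega>|lborel. ?U \<omega>) = (\<Sum>i\<in>I. (L2_norm (u i))\<^sup>2)"
    by (simp add: Bochner_Integration.integral_sum L2_D(2) u_L2 L2_norm_def)
  have S_val: "(LINT \<omega>|lborel. ?S \<omega>) = (\<Sum>r\<in>J. energy (X r))"
    unfolding energy_def by (intro Bochner_Integration.integral_sum L2_D(2) fold_band_L2)
  have *: "a * ?U \<omega> \<le> ?S \<omega> \<and> ?S \<omega> \<le> b * ?U \<omega>" for \<omega>
    using bound[of "\<lambda>i. if i \<in> I then u i \<omega> else 0"] by (simp add: cmod_fold_band cong: sum.cong_simp)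
  have "(LINT \<omega>|lborel. a * ?U \<omega>) \<le> (LINT \<omega>|lborel. ?S \<omega>)" "(LINT \<omega>|lborel. ?S \<omega>) \<le> (LINT \<omega>|lborel. b * ?U \<omega>)"
    using * by (intro Bochner_Integration.integral_mono integrable_mult_right U_int S_int; simp)+
  then show "a * (\<Sum>i\<in>I. (L2_norm (u i))\<^sup>2) \<le> (\<Sum>r\<in>J. energy (X r))"
    and "(\<Sum>r\<in>J. energy (X r)) \<le> b * (\<Sum>i\<in>I. (L2_norm (u i))\<^sup>2)"
    unfolding integral_mult_right_zero U_val S_val by auto
qed

lemma energy_nonneg: "0 \<le> energy x"
  by (simp add: energy_def)

end

theorem mainTheorem2:
  fixes l :: "nat \<Rightarrow> real ^ 'd"
    and k m :: nat
    and \<Omega> :: "(real ^ 'd) set"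
    and M :: "'a measure"
    and X :: "nat \<Rightarrow> 'a \<Rightarrow> real ^ 'd"
    and \<epsilon> \<alpha> :: real
  assumes "k \<ge> 1"
    and "\<And>i. i \<in> {1..k} \<Longrightarrow> l i \<in> int_lattice"
    and "inj_on l {1..k}"
    and "\<Omega> = (\<Union>i\<in>{1..k}. (\<lambda>y. y + l i) ` unit_cube)"
    and "prob_space M"
    and "prob_space.indep_vars M (\<lambda>_. borel) X {1..m}"
    and "\<And>r. r \<in> {1..m} \<Longrightarrow> distr M borel (X r) = uniform_measure lborel unit_cube"
    and "\<epsilon> > 0"
    and "0 < \<alpha>" and "\<alpha> < 1"
    and "real m \<ge> 10 / \<alpha>\<^sup>2 * real k * ln (2 * real k / \<epsilon>)"
  shows "measure M {w \<in> space M. \<forall>f \<in> paley_wiener \<Omega>.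
      ennreal (real m * (1 - \<alpha>) * (L2_norm f)\<^sup>2)
        \<le> (\<Sum>r = 1..m. \<Sum>\<^sub>\<infinity>j\<in>int_lattice. ennreal ((cmod (f (X r w + j)))\<^sup>2)) \<and>
      (\<Sum>r = 1..m. \<Sum>\<^sub>\<infinity>j\<in>int_lattice. ennreal ((cmod (f (X r w + j)))\<^sup>2))
        \<le> ennreal (real m * (1 + \<alpha>) * (L2_norm f)\<^sup>2)} \<ge> 1 - \<epsilon>"
proof (cases "\<epsilon> < 1")
  \<comment> \<open>For \<epsilon> \<ge> 1 the claim is trivial. Otherwise 2k/\<epsilon> > 1, and
    the hypothesis on \<open>m\<close> forces \<open>m\<close> to be positive, so that the sample is
    nonempty.\<close>
  case False
  then have "1 - \<epsilon> \<le> 0" by simp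
  then show ?thesis by (rule order_trans[OF _ measure_nonneg])
next
  case True
  interpret M: prob_space M by (rule assms(5))
  let ?I = "{1..k}" and ?J = "{1..m}" and ?\<nu> = "uniform_measure lborel (unit_cube :: (real ^ 'd) set)"
  define V where "V = (\<lambda>(y :: real ^ 'd) i. if i \<in> ?I then chr (- (l i \<bullet> y)) else 0)"
  have ln_pos: "0 < ln (2 * real k / \<epsilon>)"
    using assms(1,8) True by (intro ln_gt_zero) (simp add: field_simps)
  then have "0 < 10 / \<alpha>\<^sup>2 * real k * ln (2 * real k / \<epsilon>)"
    using assms(1,9) by simp
  then have m: "0 < m" using assms(11) by linarith
  interpret S: isotropic_sampling ?\<nu> ?I V
    unfolding V_def using assms(2,3) by (intro isotropic_sampling_unit_cube) auto
  have J: "finite ?J" "?J \<noteq> {}" and I: "?I \<noteq> {}" using m assms(1) by auto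
  have rv: "X r \<in> M \<rightarrow>\<^sub>M borel" if "r \<in> ?J" for r
    using assms(6) that unfolding M.indep_vars_def by blast
  have ip_V: "ip ?I (V y) u = (\<Sum>i\<in>?I. u i * chr (l i \<bullet> y))" for y u
    by (simp add: ip_def V_def mult.commute)
  \<comment> \<open>The failure probability allotted to one tail; half of \<epsilon> is enough
    because 1/10 \<le> 1/8 in the exponent.\<close>
  define \<eta> where "\<eta> = real k * exp (- \<alpha>\<^sup>2 * real m / (8 * real k))"
  have "\<eta> \<le> \<epsilon> / 2"
  proof -
    have "ln (2 * real k / \<epsilon>) \<le> \<alpha>\<^sup>2 * real m / (10 * real k)"
      using assms(1,9,11) by (simp add: field_simps)
    also have "\<dots> \<le> \<alpha>\<^sup>2 * real m / (8 * real k)"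
      using assms(1) by (intro divide_left_mono) auto
    finally have "exp (- (\<alpha>\<^sup>2 * real m / (8 * real k))) \<le> exp (- ln (2 * real k / \<epsilon>))" by simp
    also have "\<dots> = \<epsilon> / (2 * real k)"
      using assms(1,8) by (simp add: exp_minus)
    finally have "\<eta> \<le> real k * (\<epsilon> / (2 * real k))"
      unfolding \<eta>_def by (intro mult_left_mono) auto
    then show ?thesis using assms(1) by simp
  qed
  have tail: "\<exists>A\<in>sets M. measure M A \<le> \<eta> \<and> (\<forall>w\<in>space M - A. \<forall>u. (\<forall>i. i \<notin> ?I \<longrightarrow> u i = 0) \<longrightarrow>
      \<sigma> * (\<Sum>r\<in>?J. (cmod (\<Sum>i\<in>?I. u i * chr (l i \<bullet> X r w)))\<^sup>2)
        \<le> \<sigma> * ((1 + \<sigma> * \<alpha>) * real m) * (\<Sum>i\<in>?I. (cmod (u i))\<^sup>2))" if "\<sigma> \<in> {-1, 1}" for \<sigma>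
    using S.frame_sum_tail[OF assms(5) J assms(6,7) that assms(9,10) I]
    unfolding ip_V \<eta>_def by simp
  from tail[of 1] obtain A where A: "A \<in> sets M" "measure M A \<le> \<eta>"
    and up: "\<And>w u. w \<in> space M - A \<Longrightarrow> \<forall>i. i \<notin> ?I \<longrightarrow> u i = 0 \<Longrightarrow>
      (\<Sum>r\<in>?J. (cmod (\<Sum>i\<in>?I. u i * chr (l i \<bullet> X r w)))\<^sup>2) \<le> (1 + \<alpha>) * real m * (\<Sum>i\<in>?I. (cmod (u i))\<^sup>2)"
    by auto
  from tail[of "-1"] obtain B where B: "B \<in> sets M" "measure M B \<le> \<eta>"
    and low: "\<And>w u. w \<in> space M - B \<Longrightarrow> \<forall>i. i \<notin> ?I \<longrightarrow> u i = 0 \<Longrightarrow>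
      (1 - \<alpha>) * real m * (\<Sum>i\<in>?I. (cmod (u i))\<^sup>2) \<le> (\<Sum>r\<in>?J. (cmod (\<Sum>i\<in>?I. u i * chr (l i \<bullet> X r w)))\<^sup>2)"
    by auto
  \<comment> \<open>A condition on points \<open>x\<close> of the product space rather than on
    outcomes, so that topology can be used for measurability.\<close>
  define good where "good = (\<lambda>f (x :: nat \<Rightarrow> real ^ 'd).
      ennreal (real m * (1 - \<alpha>) * (L2_norm f)\<^sup>2)
        \<le> (\<Sum>r = 1..m. \<Sum>\<^sub>\<infinity>j\<in>int_lattice. ennreal ((cmod (f (x r + j)))\<^sup>2)) \<and>
      (\<Sum>r = 1..m. \<Sum>\<^sub>\<infinity>j\<in>int_lattice. ennreal ((cmod (f (x r + j)))\<^sup>2))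
        \<le> ennreal (real m * (1 + \<alpha>) * (L2_norm f)\<^sup>2))"
  let ?E = "{w \<in> space M. \<forall>f \<in> paley_wiener \<Omega>. good f (\<lambda>r. X r w)}"
  have multiband: "\<exists>u. multiband ?I l u \<and> (L2_norm f)\<^sup>2 = (\<Sum>i\<in>?I. (L2_norm (u i))\<^sup>2) \<and>
      (\<forall>x. good f x \<longleftrightarrow> real m * (1 - \<alpha>) * (L2_norm f)\<^sup>2 \<le> (\<Sum>r\<in>?J. multiband.energy ?I l u (x r)) \<and>
        (\<Sum>r\<in>?J. multiband.energy ?I l u (x r)) \<le> real m * (1 + \<alpha>) * (L2_norm f)\<^sup>2)"
    if f: "f \<in> paley_wiener \<Omega>" for f
  proof -
    obtain u where u: "multiband ?I l u"
      and en: "\<And>x. (\<Sum>\<^sub>\<infinity>j\<in>int_lattice. ennreal ((cmod (f (x + j)))\<^sup>2)) = ennreal (multiband.energy ?I l u x)"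
      and nrm: "ennreal ((L2_norm f)\<^sup>2) = (\<Sum>i\<in>?I. \<integral>\<^sup>+\<omega>. ennreal ((cmod (u i \<omega>))\<^sup>2) \<partial>lborel)"
      using f unfolding assms(4) by (rule paley_wiener_multiband[OF _ assms(2,3), rotated 2]) auto
    interpret multiband ?I l u by (rule u)
    have "ennreal ((L2_norm f)\<^sup>2) = ennreal (\<Sum>i\<in>?I. (L2_norm (u i))\<^sup>2)"
      unfolding nrm by (simp add: nn_integral_L2 u_L2)
    then have "(L2_norm f)\<^sup>2 = (\<Sum>i\<in>?I. (L2_norm (u i))\<^sup>2)"
      by (simp add: sum_nonneg)
    moreover have "good f x \<longleftrightarrow> real m * (1 - \<alpha>) * (L2_norm f)\<^sup>2 \<le> (\<Sum>r\<in>?J. energy (x r)) \<and>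
        (\<Sum>r\<in>?J. energy (x r)) \<le> real m * (1 + \<alpha>) * (L2_norm f)\<^sup>2" for x
    proof -
      have "(\<Sum>r\<in>?J. ennreal (energy (x r))) = ennreal (\<Sum>r\<in>?J. energy (x r))"
        by (intro sum_ennreal energy_nonneg)
      moreover have "0 \<le> (\<Sum>r\<in>?J. energy (x r))" by (intro sum_nonneg energy_nonneg)
      moreover have "0 \<le> real m * (1 + \<alpha>) * (L2_norm f)\<^sup>2" using assms(9) by simp
      ultimately show ?thesis unfolding good_def en by (simp only: ennreal_le_iff)
    qed
    ultimately show ?thesis using u by blast
  qed
  have "?E \<in> sets M"
  proof -
    define K where "K = (\<Inter>f\<in>paley_wiener \<Omega>. {x. good f x})"
    have "closed {x. good f x}" if f: "f \<in> paley_wiener \<Omega>" for f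
    proof -
      obtain u where u: "multiband ?I l u"
        and eq: "\<And>x. good f x \<longleftrightarrow> real m * (1 - \<alpha>) * (L2_norm f)\<^sup>2 \<le> (\<Sum>r\<in>?J. multiband.energy ?I l u (x r)) \<and>
        (\<Sum>r\<in>?J. multiband.energy ?I l u (x r)) \<le> real m * (1 + \<alpha>) * (L2_norm f)\<^sup>2"
        using multiband[OF f] by blast
      show ?thesis
        unfolding eq by (rule closed_product_bounds[OF multiband.continuous_energy[OF u]])
    qed
    then have K: "K \<in> sets borel" unfolding K_def by (intro borel_closed closed_INT) blast
    \<comment> \<open>Coordinates outside the sample are set to 0, which makes every coordinate
      measurable; \<open>good\<close> reads only the coordinates in \<open>?J\<close>.\<close>
    define Y where "Y = (\<lambda>w r. if r \<in> ?J then X r w else 0)"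
    have "Y \<in> M \<rightarrow>\<^sub>M borel"
    proof (rule measurable_coordinatewise_then_product)
      show "(\<lambda>w. Y w r) \<in> M \<rightarrow>\<^sub>M borel" for r
      proof (cases "r \<in> ?J")
        case True
        then show ?thesis unfolding Y_def by (simp only: if_True rv)
      next
        case False
        then show ?thesis unfolding Y_def by (simp only: if_False) simp
      qed
    qed
    then have "Y -` K \<inter> space M \<in> sets M" using K by (rule measurable_sets)
    moreover have "good f (Y w) \<longleftrightarrow> good f (\<lambda>r. X r w)" for f w
      unfolding good_def Y_def by (simp cong: sum.cong_simp)
    then have "Y -` K \<inter> space M = ?E" unfolding K_def by auto
    ultimately show ?thesis by simp
  qed
  moreover have "space M - (A \<union> B) \<subseteq> ?E"
  proof
    fix w assume w: "w \<in> space M - (A \<union> B)"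
    have "good f (\<lambda>r. X r w)" if f: "f \<in> paley_wiener \<Omega>" for f
    proof -
      obtain u where u: "multiband ?I l u" and nrm: "(L2_norm f)\<^sup>2 = (\<Sum>i\<in>?I. (L2_norm (u i))\<^sup>2)"
        and eq: "\<And>x. good f x \<longleftrightarrow> real m * (1 - \<alpha>) * (L2_norm f)\<^sup>2 \<le> (\<Sum>r\<in>?J. multiband.energy ?I l u (x r)) \<and>
        (\<Sum>r\<in>?J. multiband.energy ?I l u (x r)) \<le> real m * (1 + \<alpha>) * (L2_norm f)\<^sup>2"
        using multiband[OF f] by blast
      interpret multiband ?I l u by (rule u)
      have "(1 - \<alpha>) * real m * (\<Sum>i\<in>?I. (cmod (v i))\<^sup>2) \<le> (\<Sum>r\<in>?J. (cmod (\<Sum>i\<in>?I. v i * chr (l i \<bullet> X r w)))\<^sup>2) \<and>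
          (\<Sum>r\<in>?J. (cmod (\<Sum>i\<in>?I. v i * chr (l i \<bullet> X r w)))\<^sup>2) \<le> (1 + \<alpha>) * real m * (\<Sum>i\<in>?I. (cmod (v i))\<^sup>2)"
        if "\<forall>i. i \<notin> ?I \<longrightarrow> v i = 0" for v
        using low[OF _ that] up[OF _ that] w by blast
      note sum_energy_bounds[OF J(1) this]
      then show ?thesis unfolding eq nrm by (simp add: mult_ac)
    qed
    then show "w \<in> ?E" using w by blast
  qed
  ultimately have "measure M (space M - (A \<union> B)) \<le> measure M ?E"
    by (intro M.finite_measure_mono)
  moreover have "measure M (space M - (A \<union> B)) = 1 - measure M (A \<union> B)"
    using A B by (intro M.prob_compl) auto
  moreover have "measure M (A \<union> B) \<le> measure M A + measure M B"
    using A B by (intro measure_Un_le)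
  ultimately have "1 - \<epsilon> \<le> measure M ?E" using A B \<open>\<eta> \<le> \<epsilon> / 2\<close> by linarith
  then show ?thesis unfolding good_def .
qed

end
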